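(* Let $\mathcal{A}\subset\mathbb{R}^2$ be a rational origin-star-shaped polygon. Then $E_{\mathcal{A}}(t)=\Omega_{\pm}(t\sqrt{\log\log t})$, i.e. \[\limsup_{t\to\infty}\frac{E_{\mathcal{A}}(t)}{t\sqrt{\log\log t}}>0\quad\text{and}\quad \liminf_{t\to\infty}\frac{E_{\mathcal{A}}(t)}{t\sqrt{\log\log t}}<0.\]
   Context: A rational polygon is a polygon all of whose vertices have both coordinates rational. A set $\mathcal{B}$ is origin-star-shaped if $\lambda\mathcal{B}\subset\mathcal{B}$ for all $\lambda\in[0,1]$ (in particular it contains the origin). $\mathcal{P}=\{(m,n)\in\mathbb{Z}^2:\gcd(m,n)=1\}$ is the set of primitive lattice points, and $E_{\mathcal{A}}(t)=\#(t\mathcal{A}\cap\mathcal{P})-\frac{6}{\pi^2}t^2\,\mathrm{Area}(\mathcal{A})$. *)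

theory Defs
  imports "HOL-Analysis.Analysis"
begin

fun polygonal_path :: "(real^2) list \<Rightarrow> real \<Rightarrow> real^2" where
  "polygonal_path [] = linepath 0 0"
| "polygonal_path [a] = linepath a a"
| "polygonal_path [a, b] = linepath a b"
| "polygonal_path (a # b # c # vs) = linepath a b +++ polygonal_path (b # c # vs)"

text \<open>
  A polygon is the closed plane region bounded by a simple closed polygonal curve. Simplicity of
  the closed path excludes all degenerate vertex lists (fewer than three vertices, repeated vertices,
  collinear vertices only, crossing or touching edges), so the region always has positive area.
  Points with a straight angle are permitted in the list.
\<close>

definition polygon_with_vertices :: "(real^2) list \<Rightarrow> (real^2) set \<Rightarrow> bool" where
  "polygon_with_vertices vs A \<longleftrightarrow>
     (let C = polygonal_path (vs @ [hd vs]) in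
        simple_path C \<and> A = path_image C \<union> inside (path_image C))"

text \<open>
  Straight-angle points in the list make no difference here: every list bounding \<open>A\<close> contains
  the proper vertices of \<open>A\<close>, and the proper vertices alone form such a list.
\<close>

definition rational_polygon :: "(real^2) set \<Rightarrow> bool" where
  "rational_polygon A \<longleftrightarrow>
     (\<exists>vs. polygon_with_vertices vs A \<and> (\<forall>v\<in>set vs. \<forall>i. v $ i \<in> \<rat>))"

definition origin_star_shaped :: "(real^2) set \<Rightarrow> bool" where
  "origin_star_shaped B \<longleftrightarrow> (\<forall>c\<in>{0..1}. (\<lambda>x. c *\<^sub>R x) ` B \<subseteq> B)"

definition primitive_points :: "(real^2) set" where
  "primitive_points = {vector [of_int m, of_int n] | m n :: int. gcd m n = 1}"

definition primitive_error :: "(real^2) set \<Rightarrow> real \<Rightarrow> real" where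
  "primitive_error A t =
     real (card ((\<lambda>x. t *\<^sub>R x) ` A \<inter> primitive_points)) - 6 / pi\<^sup>2 * t\<^sup>2 * measure lebesgue A"

end

theory Submission
  imports Defs "HOL-Computational_Algebra.Squarefree" "HOL-Real_Asymp.Real_Asymp"
begin

text \<open>
  A ray from a point of \<open>A\<close> away from the origin leaves the bounded set \<open>A\<close> through an edge, so \<open>A\<close> is
  the union of the triangles spanned by the origin and the edges. Cut the plane by finitely many
  rational lines through the origin; on each cell, \<open>A\<close> is given by a single inequality \<open>w \<bullet> x \<le> 1\<close>
  with rational \<open>w\<close>. Hence the number of nonzero lattice points in \<open>t A\<close> is
  \<open>t\<^sup>2 Area(A) - t \<Sum> w i saw(h i t) + c t + O(1)\<close> with \<open>w i \<ge> 0\<close>, rational \<open>h i > 0\<close> and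
  \<open>saw x = frac x - 1/2\<close>, and Moebius inversion turns this into
  \<open>E(t)/t = - \<Sum> w i \<Sum>d. mu d/d saw(h i t/d) + O(1)\<close>.

  As in Montgomery's work on the mean of Euler's function, this is averaged over a progression
  \<open>t = \<alpha> (q k + b)\<close>, where \<open>q\<close> is the product of the primes \<open>p \<equiv> 3 (mod 4)\<close> up to \<open>z\<close> and \<open>b\<close> is
  \<open>q/4\<close> or \<open>3q/4\<close>. Small \<open>d\<close> contribute their mean over a full period, and for large \<open>d\<close> the sums
  over \<open>k\<close> are Riemann sums of a function of mean zero; all errors are \<open>O(1)\<close>, without any prime
  number theorem. The mean is a constant times \<open>\<Sum>g | q. mu g/g saw(b/g)\<close>, in which all terms have
  the same sign, so it is of size \<open>\<Prod>p | q. (1 + 1/p)\<close>, which is of order \<open>sqrt (ln z)\<close>.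
\<close>

subsection \<open>The Moebius function\<close>

text \<open>The obstacle is cancellation: each edge has its own sawtooth series, and a large value
  of one could be offset by another. Star-shapedness makes the weights nonnegative, and rationality
  lets one scale \<alpha> turn all frequencies into reciprocals of integers n i. If q is coprime to
  every n i, the means of all these series are positive multiples of one and the same sum. The
  constant sign comes from the character chi modulo 4: saw (k/4) = - chi k / 4 for odd k, and chi
  agrees with mu on products of distinct primes 3 modulo 4. The shifts q/4 and 3q/4 give opposite
  signs, which yields both one-sided statements. The progression has q^2 terms, starting at k = q^2,
  so t is of order q^3. This balances the errors: for d up to q^2 each d costs O(1), and beyond that
  each of the O(q^3) values of d costs O(1/q) up to a summable part, so the total is O(q^2), the
  number of terms. A lower bound for the product over primes 3 modulo 4 needs only an upper bound
  over primes 1 modulo 4, hence only an upper bound for L(s, chi), which is immediate from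
  alternating signs.\<close>

definition mu :: "nat \<Rightarrow> real" where
  "mu n = (if squarefree n then (-1) ^ card (prime_factors n) else 0)"

lemma abs_mu_le_1: "\<bar>mu n\<bar> \<le> 1"
  by (simp add: mu_def)

lemma mu_0 [simp]: "mu 0 = 0"
  by (simp add: mu_def)

lemma mu_1 [simp]: "mu 1 = 1" "mu (Suc 0) = 1"
  by (simp_all add: mu_def)

lemma mu_mult_coprime:
  assumes "coprime a b"
  shows "mu (a * b) = mu a * mu b"
proof (cases "a = 0 \<or> b = 0")
  case False
  have "prime_factors (a * b) = prime_factors a \<union> prime_factors b"
    using False by (simp add: prime_factors_product)
  moreover have "prime_factors a \<inter> prime_factors b = {}"
    using assms by (auto simp: in_prime_factors_iff) (meson coprime_common_divisor not_prime_unit)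
  ultimately have "card (prime_factors (a * b)) = card (prime_factors a) + card (prime_factors b)"
    by (simp add: card_Un_disjoint)
  moreover have "squarefree (a * b) \<longleftrightarrow> squarefree a \<and> squarefree b"
    using assms squarefree_mult_coprime squarefree_multD by blast
  ultimately show ?thesis
    by (auto simp: mu_def power_add)
qed auto

lemma mu_prime: "prime p \<Longrightarrow> mu p = -1"
  by (simp add: mu_def squarefree_prime prime_factorization_prime)

text \<open>Multiplication by a fixed prime factor \<open>p\<close> of \<open>n\<close> matches the
  squarefree divisors prime to \<open>p\<close> with those divisible by \<open>p\<close> and
  reverses the sign of \<open>mu\<close>.\<close>

lemma sum_mu_divisors:
  fixes n :: nat
  assumes "n > 0"
  shows "(\<Sum>d | d dvd n. mu d) = (if n = 1 then 1 else 0)"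
proof (cases "n = 1")
  case False
  then obtain p where p: "prime p" "p dvd n"
    using prime_factor_nat by blast
  have fin: "finite {d. d dvd n}" using assms by simp
  have prod: "{d. d dvd n \<and> p dvd d \<and> squarefree d} = (\<lambda>d. p * d) ` {d. d dvd n \<and> \<not> p dvd d \<and> squarefree d}"
  proof (intro equalityI subsetI)
    fix d assume "d \<in> {d. d dvd n \<and> p dvd d \<and> squarefree d}"
    then have d: "d dvd n" "p dvd d" "squarefree d" by auto
    then obtain e where e: "d = p * e" by blast
    have "\<not> p dvd e"
    proof
      assume "p dvd e"
      then have "p ^ 2 dvd d" using e by (auto simp: power2_eq_square)
      then show False using d(3) p(1) squarefreeD not_prime_unit by blast
    qed
    moreover have "e dvd n" using d e by (meson dvd_mult_right)
    moreover have "squarefree e" using d e squarefree_multD by blast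
    ultimately show "d \<in> (\<lambda>d. p * d) ` {d. d dvd n \<and> \<not> p dvd d \<and> squarefree d}"
      using e by blast
  next
    fix d assume "d \<in> (\<lambda>d. p * d) ` {d. d dvd n \<and> \<not> p dvd d \<and> squarefree d}"
    then obtain e where e: "d = p * e" "e dvd n" "\<not> p dvd e" "squarefree e" by blast
    have "coprime p e" using e p prime_imp_coprime by blast
    then show "d \<in> {d. d dvd n \<and> p dvd d \<and> squarefree d}"
      using e p by (simp add: divides_mult squarefree_mult_coprime squarefree_prime)
  qed
  have "(\<Sum>d | d dvd n. mu d) = (\<Sum>d | d dvd n \<and> squarefree d. mu d)"
    by (rule sum.mono_neutral_right) (use fin in \<open>auto simp: mu_def\<close>)
  also have "{d. d dvd n \<and> squarefree d} =
      {d. d dvd n \<and> \<not> p dvd d \<and> squarefree d} \<union> {d. d dvd n \<and> p dvd d \<and> squarefree d}"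
    by auto
  also have "(\<Sum>d\<in>\<dots>. mu d) = (\<Sum>d\<in>{d. d dvd n \<and> \<not> p dvd d \<and> squarefree d}. mu d)
      + (\<Sum>d\<in>{d. d dvd n \<and> p dvd d \<and> squarefree d}. mu d)"
    by (rule sum.union_disjoint) (auto intro: finite_subset[OF _ fin])
  also have "(\<Sum>d\<in>{d. d dvd n \<and> p dvd d \<and> squarefree d}. mu d)
      = (\<Sum>d\<in>{d. d dvd n \<and> \<not> p dvd d \<and> squarefree d}. mu (p * d))"
    unfolding prod using p by (subst sum.reindex) (auto simp: inj_on_def)
  also have "\<dots> = (\<Sum>d\<in>{d. d dvd n \<and> \<not> p dvd d \<and> squarefree d}. - mu d)"
    by (rule sum.cong) (use p in \<open>auto simp: mu_mult_coprime mu_prime prime_imp_coprime\<close>)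
  finally show ?thesis using False by (simp add: sum_negf)
qed (simp add: mu_def)

lemma sum_divisor_swap:
  fixes f :: "nat \<Rightarrow> nat \<Rightarrow> real"
  shows "(\<Sum>d=1..N. \<Sum>m=1..N div d. f d m) = (\<Sum>n=1..N. \<Sum>d | d dvd n. f d (n div d))"
proof -
  have "(\<Sum>d=1..N. \<Sum>m=1..N div d. f d m) = (\<Sum>(d,m)\<in>Sigma {1..N} (\<lambda>d. {1..N div d}). f d m)"
    by (simp add: sum.Sigma)
  also have "\<dots> = (\<Sum>(n,d)\<in>Sigma {1..N} (\<lambda>n. {d. d dvd n}). f d (n div d))"
  proof (rule sum.reindex_bij_witness[of _ "\<lambda>(n,d). (d, n div d)" "\<lambda>(d,m). (d * m, d)"], goal_cases)
    case (2 x)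
    then show ?case
      by (cases x) (auto simp: Suc_le_eq less_eq_div_iff_mult_less_eq mult.commute)
  next
    case (4 x)
    obtain n d where x: "x = (n, d)" by (cases x)
    have n: "1 \<le> n" "n \<le> N" "d dvd n" using 4 x by auto
    then have "d > 0" "d \<le> n" using dvd_imp_le[of d n] by (auto intro: Nat.gr0I)
    then show ?case using n x by (auto simp: Suc_le_eq div_greater_zero_iff div_le_mono)
  qed (auto simp: Suc_le_eq)
  also have "\<dots> = (\<Sum>n=1..N. \<Sum>d | d dvd n. f d (n div d))"
    by (subst sum.Sigma) auto
  finally show ?thesis .
qed

text \<open>Collecting the terms with d m = n leaves the divisor sum of \<open>mu\<close> at n. The
  instances f m = 1 and f m = 1 / m^2 control the partial sums of mu d / d and mu d / d^2.\<close>

lemma sum_mu_sum: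
  fixes f :: "nat \<Rightarrow> real"
  assumes "N \<ge> 1"
  shows "(\<Sum>d=1..N. mu d * (\<Sum>m=1..N div d. f (d * m))) = f 1"
proof -
  have "(\<Sum>d=1..N. mu d * (\<Sum>m=1..N div d. f (d * m))) = (\<Sum>n=1..N. \<Sum>d | d dvd n. mu d * f (d * (n div d)))"
    by (simp only: sum_distrib_left sum_divisor_swap)
  also have "\<dots> = (\<Sum>n=1..N. (\<Sum>d | d dvd n. mu d) * f n)"
    by (auto simp: sum_distrib_right intro!: sum.cong)
  also have "\<dots> = (\<Sum>n=1..N. (if n = 1 then f n else 0))"
    by (rule sum.cong) (auto simp: sum_mu_divisors)
  also have "\<dots> = f 1"
    using assms by (subst sum.delta) auto
  finally show ?thesis .
qed

section \<open>Partial sums of mu(d)/d and mu(d)/d^2\<close>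

lemma real_div_bounds:
  "real (N div d) \<le> real N / real d" "real N / real d \<le> real (N div d) + 1"
proof -
  show "real (N div d) \<le> real N / real d" by (rule of_nat_div_le_of_nat)
  show "real N / real d \<le> real (N div d) + 1"
  proof (cases "d = 0")
    case False
    have "N < (N div d + 1) * d"
      using False div_less_iff_less_mult[of d N "N div d + 1"] by simp
    then have "real N \<le> real ((N div d + 1) * d)" by linarith
    then show ?thesis using False by (simp add: divide_simps algebra_simps)
  qed auto
qed

text \<open>The sum of mu d * (N div d) is 1, and replacing N div d by N / d changes each term by at
  most 1. The bound controls the linear term c t of the lattice counts after Moebius
  inversion.\<close>

lemma abs_sum_mu_over_d: "\<bar>\<Sum>d=1..N. mu d / d\<bar> \<le> 2"
proof (cases "N = 0")
  case False
  have "(\<Sum>d=1..N. mu d * real (N div d)) = 1"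
    using sum_mu_sum[of N "\<lambda>_. 1"] False by simp
  then have "\<bar>N * (\<Sum>d=1..N. mu d / d) - 1\<bar> = \<bar>\<Sum>d=1..N. mu d * (N / d - real (N div d))\<bar>"
    by (simp add: sum_distrib_left right_diff_distrib sum_subtractf mult_ac)
  also have "\<dots> \<le> (\<Sum>d=1..N. 1)"
  proof (rule order_trans[OF sum_abs], rule sum_mono)
    fix d
    have "0 \<le> real N / real d - real (N div d)" "real N / real d - real (N div d) \<le> 1"
      using real_div_bounds[of N d] by auto
    then show "\<bar>mu d * (N / d - real (N div d))\<bar> \<le> 1"
      by (simp add: abs_mult abs_mu_le_1 mult_le_one)
  qed
  finally have "\<bar>N * (\<Sum>d=1..N. mu d / d) - 1\<bar> \<le> N" by simp
  then have "\<bar>N * (\<Sum>d=1..N. mu d / d)\<bar> \<le> 2 * N" using False by linarith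
  then show ?thesis using False by (simp add: abs_mult)
qed auto

lemma sum_inverse_squares_tail:
  assumes "k \<ge> 1"
  shows "(\<Sum>m=k+1..n. 1 / (real m)^2) \<le> 1 / real k"
proof (cases "n \<ge> k")
  case True
  then have "(\<Sum>m=k+1..n. 1 / (real m)^2) \<le> 1 / real k - 1 / real n"
  proof (induction n rule: dec_induct)
    case (step n)
    have "(\<Sum>m=k+1..Suc n. 1 / (real m)^2) = (\<Sum>m=k+1..n. 1 / (real m)^2) + 1 / (real (Suc n))^2"
      using step by simp
    moreover have "1 / (real (Suc n))^2 \<le> 1 / real n - 1 / real (Suc n)"
      using step.hyps(1) assms by (simp add: divide_simps power2_eq_square algebra_simps not_less add_pos_nonneg add_nonneg_nonneg)
    ultimately show ?case using step by linarith
  qed auto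
  moreover have "0 \<le> 1 / real n" by simp
  ultimately show ?thesis by linarith
qed auto

lemma inverse_squares_partial:
  assumes "N \<ge> 1"
  shows "\<bar>(\<Sum>m=1..N. 1 / (real m)^2) - pi\<^sup>2 / 6\<bar> \<le> 1 / N"
proof -
  have "(\<lambda>n. \<Sum>m<n. 1 / real (m + 1)^2) \<longlonglongrightarrow> pi\<^sup>2 / 6"
    using inverse_squares_sums by (simp add: sums_def add_ac)
  moreover have "(\<Sum>m<n. 1 / real (m + 1)^2) = (\<Sum>m=1..n. 1 / (real m)^2)" for n
    by (rule sum.reindex_bij_witness[of _ "\<lambda>m. m - 1" "\<lambda>m. m + 1"]) auto
  ultimately have lim: "(\<lambda>n. \<Sum>m=1..n. 1 / (real m)^2) \<longlonglongrightarrow> pi\<^sup>2 / 6" by simp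
  have split: "(\<Sum>m=1..n. 1 / (real m)^2) = (\<Sum>m=1..N. 1 / (real m)^2) + (\<Sum>m=N+1..n. 1 / (real m)^2)"
    if "n \<ge> N" for n
    using sum.ub_add_nat[of 1 N "\<lambda>m. 1 / (real m)^2" "n - N"] that assms by simp
  have "(\<Sum>m=1..n. 1 / (real m)^2) \<le> (\<Sum>m=1..N. 1 / (real m)^2) + 1 / N" if "n \<ge> N" for n
    using split[OF that] sum_inverse_squares_tail[OF assms, of n] by linarith
  then have "pi\<^sup>2 / 6 \<le> (\<Sum>m=1..N. 1 / (real m)^2) + 1 / N"
    using LIMSEQ_le_const2[OF lim] by blast
  moreover have "(\<Sum>m=1..N. 1 / (real m)^2) \<le> (\<Sum>m=1..n. 1 / (real m)^2)" if "n \<ge> N" for n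
    using split[OF that] sum_nonneg[of "{N+1..n}" "\<lambda>m. 1 / (real m)^2"] by simp
  then have "(\<Sum>m=1..N. 1 / (real m)^2) \<le> pi\<^sup>2 / 6"
    using LIMSEQ_le_const[OF lim] by blast
  ultimately show ?thesis by linarith
qed

lemma harm_le: "n \<ge> 1 \<Longrightarrow> (\<Sum>k=1..n. 1 / real k) \<le> 1 + ln n"
  using decseqD[OF decseq_harm_diff_ln, of 0 "n - 1"]
  by (simp add: harm_def inverse_eq_divide)

text \<open>The truncated Dirichlet product of mu d / d^2 with 1 / m^2 is exactly 1. Its inner sums
  stop at N div d; completing them to pi^2 / 6 costs at most 2 / (N d) for each d, in total O(ln N /
  N).\<close>

lemma sums_mu_over_squares: "(\<lambda>N. \<Sum>d=1..N. mu d / (real d)^2) \<longlonglongrightarrow> 6 / pi\<^sup>2"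
proof -
  have bound: "\<bar>(\<Sum>d=1..N. mu d / (real d)^2) * (pi\<^sup>2 / 6) - 1\<bar> \<le> 2 * (1 + ln N) / N"
    if N: "N \<ge> 1" for N
  proof -
    define S where "S d = (\<Sum>m=1..N div d. 1 / (real m)^2)" for d
    have S: "\<bar>mu d / (real d)^2 * (S d - pi\<^sup>2 / 6)\<bar> \<le> 2 / N * (1 / d)" if "d \<in> {1..N}" for d
    proof -
      have 1: "N div d \<ge> 1" using that by (simp add: less_eq_div_iff_mult_less_eq)
      have "real N / d \<le> real (N div d) + 1" by (rule real_div_bounds)
      then have "real N / d \<le> 2 * real (N div d)" using 1 by linarith
      then have 2: "1 / real (N div d) \<le> 2 * d / N"
        using that 1 by (simp add: field_simps)
      have "\<bar>S d - pi\<^sup>2 / 6\<bar> \<le> 2 * d / N"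
        using inverse_squares_partial[OF 1] 2 unfolding S_def by linarith
      then have "\<bar>mu d\<bar> * \<bar>S d - pi\<^sup>2 / 6\<bar> \<le> 1 * (2 * d / N)"
        using abs_mu_le_1[of d] by (intro mult_mono) auto
      then have "\<bar>mu d\<bar> * \<bar>S d - pi\<^sup>2 / 6\<bar> / (real d)^2 \<le> (2 * d / N) / (real d)^2"
        by (intro divide_right_mono) auto
      then show ?thesis using that by (simp add: abs_mult power2_eq_square mult.commute)
    qed
    have "(\<Sum>d=1..N. mu d / (real d)^2 * S d) = 1"
      using sum_mu_sum[OF N, of "\<lambda>m. 1 / (real m)^2"]
      by (simp add: S_def sum_distrib_left power_mult_distrib)
    then have "\<bar>(\<Sum>d=1..N. mu d / (real d)^2) * (pi\<^sup>2 / 6) - 1\<bar>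
        = \<bar>\<Sum>d=1..N. mu d / (real d)^2 * (S d - pi\<^sup>2 / 6)\<bar>"
      by (simp only: right_diff_distrib sum_subtractf sum_distrib_right abs_minus_commute)
    also have "\<dots> \<le> (\<Sum>d=1..N. 2 / N * (1 / d))"
      by (rule order_trans[OF sum_abs sum_mono[OF S]])
    also have "\<dots> = 2 / N * (\<Sum>d=1..N. 1 / d)"
      by (simp only: sum_distrib_left)
    also have "\<dots> \<le> 2 / N * (1 + ln N)"
      by (intro mult_left_mono harm_le N) auto
    finally show ?thesis by simp
  qed
  have "(\<lambda>N. (\<Sum>d=1..N. mu d / (real d)^2) * (pi\<^sup>2 / 6) - 1) \<longlonglongrightarrow> 0"
  proof (rule Lim_null_comparison)
    show "\<forall>\<^sub>F N in sequentially. norm ((\<Sum>d=1..N. mu d / (real d)^2) * (pi\<^sup>2 / 6) - 1) \<le> 2 * (1 + ln N) / N"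
      using bound by (intro eventually_sequentiallyI[of 1]) auto
    show "(\<lambda>N. 2 * (1 + ln (real N)) / real N) \<longlonglongrightarrow> 0" by real_asymp
  qed
  from tendsto_mult[OF tendsto_add[OF this tendsto_const[of 1]] tendsto_const[of "6 / pi\<^sup>2"]]
  show ?thesis by simp
qed

lemma sum_mu_over_squares:
  assumes "N \<ge> 1"
  shows "\<bar>(\<Sum>d=1..N. mu d / (real d)^2) - 6 / pi\<^sup>2\<bar> \<le> 1 / N"
proof -
  have "\<bar>(\<Sum>d=1..N. mu d / (real d)^2) - (\<Sum>d=1..n. mu d / (real d)^2)\<bar> \<le> 1 / N" if "n \<ge> N" for n
  proof -
    have "(\<Sum>d=1..n. mu d / (real d)^2) = (\<Sum>d=1..N. mu d / (real d)^2) + (\<Sum>d=N+1..n. mu d / (real d)^2)"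
      using sum.ub_add_nat[of 1 N "\<lambda>m. mu m / (real m)^2" "n - N"] that assms by simp
    moreover have "\<bar>\<Sum>d=N+1..n. mu d / (real d)^2\<bar> \<le> (\<Sum>d=N+1..n. 1 / (real d)^2)"
      by (rule order_trans[OF sum_abs sum_mono]) (simp add: divide_right_mono abs_mu_le_1)
    ultimately show ?thesis using sum_inverse_squares_tail[OF assms, of n] by linarith
  qed
  then have "\<forall>\<^sub>F n in sequentially. \<bar>(\<Sum>d=1..N. mu d / (real d)^2) - (\<Sum>d=1..n. mu d / (real d)^2)\<bar> \<le> 1 / N"
    by (intro eventually_sequentiallyI[of N]) auto
  then show ?thesis
    by (intro tendsto_upperbound[OF tendsto_rabs[OF tendsto_diff[OF tendsto_const sums_mu_over_squares]]]) auto
qed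

subsection \<open>Sawtooth sums along arithmetic progressions\<close>

definition saw :: "real \<Rightarrow> real" where
  "saw x = frac x - 1 / 2"

lemma abs_saw_le: "\<bar>saw x\<bar> \<le> 1 / 2"
  using frac_ge_0[of x] frac_lt_1[of x] unfolding saw_def by linarith

text \<open>This antiderivative of \<^const>\<open>saw\<close> is bounded, so Riemann sums of \<^const>\<open>saw\<close> are small.\<close>

definition saw_primitive :: "real \<Rightarrow> real" where
  "saw_primitive x = ((frac x)\<^sup>2 - frac x) / 2"

lemma saw_primitive_bounds: "-1/8 \<le> saw_primitive x" "saw_primitive x \<le> 0"
proof -
  have "0 \<le> (frac x - 1/2)\<^sup>2" by simp
  then show "-1/8 \<le> saw_primitive x"
    by (simp add: saw_primitive_def power2_eq_square algebra_simps)
  have "frac x * frac x \<le> frac x * 1"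
    using frac_ge_0[of x] frac_lt_1[of x] by (intro mult_left_mono) auto
  then show "saw_primitive x \<le> 0"
    by (simp add: saw_primitive_def power2_eq_square)
qed

text \<open>Where no integer is crossed, \<open>saw_primitive\<close> is quadratic with derivative
  \<open>saw\<close>, and the error is exactly \<gamma>^2 / 2. Crossing an integer costs at most
  another \<gamma>; the floors express this as a difference, so that it telescopes along a
  progression.\<close>

lemma saw_primitive_step:
  assumes "0 \<le> \<gamma>" "\<gamma> \<le> 1"
  shows "\<bar>saw_primitive (x + \<gamma>) - saw_primitive x - \<gamma> * saw x\<bar> \<le> \<gamma>\<^sup>2 / 2 + \<gamma> * of_int (\<lfloor>x + \<gamma>\<rfloor> - \<lfloor>x\<rfloor>)"
proof (cases "frac x + \<gamma> < 1")
  case True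
  then have fl: "\<lfloor>x + \<gamma>\<rfloor> = \<lfloor>x\<rfloor>"
    using assms by (intro floor_unique) (auto simp: frac_def, linarith)
  then have "frac (x + \<gamma>) = frac x + \<gamma>" by (simp add: frac_def)
  then have "saw_primitive (x + \<gamma>) - saw_primitive x - \<gamma> * saw x = \<gamma>\<^sup>2 / 2"
    by (simp add: saw_primitive_def saw_def power2_eq_square field_simps)
  moreover have "0 \<le> \<gamma>\<^sup>2 / 2" by simp
  ultimately show ?thesis using fl by (simp only:) simp
next
  case False
  then have fl: "\<lfloor>x + \<gamma>\<rfloor> = \<lfloor>x\<rfloor> + 1"
    using assms by (intro floor_unique) (auto simp: frac_def, linarith)
  then have fr: "frac (x + \<gamma>) = frac x + \<gamma> - 1" by (simp add: frac_def)
  have "saw_primitive (x + \<gamma>) - saw_primitive x - \<gamma> * saw x = \<gamma>\<^sup>2 / 2 - (frac x + \<gamma> - 1)"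
    unfolding saw_primitive_def saw_def fr by (simp add: power2_eq_square field_simps)
  moreover have "0 \<le> frac x + \<gamma> - 1" "frac x + \<gamma> - 1 \<le> \<gamma>"
    using False frac_lt_1[of x] by auto
  moreover have "0 \<le> \<gamma>\<^sup>2 / 2" by simp
  moreover have "of_int (\<lfloor>x + \<gamma>\<rfloor> - \<lfloor>x\<rfloor>) = (1::real)" using fl by simp
  ultimately show ?thesis by (simp only: mult_1_right)
qed

text \<open>Telescoping the one-step estimate, \<gamma> times the sum equals a bounded difference of
  \<open>saw_primitive\<close> up to N \<gamma>^2 / 2 and \<gamma> for each of the at most N
  \<gamma> + 1 integers crossed. Dividing by \<gamma> gives the bound.\<close>

lemma saw_sum_small_step:
  fixes \<gamma> \<delta> :: real and M N :: nat
  assumes "0 < \<gamma>" "\<gamma> \<le> 1"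
  shows "\<bar>\<Sum>n=M..<M+N. saw (\<gamma> * n + \<delta>)\<bar> \<le> 2 * (1 / \<gamma> + N * \<gamma>)"
proof -
  define x where "x n = \<gamma> * real n + \<delta>" for n
  have step: "x (Suc n) = x n + \<gamma>" for n by (simp add: x_def algebra_simps)
  have "\<bar>saw_primitive (x (M + N)) - saw_primitive (x M) - \<gamma> * (\<Sum>n=M..<M+N. saw (x n))\<bar>
      \<le> N * (\<gamma>\<^sup>2 / 2) + \<gamma> * of_int (\<lfloor>x (M + N)\<rfloor> - \<lfloor>x M\<rfloor>)"
  proof (induction N)
    case (Suc N)
    have "\<bar>saw_primitive (x (Suc (M + N))) - saw_primitive (x (M + N)) - \<gamma> * saw (x (M + N))\<bar>
      \<le> \<gamma>\<^sup>2 / 2 + \<gamma> * of_int (\<lfloor>x (Suc (M + N))\<rfloor> - \<lfloor>x (M + N)\<rfloor>)"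
      unfolding step using assms by (intro saw_primitive_step) auto
    moreover have "(\<Sum>n=M..<M+Suc N. saw (x n)) = (\<Sum>n=M..<M+N. saw (x n)) + saw (x (M + N))"
      by simp
    ultimately show ?case using Suc
      by (simp only: add_Suc_right of_nat_Suc distrib_left distrib_right of_int_diff right_diff_distrib)
  qed auto
  moreover have "of_int (\<lfloor>x (M + N)\<rfloor> - \<lfloor>x M\<rfloor>) \<le> N * \<gamma> + 1"
  proof -
    have "of_int \<lfloor>x (M + N)\<rfloor> \<le> x (M + N)" "x M < of_int \<lfloor>x M\<rfloor> + 1"
      by (simp_all add: of_int_floor_le)
    moreover have "x (M + N) = x M + N * \<gamma>" by (simp add: x_def algebra_simps)
    ultimately show ?thesis unfolding of_int_diff by linarith
  qed
  then have "\<gamma> * of_int (\<lfloor>x (M + N)\<rfloor> - \<lfloor>x M\<rfloor>) \<le> \<gamma> * (N * \<gamma> + 1)"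
    using assms by (intro mult_left_mono) auto
  ultimately have "\<bar>\<gamma> * (\<Sum>n=M..<M+N. saw (x n))\<bar> \<le> 1 / 8 + N * (\<gamma>\<^sup>2 / 2) + \<gamma> * (N * \<gamma> + 1)"
    using saw_primitive_bounds[of "x M"] saw_primitive_bounds[of "x (M + N)"] by linarith
  also have "\<dots> \<le> 2 * (1 + N * \<gamma>\<^sup>2)"
  proof -
    have "0 \<le> N * \<gamma>\<^sup>2" by simp
    moreover have "\<gamma> * (N * \<gamma> + 1) = N * \<gamma>\<^sup>2 + \<gamma>" by (simp add: power2_eq_square algebra_simps)
    moreover have "N * (\<gamma>\<^sup>2 / 2) = (N * \<gamma>\<^sup>2) / 2" by simp
    moreover have "1 / 8 + y / 2 + (y + \<gamma>) \<le> 2 * (1 + y)" if "0 \<le> y" for y :: real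
      using that assms by argo
    ultimately show ?thesis by simp
  qed
  also have "2 * (1 + N * \<gamma>\<^sup>2) = \<gamma> * (2 * (1 / \<gamma> + N * \<gamma>))"
    using assms by (simp add: power2_eq_square algebra_simps)
  finally have "\<gamma> * \<bar>\<Sum>n=M..<M+N. saw (x n)\<bar> \<le> \<gamma> * (2 * (1 / \<gamma> + N * \<gamma>))"
    using assms by (simp add: abs_mult)
  then show ?thesis using assms by (simp add: x_def)
qed

lemma frac_div_int:
  fixes a :: int and m :: nat
  assumes "m > 0" "0 \<le> \<theta>" "\<theta> < 1"
  shows "frac ((of_int a + \<theta>) / real m) = (of_int (a mod int m) + \<theta>) / real m"
proof -
  have a: "of_int a = real m * of_int (a div int m) + of_int (a mod int m)"
    by (metis mult_div_mod_eq of_int_add of_int_mult of_int_of_nat_eq)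
  have "a mod int m < int m" "0 \<le> a mod int m" using assms by auto
  then have "of_int (a mod int m) + 1 \<le> real m" "0 \<le> real_of_int (a mod int m)" by linarith+
  then have "0 \<le> (of_int (a mod int m) + \<theta>) / real m" "(of_int (a mod int m) + \<theta>) / real m < 1"
    using assms by (auto simp: field_simps)
  moreover have "(of_int a + \<theta>) / real m = (of_int (a mod int m) + \<theta>) / real m + of_int (a div int m)"
    using assms by (subst a) (simp add: field_simps)
  ultimately show ?thesis
    by (subst frac_unique_iff) auto
qed

text \<open>As \<open>q\<close> is invertible modulo \<open>m\<close>, the integers q n + floor
  \<beta> run through all residues modulo \<open>m\<close>; this is the multiplication formula for
  the first Bernoulli function.\<close>

lemma saw_period_coprime:
  fixes q m M :: nat and \<beta> :: real
  assumes "m > 0" "coprime q m"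
  shows "(\<Sum>n=M..<M+m. saw ((q * n + \<beta>) / m)) = saw \<beta>"
proof -
  define r where "r n = (int q * int n + \<lfloor>\<beta>\<rfloor>) mod int m" for n
  have fr: "saw ((q * n + \<beta>) / m) = (of_int (r n) + frac \<beta>) / m - 1 / 2" for n
  proof -
    have "q * n + \<beta> = of_int (int q * int n + \<lfloor>\<beta>\<rfloor>) + frac \<beta>" by (simp add: frac_def)
    then show ?thesis
      using frac_div_int[OF assms(1) frac_ge_0 frac_lt_1, of "int q * int n + \<lfloor>\<beta>\<rfloor>" \<beta>]
      unfolding saw_def r_def by (simp only:)
  qed
  have inj: "inj_on r {M..<M+m}"
  proof (rule inj_onI)
    fix a b assume ab: "a \<in> {M..<M+m}" "b \<in> {M..<M+m}" "r a = r b"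
    then have "int m dvd (int q * int a + \<lfloor>\<beta>\<rfloor>) - (int q * int b + \<lfloor>\<beta>\<rfloor>)"
      unfolding r_def by (simp add: mod_eq_dvd_iff)
    then have "int m dvd int q * (int a - int b)" by (simp add: algebra_simps)
    then have "int m dvd int a - int b"
      using assms(2) by (simp add: coprime_dvd_mult_right_iff coprime_commute)
    moreover have "\<bar>int a - int b\<bar> < int m" using ab by auto
    ultimately have "int a - int b = 0" using zdvd_not_zless
      by (metis abs_dvd_iff dvd_abs_iff linorder_neqE zero_less_abs_iff abs_ge_zero abs_0_eq order_le_less)
    then show "a = b" by simp
  qed
  have img: "r ` {M..<M+m} = {0..<int m}"
  proof (rule card_subset_eq)
    show "r ` {M..<M+m} \<subseteq> {0..<int m}" using assms by (auto simp: r_def)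
    show "card (r ` {M..<M+m}) = card {0..<int m}" using inj by (simp add: card_image)
  qed auto
  have "(\<Sum>n=M..<M+m. of_int (r n)) = (\<Sum>a\<in>{0..<int m}. real_of_int a)"
    unfolding img[symmetric] by (subst sum.reindex[OF inj]) simp
  also have "\<dots> = (\<Sum>a<m. real a)"
    by (rule sum.reindex_bij_witness[of _ int nat]) auto
  also have "\<dots> = real m * (real m - 1) / 2"
    by (induction m) (auto simp: field_simps)
  finally have sum_r: "(\<Sum>n=M..<M+m. of_int (r n)) = real m * (real m - 1) / 2" .
  have "(\<Sum>n=M..<M+m. saw ((q * n + \<beta>) / m)) = (\<Sum>n=M..<M+m. of_int (r n) / m + (frac \<beta> / m - 1 / 2))"
    unfolding fr by (simp add: add_divide_distrib algebra_simps)
  also have "\<dots> = (\<Sum>n=M..<M+m. of_int (r n)) / m + m * (frac \<beta> / m - 1 / 2)"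
    by (simp only: sum.distrib sum_divide_distrib) simp
  also have "\<dots> = saw \<beta>"
    using assms unfolding sum_r saw_def by (simp add: field_simps)
  finally show ?thesis .
qed

text \<open>Cancelling g = gcd q m leaves coprime data of period m' = m / g, and each complete
  period contributes saw (b / g). The incomplete period has r < m' terms and costs at most r / 2,
  the matching part of the main term at most 1 / 2.\<close>

lemma saw_sum_long:
  fixes q m M N :: nat and b :: real
  assumes "q > 0" "m > 0"
  shows "\<bar>(\<Sum>n=M..<M+N. saw ((q * n + b) / m)) - N * (gcd q m / m) * saw (b / gcd q m)\<bar> \<le> m"
proof -
  define g where "g = gcd q m"
  define q' m' where "q' = q div g" and "m' = m div g"
  have g: "g > 0" using assms by (simp add: g_def)
  have q: "q = g * q'" "m = g * m'" by (simp_all add: q'_def m'_def g_def)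
  have cop: "coprime q' m'"
    unfolding q'_def m'_def g_def using assms by (intro div_gcd_coprime) auto
  have m': "m' > 0" "m' \<le> m" using q assms g by (auto intro: Nat.gr0I)
  have eq: "(q * n + b) / m = (q' * n + b / g) / m'" for n
    using g m' unfolding q by (simp add: field_simps)
  define S where "S A B = (\<Sum>n=A..<B. saw ((q * n + b) / m))" for A B :: nat
  have block: "S A (A + m') = saw (b / g)" for A
    using saw_period_coprime[OF m'(1) cop, of "b / g" A] unfolding S_def eq by simp
  have blocks: "S M (M + k * m') = k * saw (b / g)" for k
  proof (induction k)
    case (Suc k)
    have "S M (M + Suc k * m') = S M (M + k * m') + S (M + k * m') (M + k * m' + m')"
      unfolding S_def by (subst sum.atLeastLessThan_concat) (auto simp: algebra_simps)
    then show ?case using Suc by (simp only: block) (simp add: algebra_simps)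
  qed (simp add: S_def)
  define k r where "k = N div m'" and "r = N mod m'"
  have N: "N = k * m' + r" "r < m'" using m' by (simp_all add: k_def r_def)
  have "\<bar>S (M + k * m') (M + N)\<bar> \<le> (\<Sum>n=M+k*m'..<M+N. 1 / 2)"
    unfolding S_def by (rule order_trans[OF sum_abs sum_mono]) (rule abs_saw_le)
  then have rest: "\<bar>S (M + k * m') (M + N)\<bar> \<le> r / 2" using N by simp
  have "S M (M + N) = S M (M + k * m') + S (M + k * m') (M + N)"
    unfolding S_def using N by (subst sum.atLeastLessThan_concat) auto
  then have "S M (M + N) - N / m' * saw (b / g) = S (M + k * m') (M + N) - r / m' * saw (b / g)"
    unfolding blocks using m' by (subst (2) N(1)) (simp add: field_simps)
  moreover have "\<bar>r / m' * saw (b / g)\<bar> \<le> 1 * (1 / 2)"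
    unfolding abs_mult using N m' by (intro mult_mono abs_saw_le) auto
  moreover have "real r + 1 \<le> real m'" using N by linarith
  ultimately have "\<bar>S M (M + N) - N / m' * saw (b / g)\<bar> \<le> m'"
    using rest of_nat_0_le_iff[of r, where ?'a = real] unfolding \<open>S M (M + N) - _ = _\<close> abs_le_iff by linarith
  moreover have "real N / m' = N * (g / m)" using g m' unfolding q by simp
  moreover have "real m' \<le> real m" using m' by simp
  ultimately show ?thesis unfolding S_def g_def by (simp only:)
qed

subsection \<open>The main term of the average\<close>

text \<open>The term m = 1 dominates: the others amount to at most 1 / 4 from m = 2 and 1 / 2 from
  the tail, uniformly in \<open>q\<close>.\<close>

lemma coprime_mu_sum_lower:
  assumes "Y \<ge> 1"
  shows "(\<Sum>m | m \<in> {1..Y} \<and> coprime m q. mu m / (real m)^2) \<ge> 1 / 4"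
proof -
  have "(\<Sum>m | m \<in> {1..Y} \<and> coprime m q. mu m / (real m)^2)
      = 1 + (\<Sum>m | m \<in> {2..Y} \<and> coprime m q. mu m / (real m)^2)"
  proof -
    have "{m. m \<in> {1..Y} \<and> coprime m q} = insert 1 {m. m \<in> {2..Y} \<and> coprime m q}"
      using assms by (auto simp: le_less Suc_le_eq)
    then show ?thesis by simp
  qed
  moreover have "\<bar>\<Sum>m | m \<in> {2..Y} \<and> coprime m q. mu m / (real m)^2\<bar> \<le> (\<Sum>m | m \<in> {2..Y} \<and> coprime m q. 1 / (real m)^2)"
    by (rule order_trans[OF sum_abs sum_mono]) (simp add: divide_right_mono abs_mu_le_1)
  moreover have "\<dots> \<le> (\<Sum>m=2..Y. 1 / (real m)^2)"
    by (rule sum_mono2) auto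
  moreover have "\<dots> \<le> 3 / 4"
  proof (cases "Y \<ge> 2")
    case True
    then have "{2..Y} = insert 2 {2+1..Y}" by auto
    then show ?thesis using sum_inverse_squares_tail[of 2 Y] by simp
  qed auto
  ultimately show ?thesis by linarith
qed

text \<open>The terms are grouped by g = gcd q d. A squarefree d is g m with m coprime to q, since a
  common divisor of m and q divides g too, and then its square divides d. Multiplicativity splits
  off mu g F g / g, and the remaining sum over m is at least 1 / 4; Y \<ge> q keeps every range of m
  nonempty.\<close>

lemma sum_mu_gcd_lower:
  fixes F :: "nat \<Rightarrow> real"
  assumes "squarefree q" "Y \<ge> q" and F: "\<And>g. g dvd q \<Longrightarrow> mu g * F g \<ge> \<kappa>" and "\<kappa> \<ge> 0"
  shows "(\<Sum>d=1..Y. mu d / d * (gcd q d / d) * F (gcd q d)) \<ge> \<kappa> / 4 * (\<Sum>g | g dvd q. 1 / real g)"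
proof -
  have q: "q > 0" using assms not_squarefree_0 by (metis gr0I)
  have inner: "(\<Sum>d | d \<in> {1..Y} \<and> gcd q d = g. mu d / d * (gcd q d / d) * F (gcd q d)) \<ge> \<kappa> / 4 * (1 / g)"
    if g: "g dvd q" for g
  proof -
    have g0: "g > 0" "g \<le> q" using g q by (auto intro: Nat.gr0I dvd_imp_le)
    have sqg: "squarefree g" using squarefree_mono[OF g assms(1)] .
    have Y: "Y div g \<ge> 1" using g0 assms by (simp add: less_eq_div_iff_mult_less_eq)
    have "(\<Sum>d | d \<in> {1..Y} \<and> gcd q d = g. mu d / d * (gcd q d / d) * F (gcd q d))
        = (\<Sum>d | d \<in> {1..Y} \<and> gcd q d = g \<and> squarefree d. mu d / d * (g / d) * F g)"
      by (rule sum.mono_neutral_cong_right) (auto simp: mu_def)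
    also have "\<dots> = (\<Sum>m | m \<in> {1..Y div g} \<and> coprime m q \<and> squarefree m. mu (g * m) / (g * m) * (1 / m) * F g)"
    proof (rule sum.reindex_bij_witness[of _ "\<lambda>m. g * m" "\<lambda>d. d div g"], goal_cases)
      case (2 d)
      then have d: "d \<in> {1..Y}" "gcd q d = g" "squarefree d" by auto
      then have gd: "g dvd d" by auto
      then obtain m where m: "d = g * m" by blast
      have "coprime m q"
      proof (rule coprimeI)
        fix c assume c: "c dvd m" "c dvd q"
        then have "c dvd gcd q d" using m by simp
        then have "c dvd g" using d by simp
        then have "c ^ 2 dvd d" unfolding m power2_eq_square using c by (simp add: mult_dvd_mono)
        then show "is_unit c" using d squarefreeD by blast
      qed
      moreover have "squarefree m" using d(3) unfolding m by (rule squarefree_multD(2))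
      moreover have "m \<in> {1..Y div g}"
        using d g0 unfolding m by (auto simp: less_eq_div_iff_mult_less_eq mult.commute Suc_le_eq)
      ultimately show ?case using m g0 by simp
    next
      case (4 m)
      then have m: "m \<in> {1..Y div g}" "coprime m q" "squarefree m" by auto
      have "coprime g m" using g m(2) by (metis coprime_commute coprime_divisors dvd_refl)
      then have "squarefree (g * m)" using sqg m squarefree_mult_coprime by blast
      moreover have "gcd q (g * m) = g"
        using g m(2) by (simp add: gcd_mult_right_right_cancel coprime_commute gcd_nat.absorb2)
      moreover have "g * m \<in> {1..Y}"
        using m(1) g0 by (auto simp: less_eq_div_iff_mult_less_eq mult.commute Suc_le_eq)
      ultimately show ?case by auto
    next
      case (5 d)
      then have "g dvd d" by auto
      then obtain m where "d = g * m" by blast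
      then show ?case using g0 5 by (auto simp: field_simps)
    qed (use g0 in auto)
    also have "\<dots> = (\<Sum>m | m \<in> {1..Y div g} \<and> coprime m q \<and> squarefree m. mu g * F g / g * (mu m / (real m)^2))"
    proof (rule sum.cong)
      fix m assume "m \<in> {m \<in> {1..Y div g}. coprime m q \<and> squarefree m}"
      then have "coprime g m" using g by (metis (mono_tags, lifting) coprime_commute coprime_divisors dvd_refl mem_Collect_eq)
      then show "mu (g * m) / (g * m) * (1 / m) * F g = mu g * F g / g * (mu m / (real m)^2)"
        by (simp add: mu_mult_coprime power2_eq_square field_simps)
    qed auto
    also have "\<dots> = mu g * F g / g * (\<Sum>m | m \<in> {1..Y div g} \<and> coprime m q \<and> squarefree m. mu m / (real m)^2)"
      by (simp only: sum_distrib_left)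
    also have "(\<Sum>m | m \<in> {1..Y div g} \<and> coprime m q \<and> squarefree m. mu m / (real m)^2)
        = (\<Sum>m | m \<in> {1..Y div g} \<and> coprime m q. mu m / (real m)^2)"
      by (rule sum.mono_neutral_left) (auto simp: mu_def)
    also have "mu g * F g / g * \<dots> \<ge> \<kappa> / g * (1 / 4)"
      using F[OF g] \<open>\<kappa> \<ge> 0\<close> coprime_mu_sum_lower[OF Y] by (intro mult_mono divide_right_mono) auto
    finally show ?thesis by simp
  qed
  have "(\<Sum>d=1..Y. mu d / d * (gcd q d / d) * F (gcd q d))
      = (\<Sum>g | g dvd q. \<Sum>d | d \<in> {1..Y} \<and> gcd q d = g. mu d / d * (gcd q d / d) * F (gcd q d))"
    using q by (subst sum.group) auto
  also have "\<dots> \<ge> (\<Sum>g | g dvd q. \<kappa> / 4 * (1 / real g))"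
    by (rule sum_mono) (use inner in auto)
  finally show ?thesis by (simp add: sum_distrib_left)
qed

subsection \<open>The nontrivial character modulo 4\<close>

definition chi :: "nat \<Rightarrow> real" where
  "chi n = (if n mod 4 = 1 then 1 else if n mod 4 = 3 then -1 else 0)"

lemma chi_mult: "chi (a * b) = chi a * chi b"
proof -
  have "(a * b) mod 4 = ((a mod 4) * (b mod 4)) mod 4" by (simp add: mod_mult_eq)
  moreover have "a mod 4 \<in> {0,1,2,3}" "b mod 4 \<in> {0,1,2,3}" by auto
  ultimately show ?thesis unfolding chi_def by auto
qed

lemma chi_1 [simp]: "chi 1 = 1" "chi (Suc 0) = 1"
  by (simp_all add: chi_def)

lemma abs_chi_le_1: "\<bar>chi n\<bar> \<le> 1"
  by (simp add: chi_def)

lemma chi_prod: "finite P \<Longrightarrow> chi (\<Prod>p\<in>P. f p) = (\<Prod>p\<in>P. chi (f p))"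
  by (induction P rule: finite_induct) (auto simp: chi_mult)

text \<open>Every prime factor of \<open>n\<close> contributes -1 on both sides.\<close>

lemma chi_eq_mu:
  assumes "squarefree n" "\<And>p. prime p \<Longrightarrow> p dvd n \<Longrightarrow> p mod 4 = 3"
  shows "chi n = mu n"
proof -
  have n: "n \<noteq> 0" using assms(1) not_squarefree_0 by metis
  have "n = (\<Prod>p\<in>prime_factors n. p ^ multiplicity p n)"
    using prod_prime_factors[OF n] by simp
  also have "\<dots> = (\<Prod>p\<in>prime_factors n. p)"
  proof (rule prod.cong)
    fix p assume p: "p \<in> prime_factors n"
    then have "multiplicity p n \<le> 1"
      using assms(1) squarefree_factorial_semiring''[OF n] by (auto simp: in_prime_factors_iff)
    moreover have "multiplicity p n > 0"
      using p by (auto simp: in_prime_factors_iff prime_multiplicity_gt_zero_iff)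
    ultimately have "multiplicity p n = 1" by linarith
    then show "p ^ multiplicity p n = p" by simp
  qed auto
  finally have "chi n = (\<Prod>p\<in>prime_factors n. chi p)"
    using chi_prod[of "prime_factors n" "\<lambda>p. p"] by simp
  also have "\<dots> = (\<Prod>p\<in>prime_factors n. -1)"
    by (rule prod.cong) (use assms(2) in \<open>auto simp: in_prime_factors_iff chi_def\<close>)
  finally show ?thesis using assms(1) by (simp add: mu_def)
qed

text \<open>At odd multiples of 1 / 4 the sawtooth takes only the values 1 / 4 and - 1 / 4; tripling
  the argument changes the sign because chi 3 = -1.\<close>

lemma saw_quarter:
  assumes "odd k"
  shows "saw (real k / 4) = - chi k / 4" "saw (real (3 * k) / 4) = chi k / 4"
proof -
  have fr: "frac (real j / 4) = real (j mod 4) / 4" for j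
    using frac_div_int[of 4 0 "int j"] by (simp add: zmod_int[of j 4, symmetric, simplified])
  have "k mod 4 = 1 \<or> k mod 4 = 3" using assms by presburger
  moreover have "3 * k mod 4 = 3 * (k mod 4) mod 4" by (simp add: mod_mult_right_eq)
  ultimately show "saw (real k / 4) = - chi k / 4" "saw (real (3 * k) / 4) = chi k / 4"
    unfolding saw_def fr chi_def by auto
qed

text \<open>With k = q / g, mu g saw (k / 4) = - chi g chi k / 4 = - mu q / 4, which no longer
  involves g. The choice between q / 4 and 3 q / 4 realizes the sign \<epsilon>.\<close>

lemma exists_resonant_shift:
  assumes "squarefree q" "\<And>p. prime p \<Longrightarrow> p dvd q \<Longrightarrow> p mod 4 = 3" and "\<epsilon> = 1 \<or> \<epsilon> = -1"
  shows "\<exists>b. 0 \<le> b \<and> b \<le> real q \<and> (\<forall>g. g dvd q \<longrightarrow> mu g * (\<epsilon> * saw (b / g)) = 1 / 4)"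
proof -
  have chi: "chi d = mu d" if "d dvd q" for d
    using that squarefree_mono[OF that assms(1)] assms(2) by (intro chi_eq_mu) (auto intro: dvd_trans)
  have q: "q > 0" using assms(1) not_squarefree_0 by (metis gr0I)
  have mu2: "mu d = 1 \<or> mu d = -1" if "d dvd q" for d
    using squarefree_mono[OF that assms(1)] by (simp add: mu_def minus_one_power_iff)
  have *: "mu g * saw (real q / 4 / g) = - mu q / 4" "mu g * saw (real (3 * q) / 4 / g) = mu q / 4"
    if g: "g dvd q" for g
  proof -
    obtain k where k: "q = g * k" using g by blast
    have g0: "g > 0" using k q by (auto intro: Nat.gr0I)
    have "k dvd q" using k by simp
    then have "chi k \<noteq> 0" using chi[of k] mu2[of k] by auto
    then have "k mod 4 = 1 \<or> k mod 4 = 3" by (auto simp: chi_def split: if_splits)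
    then have "odd k" by presburger
    moreover have "mu g * chi k = mu q"
      using chi[of q] chi[OF g] by (simp add: k chi_mult)
    moreover have "real q / 4 / g = real k / 4" "real (3 * q) / 4 / g = real (3 * k) / 4"
      using g0 by (simp_all add: k)
    ultimately show "mu g * saw (real q / 4 / g) = - mu q / 4" "mu g * saw (real (3 * q) / 4 / g) = mu q / 4"
      using saw_quarter[OF \<open>odd k\<close>] by (simp_all only: times_divide_eq_right mult_minus_right simp_thms)
  qed
  have comm: "mu g * (\<epsilon> * x) = \<epsilon> * (mu g * x)" for g x by simp
  consider "\<epsilon> * mu q = -1" | "\<epsilon> * mu q = 1" using mu2[of q] assms(3) by auto
  then show ?thesis
  proof cases
    case 1
    have "mu g * (\<epsilon> * saw (real q / 4 / g)) = 1 / 4" if "g dvd q" for g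
      unfolding comm *(1)[OF that] using 1 by simp
    then show ?thesis by (intro exI[of _ "real q / 4"]) simp
  next
    case 2
    have "mu g * (\<epsilon> * saw (real (3 * q) / 4 / g)) = 1 / 4" if "g dvd q" for g
      unfolding comm *(2)[OF that] using 2 by simp
    then show ?thesis by (intro exI[of _ "real (3 * q) / 4"]) simp
  qed
qed

subsection \<open>Primes congruent to 3 modulo 4\<close>

text \<open>A number whose prime factors lie in \<open>insert p P\<close> is either free of
  \<open>p\<close> or \<open>p\<close> times another such number. The sums S and S' for
  \<open>insert p P\<close> and \<open>P\<close> thus satisfy S \<le> S' + S / p, and solving for S
  produces the new Euler factor.\<close>

lemma sum_smooth_le_prod:
  assumes "finite P" "\<And>p. p \<in> P \<Longrightarrow> prime p"
  shows "(\<Sum>n | n \<in> {1..N} \<and> prime_factors n \<subseteq> P. 1 / real n) \<le> (\<Prod>p\<in>P. 1 / (1 - 1 / real p))"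
  using assms
proof (induction P arbitrary: N rule: finite_induct)
  case empty
  have "{n. n \<in> {1..N} \<and> prime_factors n \<subseteq> {}} \<subseteq> {1}"
    by (auto simp: prime_factorization_empty_iff)
  then have "(\<Sum>n | n \<in> {1..N} \<and> prime_factors n \<subseteq> {}. 1 / real n) \<le> (\<Sum>n\<in>{1}. 1 / real n)"
    by (intro sum_mono2) auto
  then show ?case by simp
next
  case (insert p P)
  define T where "T Q = {n. n \<in> {1..N} \<and> prime_factors n \<subseteq> Q}" for Q
  have p: "prime p" using insert by auto
  then have p2: "p \<ge> 2" by (rule prime_ge_2_nat)
  have fin: "finite (T Q)" for Q unfolding T_def by auto
  have "T (insert p P) \<subseteq> T P \<union> (\<lambda>n. p * n) ` T (insert p P)"
  proof
    fix n assume n: "n \<in> T (insert p P)"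
    show "n \<in> T P \<union> (\<lambda>n. p * n) ` T (insert p P)"
    proof (cases "p dvd n")
      case True
      then obtain m where m: "n = p * m" by blast
      have m0: "m > 0" using n m by (auto simp: T_def intro: Nat.gr0I)
      then have "m \<le> n" using m p2 by simp
      moreover have "prime_factors m \<subseteq> prime_factors n"
        using m m0 p by (simp add: prime_factors_product)
      ultimately have "m \<in> T (insert p P)" using n m0 by (auto simp: T_def)
      then show ?thesis using m by blast
    next
      case False
      then show ?thesis using n by (auto simp: T_def in_prime_factors_iff)
    qed
  qed
  then have "(\<Sum>n\<in>T (insert p P). 1 / real n) \<le> (\<Sum>n\<in>T P \<union> (\<lambda>n. p * n) ` T (insert p P). 1 / real n)"
    by (intro sum_mono2) (auto simp: fin)
  also have "\<dots> \<le> (\<Sum>n\<in>T P. 1 / real n) + (\<Sum>n\<in>(\<lambda>n. p * n) ` T (insert p P). 1 / real n)"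
    using sum.union_inter[OF fin finite_imageI[OF fin], of "\<lambda>n. 1 / real n" P "\<lambda>n. p * n" "insert p P"]
      sum_nonneg[of "T P \<inter> (\<lambda>n. p * n) ` T (insert p P)" "\<lambda>n. 1 / real n"] by auto
  also have "(\<Sum>n\<in>(\<lambda>n. p * n) ` T (insert p P). 1 / real n) = 1 / p * (\<Sum>n\<in>T (insert p P). 1 / real n)"
    using p2 by (subst sum.reindex) (auto simp: inj_on_def sum_distrib_left)
  finally have "(1 - 1 / p) * (\<Sum>n\<in>T (insert p P). 1 / real n) \<le> (\<Sum>n\<in>T P. 1 / real n)"
    by (simp add: algebra_simps)
  also have "\<dots> \<le> (\<Prod>p\<in>P. 1 / (1 - 1 / real p))"
    unfolding T_def using insert by auto
  finally have "(1 - 1 / p) * (\<Sum>n\<in>T (insert p P). 1 / real n) \<le> (\<Prod>p\<in>P. 1 / (1 - 1 / real p))" .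
  moreover have "1 - 1 / real p > 0" using p2 by simp
  ultimately have "(\<Sum>n\<in>T (insert p P). 1 / real n) \<le> 1 / (1 - 1 / real p) * (\<Prod>p\<in>P. 1 / (1 - 1 / real p))"
    by (simp add: pos_le_divide_eq mult.commute)
  then show ?case using insert(1,2) unfolding T_def by simp
qed

lemma ln_le_prod_primes:
  fixes N :: nat
  assumes "N \<ge> 1"
  shows "ln (real N) \<le> (\<Prod>p | prime p \<and> p \<le> N. 1 / (1 - 1 / real p))"
proof -
  have "ln (real N) \<le> ln (real N + 1)" using assms by simp
  also have "\<dots> \<le> harm N" by (rule ln_le_harm)
  also have "(harm N :: real) = (\<Sum>n | n \<in> {1..N} \<and> prime_factors n \<subseteq> {p. prime p \<and> p \<le> N}. 1 / real n)"
    unfolding harm_def inverse_eq_divide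
    by (rule sum.cong) (auto simp: in_prime_factors_iff intro: order_trans[OF dvd_imp_le])
  also have "\<dots> \<le> (\<Prod>p | prime p \<and> p \<le> N. 1 / (1 - 1 / real p))"
    by (rule sum_smooth_le_prod) auto
  finally show ?thesis .
qed

text \<open>Double counting of the pairs p, k with p dividing k \<le> N: for fixed k the logarithms
  add up to at most ln k, while each p occurs N div p \<ge> N / (2 p) times because p \<le>
  N.\<close>

lemma sum_ln_primes_over_p:
  fixes N :: nat
  shows "(\<Sum>p | prime p \<and> p \<le> N. ln (real p) / real p) \<le> 2 * ln (real N)"
proof (cases "N = 0")
  case True
  then have "{p. prime p \<and> p \<le> N} = {}" by (auto dest: prime_gt_0_nat)
  then show ?thesis using True by (metis (no_types, lifting) ln_0 mult_zero_right of_nat_0 order_refl sum.empty)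
next
  case False
  have ln_factors: "(\<Sum>p | prime p \<and> p dvd k. ln (real p)) \<le> ln (real k)" if k: "k > 0" for k :: nat
  proof -
    have "(\<Prod>p\<in>prime_factors k. p) \<le> (\<Prod>p\<in>prime_factors k. p ^ multiplicity p k)"
      using k by (intro prod_mono) (auto simp: in_prime_factors_iff prime_multiplicity_gt_zero_iff
          intro!: self_le_power simp: Suc_le_eq prime_gt_0_nat)
    then have "(\<Prod>p\<in>prime_factors k. p) \<le> k" using prod_prime_factors[of k] k by simp
    then have "real (\<Prod>p\<in>prime_factors k. p) \<le> real k" by (rule of_nat_mono)
    moreover have "real (\<Prod>p\<in>prime_factors k. p) > 0"
      by (auto simp: prime_gt_0_nat in_prime_factors_iff intro!: prod_pos)
    ultimately have "ln (real (\<Prod>p\<in>prime_factors k. p)) \<le> ln (real k)" using k by simp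
    also have "ln (real (\<Prod>p\<in>prime_factors k. p)) = (\<Sum>p\<in>prime_factors k. ln (real p))"
      by (simp, subst ln_prod) (auto simp: prime_gt_0_nat in_prime_factors_iff)
    also have "prime_factors k = {p. prime p \<and> p dvd k}" using k by (auto simp: in_prime_factors_iff)
    finally show ?thesis .
  qed
  have "N * (\<Sum>p | prime p \<and> p \<le> N. ln (real p) / real p) = (\<Sum>p | prime p \<and> p \<le> N. (real N / real p) * ln (real p))"
    by (simp add: sum_distrib_left)
  also have "\<dots> \<le> (\<Sum>p | prime p \<and> p \<le> N. 2 * (real (N div p) * ln (real p)))"
  proof (rule sum_mono)
    fix p assume p: "p \<in> {p. prime p \<and> p \<le> N}"
    then have "p > 0" "p \<le> N" by (auto simp: prime_gt_0_nat)
    then have "N div p \<ge> 1" by (simp add: div_greater_zero_iff Suc_le_eq)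
    then have "real N / p \<le> 2 * real (N div p)" using real_div_bounds(2)[of N p] by linarith
    moreover have "ln (real p) \<ge> 0" using \<open>p > 0\<close> by simp
    ultimately have "real N / p * ln (real p) \<le> 2 * real (N div p) * ln (real p)" by (rule mult_right_mono)
    then show "(real N / real p) * ln (real p) \<le> 2 * (real (N div p) * ln (real p))" by (simp only: mult.assoc)
  qed
  also have "\<dots> = 2 * (\<Sum>p | prime p \<and> p \<le> N. \<Sum>k | k \<in> {1..N} \<and> p dvd k. ln (real p))"
  proof -
    have "card {k. k \<in> {1..N} \<and> p dvd k} = N div p" if "p > 0" for p :: nat
    proof -
      have "{k. k \<in> {1..N} \<and> p dvd k} = (\<lambda>m. p * m) ` {1..N div p}"
        using that by (auto simp: image_iff less_eq_div_iff_mult_less_eq mult.commute Suc_le_eq elim!: dvdE)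
      then show ?thesis using that by (simp add: card_image inj_on_def)
    qed
    then show ?thesis by (simp add: sum_distrib_left prime_gt_0_nat)
  qed
  also have "(\<Sum>p | prime p \<and> p \<le> N. \<Sum>k | k \<in> {1..N} \<and> p dvd k. ln (real p))
      = (\<Sum>k=1..N. \<Sum>p | p \<in> {p. prime p \<and> p \<le> N} \<and> p dvd k. ln (real p))"
    by (rule sum.swap_restrict) auto
  also have "\<dots> = (\<Sum>k=1..N. \<Sum>p | prime p \<and> p dvd k. ln (real p))"
    by (intro sum.cong) (auto dest: dvd_imp_le)
  also have "\<dots> \<le> (\<Sum>k=1..N. ln (real N))"
  proof (rule sum_mono)
    fix k assume "k \<in> {1..N}"
    then have "k > 0" "ln (real k) \<le> ln (real N)" by auto
    then show "(\<Sum>p | prime p \<and> p dvd k. ln (real p)) \<le> ln (real N)" using ln_factors[of k] by linarith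
  qed
  also have "2 * \<dots> = N * (2 * ln (real N))" by simp
  finally show ?thesis using False by simp
qed

section \<open>Zeta and L-series near s = 1\<close>

lemma zeta_upper:
  fixes s :: real
  assumes "s > 1"
  shows "(\<Sum>n=1..N. real n powr (-s)) \<le> 1 + 1 / (s - 1)"
proof (cases "N \<ge> 1")
  case True
  then have "(\<Sum>n=1..N. real n powr (-s)) \<le> 1 + (1 - real N powr (1 - s)) / (s - 1)"
  proof (induction N rule: dec_induct)
    case (step n)
    have der: "((\<lambda>x. x powr (1 - s)) has_real_derivative (1 - s) * x powr (-s)) (at x)" if "x > 0" for x
      using has_real_derivative_powr[of x "1 - s"] that by simp
    obtain z where z: "real n < z" "z < real (Suc n)"
      "real (Suc n) powr (1 - s) - real n powr (1 - s) = (real (Suc n) - real n) * ((1 - s) * z powr (-s))"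
      using MVT2[of "real n" "real (Suc n)" "\<lambda>x. x powr (1 - s)" "\<lambda>x. (1 - s) * x powr (-s)"] der step by auto
    have "real (Suc n) powr (-s) \<le> z powr (-s)"
      using z step assms by (intro powr_mono2') auto
    then have "(s - 1) * real (Suc n) powr (-s) \<le> (s - 1) * z powr (-s)"
      using assms by (intro mult_left_mono) auto
    also have "\<dots> = real n powr (1 - s) - real (Suc n) powr (1 - s)"
    proof -
      have "(real (Suc n) - real n) * ((1 - s) * z powr (-s)) = - ((s - 1) * z powr (-s))"
        by (simp add: algebra_simps)
      then show ?thesis using z(3) by linarith
    qed
    finally have "(s - 1) * real (Suc n) powr (-s) \<le> real n powr (1 - s) - real (Suc n) powr (1 - s)" .
    then have "real (Suc n) powr (-s) \<le> (real n powr (1 - s) - real (Suc n) powr (1 - s)) / (s - 1)"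
      using assms by (simp add: pos_le_divide_eq mult.commute)
    with step show ?case by (simp add: diff_divide_distrib)
  qed auto
  moreover have "(1 - real N powr (1 - s)) / (s - 1) \<le> 1 / (s - 1)"
    using assms by (intro divide_right_mono) auto
  ultimately show ?thesis by linarith
qed (use assms in auto)

text \<open>A block of four consecutive integers contributes (4K+1)^-s - (4K+3)^-s. The term
  subtracted in the bound is the positive term about to be added, which makes the induction
  close.\<close>

lemma L_upper:
  fixes s :: real
  assumes "s > 1"
  shows "(\<Sum>n<4*K+1. chi n * real n powr (-s)) \<le> 1 - real (4 * K + 1) powr (-s)"
proof (induction K)
  case (Suc K)
  have "{..<4*Suc K+1} = {..<4*K+1} \<union> {4*K+1, 4*K+2, 4*K+3, 4*K+4}" by auto
  then have "(\<Sum>n<4*Suc K+1. chi n * real n powr (-s)) = (\<Sum>n<4*K+1. chi n * real n powr (-s))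
      + (\<Sum>n\<in>{4*K+1, 4*K+2, 4*K+3, 4*K+4}. chi n * real n powr (-s))"
    by (simp only:) (rule sum.union_disjoint, auto)
  also have "(\<Sum>n\<in>{4*K+1, 4*K+2, 4*K+3, 4*K+4}. chi n * real n powr (-s))
      = real (4 * K + 1) powr (-s) - real (4 * K + 3) powr (-s)"
  proof -
    have "(4*K+1) mod 4 = 1" "(4*K+2) mod 4 = 2" "(4*K+3) mod 4 = 3" "(4*K+4) mod 4 = 0" by presburger+
    then have "chi (4*K+1) = 1" "chi (4*K+2) = 0" "chi (4*K+3) = -1" "chi (4*K+4) = 0" by (simp_all add: chi_def)
    then show ?thesis by simp
  qed
  finally have "(\<Sum>n<4*Suc K+1. chi n * real n powr (-s)) = (\<Sum>n<4*K+1. chi n * real n powr (-s))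
    + (real (4 * K + 1) powr (-s) - real (4 * K + 3) powr (-s))" .
  moreover have "real (4 * Suc K + 1) powr (-s) \<le> real (4 * K + 3) powr (-s)"
    using assms by (intro powr_mono2') auto
  ultimately show ?case using Suc by linarith
qed (simp add: chi_def)

text \<open>Removing the multiples of \<open>p\<close> multiplies the sum of a completely multiplicative function
  by \<open>1 - f p\<close>.\<close>

lemma euler_sieve:
  fixes f :: "nat \<Rightarrow> real"
  assumes mult: "\<And>a b. f (a * b) = f a * f b" and summ: "(\<lambda>n. norm (f n)) summable_on UNIV"
    and "finite P" "\<And>p. p \<in> P \<Longrightarrow> prime p"
  shows "infsum f {n. \<forall>p\<in>P. \<not> p dvd n} = infsum f UNIV * (\<Prod>p\<in>P. 1 - f p)"
  using assms(3,4)
proof (induction P rule: finite_induct)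
  case (insert p P)
  define C where "C = {n. \<forall>p\<in>P. \<not> p dvd n}"
  have p: "prime p" using insert by auto
  have sub: "f summable_on A" for A
    using summ abs_summable_summable summable_on_subset_banach by blast
  have "{n. \<forall>p\<in>insert p P. \<not> p dvd n} = C - (\<lambda>n. p * n) ` C"
  proof (intro equalityI subsetI)
    fix n assume n: "n \<in> C - (\<lambda>n. p * n) ` C"
    have "\<not> p dvd n"
    proof
      assume "p dvd n"
      then obtain m where m: "n = p * m" by blast
      then have "m \<in> C" using n by (auto simp: C_def)
      then show False using n m by blast
    qed
    then show "n \<in> {n. \<forall>p\<in>insert p P. \<not> p dvd n}" using n by (auto simp: C_def)
  qed (auto simp: C_def)
  moreover have "(\<lambda>n. p * n) ` C \<subseteq> C"
  proof (clarsimp simp: C_def)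
    fix n r assume "\<forall>r\<in>P. \<not> r dvd n" "r \<in> P" "r dvd p * n"
    moreover have "prime r" "r \<noteq> p" using insert \<open>r \<in> P\<close> by auto
    ultimately show False using p by (metis prime_dvd_mult_iff primes_dvd_imp_eq)
  qed
  ultimately have "infsum f {n. \<forall>p\<in>insert p P. \<not> p dvd n} = infsum f C - infsum f ((\<lambda>n. p * n) ` C)"
    using infsum_Diff[OF sub sub] by metis
  also have "infsum f ((\<lambda>n. p * n) ` C) = infsum (\<lambda>n. f p * f n) C"
    using p by (subst infsum_reindex) (auto simp: inj_on_def prime_gt_0_nat o_def mult)
  also have "\<dots> = f p * infsum f C" by (rule infsum_cmult_right') 
  finally show ?case using insert by (simp add: C_def algebra_simps)
qed auto

lemma prime_powr_less_1:
  assumes "prime p" "s > 0"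
  shows "real p powr (-s) < 1"
  using powr_less_cancel_iff[of "real p" "-s" 0] prime_gt_1_nat[OF assms(1)] assms(2) by simp

text \<open>\<open>\<zeta>(s) L(s,\<chi>)\<close> dominates the square of the partial Euler product over primes \<open>p \<equiv> 1 (mod 4)\<close>,
  while \<open>L(s,\<chi>) \<le> 1\<close>; no lower bound for \<open>L(1,\<chi>)\<close> is needed.\<close>

lemma prod_primes_1_mod_4_at_s:
  fixes s :: real
  assumes s: "s > 1"
  shows "(\<Prod>p | prime p \<and> p \<le> z \<and> p mod 4 = 1. 1 / (1 - real p powr (-s)))\<^sup>2 \<le> 2 * (1 + 1 / (s - 1))"
proof -
  define f where "f n = real n powr (-s)" for n :: nat
  define g where "g n = chi n * f n" for n :: nat
  have f_mult: "f (a * b) = f a * f b" for a b by (simp add: f_def powr_mult)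
  have g_mult: "g (a * b) = g a * g b" for a b by (simp add: g_def f_mult chi_mult)
  have f_nonneg: "f n \<ge> 0" for n by (simp add: f_def)
  have sf: "summable f" unfolding f_def using s by (subst summable_real_powr_iff) auto
  then have f_abs: "(\<lambda>n. norm (f n)) summable_on UNIV"
    using f_nonneg by (simp add: summable_on_UNIV_nonneg_real_iff)
  have g_le: "norm (g n) \<le> norm (f n)" for n
    using abs_chi_le_1[of n] f_nonneg[of n] by (simp add: g_def abs_mult mult_left_le_one_le)
  have g_abs: "(\<lambda>n. norm (g n)) summable_on UNIV"
    using Infinite_Sum.abs_summable_on_comparison_test[OF f_abs] g_le by blast
  have sub_f: "f summable_on A" for A
    using f_abs abs_summable_summable summable_on_subset_banach by blast
  have sub_g: "g summable_on A" for A
    using g_abs abs_summable_summable summable_on_subset_banach by blast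
  define Z where "Z = infsum f UNIV"
  define L where "L = infsum g UNIV"
  have f_sums: "f sums Z" unfolding Z_def using sub_f by (intro has_sum_imp_sums has_sum_infsum)
  have g_sums: "g sums L" unfolding L_def using sub_g by (intro has_sum_imp_sums has_sum_infsum)
  have Z_le: "Z \<le> 1 + 1 / (s - 1)"
  proof (rule LIMSEQ_le_const2)
    show "(\<lambda>n. \<Sum>i<n. f i) \<longlonglongrightarrow> Z" using f_sums by (simp add: sums_def)
    have "(\<Sum>i<n. f i) \<le> 1 + 1 / (s - 1)" for n
    proof -
      have "(\<Sum>i<n. f i) \<le> (\<Sum>i\<in>insert 0 {1..n}. f i)"
        by (intro sum_mono2) (auto simp: f_nonneg)
      also have "\<dots> = (\<Sum>i=1..n. f i)" by (simp add: f_def)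
      finally show ?thesis using zeta_upper[OF s, of n] by (simp add: f_def)
    qed
    then show "\<exists>N. \<forall>n\<ge>N. (\<Sum>i<n. f i) \<le> 1 + 1 / (s - 1)" by blast
  qed
  have L_le: "L \<le> 1"
  proof (rule LIMSEQ_le_const2)
    have "strict_mono (\<lambda>K::nat. 4 * K + 1)" by (auto simp: strict_mono_def)
    from LIMSEQ_subseq_LIMSEQ[OF g_sums[unfolded sums_def] this]
    show "(\<lambda>K. \<Sum>i<4*K+1. g i) \<longlonglongrightarrow> L" unfolding o_def .
    have "(\<Sum>i<4*K+1. g i) \<le> 1" for K
      using L_upper[OF s, of K] powr_ge_zero[of "real (4 * K + 1)" "-s"]
      unfolding g_def f_def by linarith
    then show "\<exists>N. \<forall>K\<ge>N. (\<Sum>i<4*K+1. g i) \<le> 1" by blast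
  qed
  \<comment> \<open>Apart from 1, an integer without prime factors up to \<open>Y\<close> exceeds
    \<open>Y\<close>; Y \<ge> 2 lets the prime 2 sieve out 0. With the tail beyond \<open>Y\<close>
    at most 1 / 2, the sieved sums of \<open>f\<close> and \<open>g\<close> are at least 1 and 1 /
    2.\<close>
  obtain Y where Y: "Y \<ge> z" "Y \<ge> 2" "(\<Sum>n. f (n + Suc Y)) \<le> 1 / 2"
  proof -
    have "(\<lambda>n. \<Sum>i. f (i + n)) \<longlonglongrightarrow> 0" by (rule suminf_exist_split2[OF sf])
    then have "\<forall>\<^sub>F n in sequentially. (\<Sum>i. f (i + n)) < 1 / 2" by (rule order_tendstoD) auto
    then obtain N where N: "\<And>n. n \<ge> N \<Longrightarrow> (\<Sum>i. f (i + n)) < 1 / 2"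
      by (auto simp: eventually_sequentially)
    have "(\<Sum>i. f (i + Suc (max N (max z 2)))) < 1 / 2" by (rule N) simp
    then show ?thesis by (intro that[of "max N (max z 2)"]) simp_all
  qed
  define P where "P = {p. prime p \<and> p \<le> Y}"
  define C where "C = {n. \<forall>p\<in>P. \<not> p dvd n}"
  have finP: "finite P" unfolding P_def by auto
  have "1 \<in> C" unfolding C_def P_def using not_prime_1 by (auto simp del: One_nat_def)
  then have C1: "C = insert 1 (C - {1})" by blast
  have Cbig: "n > Y" if nC: "n \<in> C - {1}" for n
  proof (rule ccontr)
    assume "\<not> n > Y"
    then have n: "n \<le> Y" by simp
    obtain p where p: "prime p" "p dvd n" using nC prime_factor_nat[of n] by auto
    show False
    proof (cases "n = 0")
      case True
      then show False using that Y two_is_prime_nat by (auto simp: C_def P_def)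
    next
      case False
      then have "p \<in> P" using p n dvd_imp_le[of p n] by (simp add: P_def)
      then show False using that p by (simp add: C_def)
    qed
  qed
  have tail: "infsum f (C - {1}) \<le> 1 / 2"
  proof -
    have "C - {1} \<subseteq> {Suc Y..}"
      using Cbig by (intro subsetI) (simp only: atLeast_iff Suc_le_eq)
    then have "infsum f (C - {1}) \<le> infsum f {Suc Y..}"
      using f_nonneg by (intro infsum_mono2 sub_f) auto
    also have "\<dots> = infsum (\<lambda>n. f (n + Suc Y)) UNIV"
      by (rule infsum_reindex_bij_witness[of _ "\<lambda>n. n + Suc Y" "\<lambda>n. n - Suc Y"]) auto
    also have "\<dots> = (\<Sum>n. f (n + Suc Y))"
    proof -
      have "(\<lambda>n. f (n + Suc Y)) summable_on UNIV"
        using summable_ignore_initial_segment[OF sf, of "Suc Y"] f_nonneg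
        by (subst summable_on_UNIV_nonneg_real_iff) auto
      then show ?thesis using has_sum_imp_sums[OF has_sum_infsum] sums_unique by blast
    qed
    finally show ?thesis using Y by linarith
  qed
  have gtail: "infsum g (C - {1}) \<ge> - (1 / 2)"
  proof -
    have "infsum (\<lambda>n. - f n) (C - {1}) \<le> infsum g (C - {1})"
    proof (rule infsum_mono)
      show "(\<lambda>n. - f n) summable_on (C - {1})" using sub_f by (simp add: summable_on_uminus)
      show "- f n \<le> g n" for n using g_le[of n] f_nonneg[of n] by (simp add: abs_le_iff)
    qed (rule sub_g)
    then show ?thesis using tail by (simp add: infsum_uminus)
  qed
  have split: "infsum h C = h 1 + infsum h (C - {1})" if "h summable_on (C - {1})" for h :: "nat \<Rightarrow> real"
    using infsum_insert[OF that, of 1] C1 by simp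
  have prime_P: "prime p" if "p \<in> P" for p using that by (simp add: P_def)
  have fp: "0 < f p" "f p < 1" if "prime p" for p
    using prime_gt_1_nat[OF that] prime_powr_less_1[OF that] s by (auto simp: f_def)
  have gp: "\<bar>g p\<bar> < 1" if "prime p" for p
    using g_le[of p] fp[OF that] by simp
  have "infsum f C \<ge> 1"
    using split[OF sub_f] infsum_nonneg[of "C - {1}" f] f_nonneg by (simp add: f_def)
  then have Zprod: "Z * (\<Prod>p\<in>P. 1 - f p) \<ge> 1"
    unfolding Z_def C_def using euler_sieve[OF f_mult f_abs finP prime_P] by simp
  have "infsum g C \<ge> 1 / 2"
    using split[OF sub_g] gtail by (simp add: f_def g_def)
  then have Lprod: "L * (\<Prod>p\<in>P. 1 - g p) \<ge> 1 / 2"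
    unfolding L_def C_def using euler_sieve[OF g_mult g_abs finP prime_P] by simp
  define T where "T = {p. prime p \<and> p \<le> z \<and> p mod 4 = 1}"
  have "T \<subseteq> P" using Y by (auto simp: T_def P_def)
  \<comment> \<open>The Euler factors of the two series multiply to (1 - f p)^2 if chi p = 1, to 1 -
    f p if chi p = 0, and to 1 - (f p)^2 if chi p = -1. Outside \<open>T\<close> the bound 1 is
    enough.\<close>
  have factor: "0 < (1 - f p) * (1 - g p)" "(1 - f p) * (1 - g p) \<le> (if p \<in> T then (1 - f p)\<^sup>2 else 1)"
    if p: "prime p" for p
  proof -
    show "0 < (1 - f p) * (1 - g p)" using fp[OF p] gp[OF p] by (intro mult_pos_pos) auto
    have "chi p = 1 \<or> chi p = 0 \<or> chi p = -1" by (simp add: chi_def)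
    moreover have "chi p = 1" if "p \<in> T" using that by (simp add: T_def chi_def)
    moreover have "(1 - f p) * (1 - f p) \<le> 1 * 1" using fp[OF p] by (intro mult_mono) auto
    moreover have "(1 - f p) * (1 + f p) \<le> 1" by (simp add: algebra_simps)
    ultimately show "(1 - f p) * (1 - g p) \<le> (if p \<in> T then (1 - f p)\<^sup>2 else 1)"
      using fp[OF p] by (auto simp: g_def power2_eq_square)
  qed
  have "(1 / 2 :: real) = 1 * (1 / 2)" by simp
  also have "\<dots> \<le> (Z * (\<Prod>p\<in>P. 1 - f p)) * (L * (\<Prod>p\<in>P. 1 - g p))"
    using Zprod Lprod by (intro mult_mono) auto
  also have "\<dots> = Z * L * (\<Prod>p\<in>P. (1 - f p) * (1 - g p))"
    by (simp add: prod.distrib mult_ac)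
  finally have half: "1 / 2 \<le> Z * L * (\<Prod>p\<in>P. (1 - f p) * (1 - g p))" .
  have prodpos: "(\<Prod>p\<in>P. (1 - f p) * (1 - g p)) > 0"
    using factor(1) prime_P by (intro prod_pos) auto
  have Z0: "Z \<ge> 0" unfolding Z_def using f_nonneg by (intro infsum_nonneg) auto
  have "Z * L \<le> Z * 1" using L_le Z0 by (intro mult_left_mono) auto
  then have ZL: "Z * L \<le> 1 + 1 / (s - 1)" using Z_le by linarith
  have "(\<Prod>p\<in>P. (1 - f p) * (1 - g p)) \<le> (\<Prod>p\<in>P. if p \<in> T then (1 - f p)\<^sup>2 else 1)"
    using factor prime_P by (intro prod_mono) (auto intro: less_imp_le)
  also have "\<dots> = (\<Prod>p\<in>T. (1 - f p)\<^sup>2)"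
    using \<open>T \<subseteq> P\<close> finP by (subst prod.inter_restrict[symmetric]) (auto simp: Int_absorb1)
  also have "\<dots> = (\<Prod>p\<in>T. 1 - f p)\<^sup>2" by (simp add: prod_power_distrib)
  finally have "Z * L * (\<Prod>p\<in>P. (1 - f p) * (1 - g p)) \<le> (1 + 1 / (s - 1)) * (\<Prod>p\<in>T. 1 - f p)\<^sup>2"
    using ZL prodpos s by (intro mult_mono) auto
  with half have "1 / 2 \<le> (1 + 1 / (s - 1)) * (\<Prod>p\<in>T. 1 - f p)\<^sup>2" by linarith
  moreover have "(\<Prod>p\<in>T. 1 - f p) > 0" using fp by (intro prod_pos) (auto simp: T_def)
  ultimately show ?thesis
    unfolding T_def[symmetric] f_def[symmetric]
    by (simp add: prod_dividef power_divide divide_simps)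
qed


text \<open>By \<open>ln_le_prod_primes\<close> the Euler product over all primes up to z is at
  least ln z. The prime 2 contributes 2, and the primes 1 modulo 4 at most 2 exp 4 sqrt (ln z), so
  those 3 modulo 4 must supply the rest; passing from 1 / (1 - 1 / p) to 1 + 1 / p costs the last
  factor 2 of the constant.\<close>

lemma prod_primes_3_mod_4_lower:
  fixes z :: nat
  assumes "z \<ge> 3"
  shows "sqrt (ln (real z)) \<le> 8 * exp 4 * (\<Prod>p | prime p \<and> p \<le> z \<and> p mod 4 = 3. 1 + 1 / real p)"
proof -
  define l where "l = ln (real z)"
  have "exp 1 \<le> real z" using exp_le assms by linarith
  then have l: "l \<ge> 1" unfolding l_def using assms by (simp add: ln_ge_iff)
  \<comment> \<open>At this s the bound 1 + 1 / (s - 1) is of order ln z, while replacing p^-s by 1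
    / p for the primes up to z changes the product only by a bounded factor.\<close>
  define s where "s = 1 + 1 / l"
  have s: "s > 1" using l by (simp add: s_def)
  define P1 where "P1 = {p. prime p \<and> p \<le> z \<and> p mod 4 = 1}"
  define P3 where "P3 = {p. prime p \<and> p \<le> z \<and> p mod 4 = 3}"
  have fin: "finite P1" "finite P3" by (auto simp: P1_def P3_def)
  \<comment> \<open>The first-order cost of the change of exponent is ln p / (p l); the factor 2
    absorbs 1 - 1 / p \<ge> 1 / 2.\<close>
  define w where "w p = 2 * (ln (real p) / real p) / l" for p :: nat
  have compare: "1 - real p powr (-s) \<le> exp (w p) * (1 - 1 / real p)" if p: "prime p" for p
  proof -
    have p2: "real p \<ge> 2" using prime_ge_2_nat[OF p] by simp
    define x where "x = exp (- (ln (real p) / l))"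
    have "real p powr (-s) = exp (- ln (real p)) * x"
      using p2 by (simp add: powr_def s_def x_def exp_add[symmetric] algebra_simps)
    then have ps: "real p powr (-s) = x / p" using p2 by (simp add: exp_minus field_simps)
    have x: "1 - x \<le> ln (real p) / l" using exp_ge_add_one_self[of "- (ln (real p) / l)"] by (simp add: x_def)
    have x1: "x \<le> 1" using l p2 by (simp add: x_def)
    have half: "1 / 2 \<le> 1 - 1 / real p" using p2 by (simp add: field_simps)
    define y where "y = (1 - x) / p"
    have "2 * y \<le> w p"
    proof -
      have "2 * y \<le> 2 * ((ln (real p) / l) / p)"
        unfolding y_def using x by (intro mult_left_mono divide_right_mono) auto
      then show ?thesis by (simp add: w_def mult.commute)
    qed
    moreover have "2 * y * (1 / 2) \<le> 2 * y * (1 - 1 / real p)"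
      using x1 by (intro mult_left_mono half) (auto simp: y_def)
    moreover have "2 * y * (1 - 1 / real p) \<le> w p * (1 - 1 / real p)"
      using \<open>2 * y \<le> w p\<close> half by (intro mult_right_mono) linarith+
    ultimately have "y \<le> w p * (1 - 1 / real p)" by simp
    moreover have "1 - real p powr (-s) = (1 - 1 / real p) + y"
      unfolding ps y_def by (simp add: diff_divide_distrib)
    ultimately have "1 - real p powr (-s) \<le> (1 - 1 / real p) + w p * (1 - 1 / real p)" by simp
    also have "\<dots> = (1 + w p) * (1 - 1 / real p)" by (metis distrib_right mult_1)
    also have "\<dots> \<le> exp (w p) * (1 - 1 / real p)"
      using half by (intro mult_right_mono exp_ge_add_one_self) auto
    finally show ?thesis .
  qed
  have pos: "1 - 1 / real p > 0" "1 - real p powr (-s) > 0" if "prime p" for p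
    using prime_gt_1_nat[OF that] prime_powr_less_1[OF that] s by auto
  define A1 where "A1 = (\<Prod>p\<in>P1. 1 / (1 - 1 / real p))"
  define A3 where "A3 = (\<Prod>p\<in>P3. 1 / (1 - 1 / real p))"
  define As where "As = (\<Prod>p\<in>P1. 1 / (1 - real p powr (-s)))"
  define \<sigma> where "\<sigma> = (\<Prod>p\<in>P3. 1 + 1 / real p)"
  have A1_pos: "A1 \<ge> 0" unfolding A1_def using pos by (intro prod_nonneg) (auto simp: P1_def less_imp_le)
  have As_pos: "As \<ge> 0" unfolding As_def using pos by (intro prod_nonneg) (auto simp: P1_def less_imp_le)
  have A3_pos: "A3 \<ge> 0" unfolding A3_def using pos by (intro prod_nonneg) (auto simp: P3_def less_imp_le)
  have \<sigma>_pos: "\<sigma> \<ge> 0" unfolding \<sigma>_def by (intro prod_nonneg) auto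
  have "A1 \<le> (\<Prod>p\<in>P1. exp (w p) * (1 / (1 - real p powr (-s))))"
    unfolding A1_def
  proof (rule prod_mono)
    fix p assume "p \<in> P1"
    then have p: "prime p" by (simp add: P1_def)
    have "1 / (1 - 1 / real p) \<le> exp (w p) / (1 - real p powr (-s))"
      using compare[OF p] pos[OF p] by (simp add: divide_le_eq pos_le_divide_eq mult.commute)
    then show "0 \<le> 1 / (1 - 1 / real p) \<and> 1 / (1 - 1 / real p) \<le> exp (w p) * (1 / (1 - real p powr (-s)))"
      using pos[OF p] by simp
  qed
  also have "\<dots> = exp (\<Sum>p\<in>P1. w p) * As"
    using fin by (simp only: prod.distrib exp_sum As_def)
  also have "\<dots> \<le> exp 4 * As"
  proof (intro mult_right_mono As_pos)
    have "(\<Sum>p\<in>P1. ln (real p) / real p) \<le> (\<Sum>p | prime p \<and> p \<le> z. ln (real p) / real p)"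
      by (intro sum_mono2) (auto simp: P1_def dest: prime_ge_1_nat)
    also have "\<dots> \<le> 2 * l" unfolding l_def by (rule sum_ln_primes_over_p)
    finally have "2 * (\<Sum>p\<in>P1. ln (real p) / real p) / l \<le> 2 * (2 * l) / l"
      using l by (intro divide_right_mono mult_left_mono) auto
    also have "2 * (2 * l) / l = 4" using l by simp
    finally have "(\<Sum>p\<in>P1. w p) \<le> 4"
      by (simp add: w_def sum_distrib_left sum_divide_distrib)
    then show "exp (\<Sum>p\<in>P1. w p) \<le> exp 4" by simp
  qed
  finally have A1_As: "A1 \<le> exp 4 * As" .
  have "As\<^sup>2 \<le> 2 * (1 + 1 / (s - 1))"
    unfolding As_def P1_def by (rule prod_primes_1_mod_4_at_s[OF s])
  also have "\<dots> \<le> 4 * l" using l by (simp add: s_def)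
  finally have "As \<le> sqrt (4 * l)" by (rule real_le_rsqrt)
  then have "As \<le> 2 * sqrt l" by (simp add: real_sqrt_mult)
  then have "exp 4 * As \<le> exp 4 * (2 * sqrt l)" by (intro mult_left_mono) auto
  from order_trans[OF A1_As this] have A1_le: "A1 \<le> 2 * exp 4 * sqrt l" by (simp only: mult_ac)
  \<comment> \<open>For N \<ge> 1 the product telescopes to (N + 1) / (2 N). It bounds the product
    of (1 - 1 / p) (1 + 1 / p) over \<open>P3\<close> from below, because the omitted factors are at
    most 1.\<close>
  have sq: "(\<Prod>n=2..N. 1 - 1 / (real n)\<^sup>2) \<ge> 1 / 2" for N
  proof (cases "N \<ge> 1")
    case True
    then have eq: "(\<Prod>n=2..N. 1 - 1 / (real n)\<^sup>2) = (real N + 1) / (2 * real N)"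
    proof (induction N rule: dec_induct)
      case (step n)
      have "{2..Suc n} = insert (Suc n) {2..n}" using step by auto
      then have "(\<Prod>n=2..Suc n. 1 - 1 / (real n)\<^sup>2) = (1 - 1 / (real (Suc n))\<^sup>2) * ((real n + 1) / (2 * real n))"
        using step by simp
      also have "\<dots> = (real (Suc n) + 1) / (2 * real (Suc n))"
      proof -
        have key: "(1 - 1 / x\<^sup>2) * (x / (2 * (x - 1))) = (x + 1) / (2 * x)" if "x > 1" for x :: real
        proof -
          have "1 - 1 / x\<^sup>2 = (x - 1) * (x + 1) / (x * x)"
            using that by (simp add: field_simps power2_eq_square)
          moreover have "(x - 1) * (x + 1) / (x * x) * (x / (2 * (x - 1))) = ((x - 1) * x * (x + 1)) / ((x - 1) * x * (2 * x))"
            by (simp add: mult_ac)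
          moreover have "\<dots> = (x + 1) / (2 * x)"
            using that by (subst mult_divide_mult_cancel_left) auto
          ultimately show ?thesis by simp
        qed
        show ?thesis using key[of "real (Suc n)"] step by (simp add: add.commute)
      qed
      finally show ?case .
    qed auto
    show ?thesis unfolding eq using True by (simp add: divide_le_eq pos_le_divide_eq)
  qed auto
  have "1 / 2 \<le> (\<Prod>n=2..z. 1 - 1 / (real n)\<^sup>2)" by (rule sq)
  also have "\<dots> \<le> (\<Prod>p\<in>P3. 1 - 1 / (real p)\<^sup>2)"
  proof -
    have "(\<Prod>n=2..z. 1 - 1 / (real n)\<^sup>2) = (\<Prod>n\<in>{2..z} - P3. 1 - 1 / (real n)\<^sup>2) * (\<Prod>p\<in>P3. 1 - 1 / (real p)\<^sup>2)"
      by (rule prod.subset_diff) (auto simp: P3_def prime_ge_2_nat)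
    also have "\<dots> \<le> 1 * (\<Prod>p\<in>P3. 1 - 1 / (real p)\<^sup>2)"
    proof (intro mult_right_mono prod_le_1 prod_nonneg)
      fix p assume "p \<in> P3"
      then have "1 \<le> real p" by (auto simp: P3_def prime_ge_1_nat)
      then show "0 \<le> 1 - 1 / (real p)\<^sup>2" by (simp add: divide_le_eq)
    qed (auto simp: divide_le_eq)
    finally show ?thesis by simp
  qed
  also have "\<dots> = (\<Prod>p\<in>P3. (1 - 1 / real p) * (1 + 1 / real p))"
    by (simp add: algebra_simps power2_eq_square)
  also have "\<dots> = (\<Prod>p\<in>P3. 1 - 1 / real p) * \<sigma>"
    by (simp add: prod.distrib \<sigma>_def)
  finally have "1 / 2 \<le> (\<Prod>p\<in>P3. 1 - 1 / real p) * \<sigma>" .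
  moreover have "(\<Prod>p\<in>P3. 1 - 1 / real p) > 0" using pos by (intro prod_pos) (auto simp: P3_def)
  ultimately have A3_le: "A3 \<le> 2 * \<sigma>"
    unfolding A3_def by (simp add: prod_dividef divide_le_eq mult_ac)
  have primes: "{p. prime p \<and> p \<le> z} = insert 2 (P1 \<union> P3)"
  proof -
    have "p = 2 \<or> p mod 4 = 1 \<or> p mod 4 = 3" if "prime p" for p :: nat
    proof -
      have "p = 2 \<or> odd p" using prime_odd_nat[of p] prime_ge_2_nat[of p] that by fastforce
      then show ?thesis by presburger
    qed
    then show ?thesis using assms by (auto simp: P1_def P3_def)
  qed
  have "l \<le> (\<Prod>p | prime p \<and> p \<le> z. 1 / (1 - 1 / real p))"
    unfolding l_def using assms by (intro ln_le_prod_primes) auto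
  also have "\<dots> = 2 * (A1 * A3)"
  proof -
    have "2 \<notin> P1 \<union> P3" "P1 \<inter> P3 = {}" by (auto simp: P1_def P3_def)
    then show ?thesis unfolding primes A1_def A3_def using fin
      by (subst prod.insert) (auto simp: prod.union_disjoint)
  qed
  also have "\<dots> \<le> 2 * ((2 * exp 4 * sqrt l) * (2 * \<sigma>))"
    using A1_le A3_le A1_pos A3_pos l by (intro mult_left_mono mult_mono) auto
  also have "2 * ((2 * exp 4 * sqrt l) * (2 * \<sigma>)) = sqrt l * (8 * exp 4 * \<sigma>)" by simp
  finally have "sqrt l * sqrt l \<le> sqrt l * (8 * exp 4 * \<sigma>)"
    using l by (simp only: real_sqrt_mult_self)
  then have "sqrt l \<le> 8 * exp 4 * \<sigma>" using l by - (rule mult_left_le_imp_le[of "sqrt l"], auto)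
  then show ?thesis by (simp add: l_def \<sigma>_def P3_def)
qed

section \<open>Moduli with a large sum of reciprocal divisors\<close>

lemma prod_le_sum_divisors:
  assumes "finite P" "\<And>p. p \<in> P \<Longrightarrow> prime p"
  shows "(\<Prod>p\<in>P. 1 + 1 / real p) \<le> (\<Sum>g | g dvd \<Prod>P. 1 / real g)"
  using assms
proof (induction P rule: finite_induct)
  case (insert p P)
  define m where "m = \<Prod>P"
  have p: "prime p" using insert by auto
  have m0: "m > 0" unfolding m_def using insert by (intro prod_pos) (auto simp: prime_gt_0_nat)
  have cop: "\<not> p dvd m" unfolding m_def
    using insert p primes_dvd_imp_eq[OF p] by (subst prime_dvd_prod_iff) auto
  have fin: "finite {g. g dvd m}" using m0 by simp
  have "(\<Prod>r\<in>insert p P. 1 + 1 / real r) \<le> (1 + 1 / real p) * (\<Sum>g | g dvd m. 1 / real g)"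
    using insert by (simp add: m_def mult_left_mono)
  also have "\<dots> = (\<Sum>g | g dvd m. 1 / real g) + (\<Sum>g | g dvd m. 1 / real (p * g))"
    unfolding distrib_right by (simp add: sum_distrib_left)
  also have "(\<Sum>g | g dvd m. 1 / real (p * g)) = (\<Sum>g\<in>(\<lambda>g. p * g) ` {g. g dvd m}. 1 / real g)"
    using p by (subst sum.reindex) (auto simp: inj_on_def prime_gt_0_nat)
  also have "(\<Sum>g | g dvd m. 1 / real g) + \<dots> = (\<Sum>g\<in>{g. g dvd m} \<union> (\<lambda>g. p * g) ` {g. g dvd m}. 1 / real g)"
    using cop fin by (intro sum.union_disjoint[symmetric]) (auto dest: dvd_mult_left)
  also have "\<dots> \<le> (\<Sum>g | g dvd p * m. 1 / real g)"
    using m0 p by (intro sum_mono2) (auto simp: prime_gt_0_nat)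
  finally show ?case using insert by (simp add: m_def)
qed auto

text \<open>The witness is the product of the primes 3 modulo 4 up to z that do not divide
  \<open>n0\<close>; leaving those out costs the constant factor \<open>K\<close>. The crude bound
  z^z suffices, since only ln (ln q) enters the result.\<close>

lemma exists_resonant_moduli:
  fixes n0 :: nat
  assumes "n0 > 0"
  obtains q :: "nat \<Rightarrow> nat" and c :: real
  where "c > 0" "\<And>z. squarefree (q z)" "\<And>z p. prime p \<Longrightarrow> p dvd q z \<Longrightarrow> p mod 4 = 3"
    "\<And>z. coprime (q z) n0" "\<And>z. z \<ge> 1 \<Longrightarrow> q z \<le> z ^ z"
    "\<And>z. z \<ge> 3 \<Longrightarrow> c * sqrt (ln (real z)) \<le> (\<Sum>g | g dvd q z. 1 / real g)"
proof -
  define P where "P z = {p. prime p \<and> p \<le> z \<and> p mod 4 = 3 \<and> \<not> p dvd n0}" for z :: nat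
  define q where "q z = \<Prod>(P z)" for z
  have fin: "finite (P z)" for z by (auto simp: P_def)
  have prime_P: "prime p" if "p \<in> P z" for p z using that by (simp add: P_def)
  have dvd_q: "p \<in> P z" if "prime p" "p dvd q z" for p z
    using that fin[of z] prime_P unfolding q_def
    by (subst (asm) prime_dvd_prod_iff) (use primes_dvd_imp_eq in blast)+
  define K where "K = (\<Prod>p\<in>prime_factors n0. 1 + 1 / real p)"
  have K: "K > 0" unfolding K_def by (intro prod_pos) (auto simp: add_pos_nonneg)
  show ?thesis
  proof (rule that[of "1 / (8 * exp 4 * K)" q])
    show "1 / (8 * exp 4 * K) > 0" using K by simp
    show "squarefree (q z)" for z
      unfolding q_def using prime_P
      by (intro squarefree_prod_coprime) (auto simp: primes_coprime squarefree_prime)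
    show "p mod 4 = 3" if "prime p" "p dvd q z" for p z
      using dvd_q[OF that] by (simp add: P_def)
    show "coprime (q z) n0" for z
      unfolding q_def by (intro prod_coprime_left) (auto simp: P_def prime_imp_coprime)
    show "q z \<le> z ^ z" if "z \<ge> 1" for z
    proof -
      have "q z \<le> (\<Prod>p\<in>P z. z)" unfolding q_def by (intro prod_mono) (auto simp: P_def)
      also have "\<dots> = z ^ card (P z)" by simp
      also have "\<dots> \<le> z ^ z"
      proof (rule power_increasing)
        have "P z \<subseteq> {1..z}" by (auto simp: P_def prime_ge_1_nat)
        from card_mono[OF _ this] show "card (P z) \<le> z" by simp
      qed (use that in auto)
      finally show ?thesis .
    qed
    show "1 / (8 * exp 4 * K) * sqrt (ln (real z)) \<le> (\<Sum>g | g dvd q z. 1 / real g)" if "z \<ge> 3" for z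
    proof -
      define R where "R = {p. prime p \<and> p \<le> z \<and> p mod 4 = 3 \<and> p dvd n0}"
      have "{p. prime p \<and> p \<le> z \<and> p mod 4 = 3} = P z \<union> R" "P z \<inter> R = {}" "finite R"
        by (auto simp: P_def R_def)
      then have "(\<Prod>p | prime p \<and> p \<le> z \<and> p mod 4 = 3. 1 + 1 / real p)
          = (\<Prod>p\<in>P z. 1 + 1 / real p) * (\<Prod>p\<in>R. 1 + 1 / real p)"
        using fin by (simp add: prod.union_disjoint)
      also have "\<dots> \<le> (\<Sum>g | g dvd q z. 1 / real g) * K"
      proof (intro mult_mono)
        show "(\<Prod>p\<in>P z. 1 + 1 / real p) \<le> (\<Sum>g | g dvd q z. 1 / real g)"
          unfolding q_def using fin prime_P by (rule prod_le_sum_divisors)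
        show "(\<Prod>p\<in>R. 1 + 1 / real p) \<le> K"
          unfolding K_def using assms by (intro prod_mono2) (auto simp: R_def in_prime_factors_iff)
      qed (auto intro!: sum_nonneg prod_nonneg)
      finally have "8 * exp 4 * (\<Prod>p | prime p \<and> p \<le> z \<and> p mod 4 = 3. 1 + 1 / real p)
          \<le> 8 * exp 4 * ((\<Sum>g | g dvd q z. 1 / real g) * K)"
        by (intro mult_left_mono) auto
      then have "sqrt (ln (real z)) \<le> 8 * exp 4 * ((\<Sum>g | g dvd q z. 1 / real g) * K)"
        using prod_primes_3_mod_4_lower[OF that] by linarith
      then show ?thesis using K by (simp add: divide_le_eq mult_ac)
    qed
  qed
qed

subsection \<open>Moebius inversion for primitive points\<close>

definition ivec :: "int \<times> int \<Rightarrow> real^2" where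
  "ivec v = vector [of_int (fst v), of_int (snd v)]"

lemma ivec_nth [simp]: "ivec v $ 1 = of_int (fst v)" "ivec v $ 2 = of_int (snd v)"
  by (simp_all add: ivec_def)

lemma inj_ivec: "inj ivec"
  by (rule injI) (auto simp: vec_eq_iff forall_2 prod_eq_iff)

text \<open>The origin is excluded because every d divides it, so it would enter every term of the
  Moebius sum.\<close>

definition lattice_in :: "(real^2) set \<Rightarrow> real \<Rightarrow> (int \<times> int) set" where
  "lattice_in A t = {v. v \<noteq> (0, 0) \<and> ivec v \<in> (\<lambda>x. t *\<^sub>R x) ` A}"

lemma mem_lattice_in:
  assumes "t > 0"
  shows "v \<in> lattice_in A t \<longleftrightarrow> v \<noteq> (0, 0) \<and> (1 / t) *\<^sub>R ivec v \<in> A"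
proof -
  have "ivec v \<in> (\<lambda>x. t *\<^sub>R x) ` A \<longleftrightarrow> (1 / t) *\<^sub>R ivec v \<in> A"
  proof
    assume "(1 / t) *\<^sub>R ivec v \<in> A"
    then have "t *\<^sub>R ((1 / t) *\<^sub>R ivec v) \<in> (\<lambda>x. t *\<^sub>R x) ` A" by (rule imageI)
    then show "ivec v \<in> (\<lambda>x. t *\<^sub>R x) ` A" using assms by simp
  qed (use assms in auto)
  then show ?thesis by (simp add: lattice_in_def)
qed

lemma lattice_in_bounded:
  assumes "\<And>x. x \<in> A \<Longrightarrow> norm x \<le> R" "t > 0" "t * R \<le> real D" "v \<in> lattice_in A t"
  shows "\<bar>fst v\<bar> \<le> int D" "\<bar>snd v\<bar> \<le> int D"
proof -
  have "norm ((1 / t) *\<^sub>R ivec v) \<le> R" using assms mem_lattice_in by blast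
  then have "norm (ivec v) \<le> t * R" using assms(2) by (simp add: divide_le_eq mult.commute)
  then have "norm (ivec v) \<le> real D" using assms(3) by linarith
  then have "\<bar>ivec v $ i\<bar> \<le> real D" for i using component_le_norm_cart order_trans by blast
  from this[of 1] this[of 2] show "\<bar>fst v\<bar> \<le> int D" "\<bar>snd v\<bar> \<le> int D"
    by simp_all
qed

lemma finite_lattice_in:
  assumes "\<And>x. x \<in> A \<Longrightarrow> norm x \<le> R" "t > 0"
  shows "finite (lattice_in A t)"
proof -
  obtain D :: nat where D: "t * R \<le> real D" using real_arch_simple by blast
  have "lattice_in A t \<subseteq> {- int D..int D} \<times> {- int D..int D}"
    using lattice_in_bounded[OF assms(1) assms(2) D] by (force simp: abs_le_iff)
  then show ?thesis by (rule finite_subset) auto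
qed

lemma primitive_points_eq: "primitive_points = ivec ` {v. gcd (fst v) (snd v) = 1}"
proof -
  have "x \<in> primitive_points \<longleftrightarrow> (\<exists>m n. x = ivec (m, n) \<and> gcd m n = 1)" for x
    unfolding primitive_points_def ivec_def mem_Collect_eq fst_conv snd_conv ..
  then show ?thesis by (force simp: image_iff)
qed

text \<open>The points of t A divisible by d are d times the points of (t / d) A, and
  \<open>mu\<close> summed over the divisors of the gcd detects gcd 1. Stopping at \<open>D\<close>
  loses nothing: the gcd of a nonzero point is at most the absolute value of a nonzero
  coordinate.\<close>

lemma card_primitive_moebius:
  assumes R: "\<And>x. x \<in> A \<Longrightarrow> norm x \<le> R" and t: "t > 0" and D: "t * R \<le> real D"
  shows "real (card ((\<lambda>x. t *\<^sub>R x) ` A \<inter> primitive_points))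
    = (\<Sum>d=1..D. mu d * real (card (lattice_in A (t / real d))))"
proof -
  define L where "L = lattice_in A t"
  define G where "G v = nat (gcd (fst v) (snd v))" for v :: "int \<times> int"
  have finL: "finite L" unfolding L_def by (rule finite_lattice_in[OF R t])
  have G_pos: "G v > 0" if "v \<in> L" for v
    using that by (auto simp: L_def lattice_in_def G_def prod_eq_iff)
  have G_le: "G v \<le> D" if "v \<in> L" for v
  proof -
    have "fst v \<noteq> 0 \<or> snd v \<noteq> 0" using that by (auto simp: L_def lattice_in_def prod_eq_iff)
    moreover have "gcd (fst v) (snd v) \<le> \<bar>fst v\<bar>" if "fst v \<noteq> 0" using that by (simp add: zdvd_imp_le)
    moreover have "gcd (fst v) (snd v) \<le> \<bar>snd v\<bar>" if "snd v \<noteq> 0" using that by (simp add: zdvd_imp_le)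
    ultimately have "gcd (fst v) (snd v) \<le> int D"
      using lattice_in_bounded[OF R t D that[unfolded L_def]] by linarith
    then show ?thesis by (simp add: G_def)
  qed
  have dvd_G: "d dvd G v \<longleftrightarrow> int d dvd fst v \<and> int d dvd snd v" for d v
  proof -
    have "int (G v) = gcd (fst v) (snd v)" by (simp add: G_def)
    moreover have "d dvd G v \<longleftrightarrow> int d dvd int (G v)" by simp
    ultimately show ?thesis by simp
  qed
  have eq: "(\<lambda>x. t *\<^sub>R x) ` A \<inter> primitive_points = ivec ` {v \<in> L. G v = 1}"
  proof -
    define X where "X = (\<lambda>x. t *\<^sub>R x) ` A"
    have "X \<inter> ivec ` {v. gcd (fst v) (snd v) = 1} = ivec ` {v. gcd (fst v) (snd v) = 1 \<and> ivec v \<in> X}" by auto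
    also have "{v. gcd (fst v) (snd v) = 1 \<and> ivec v \<in> X} = {v \<in> L. G v = 1}"
    proof (rule Collect_cong)
      fix v :: "int \<times> int"
      have "G v = 1 \<longleftrightarrow> gcd (fst v) (snd v) = 1" unfolding G_def by (auto simp: nat_eq_iff)
      moreover have "v \<in> L \<longleftrightarrow> ivec v \<in> X" if "gcd (fst v) (snd v) = 1"
        using that unfolding L_def lattice_in_def X_def by auto
      ultimately show "gcd (fst v) (snd v) = 1 \<and> ivec v \<in> X \<longleftrightarrow> v \<in> L \<and> G v = 1" by metis
    qed
    finally show ?thesis unfolding X_def primitive_points_eq .
  qed
  have "real (card ((\<lambda>x. t *\<^sub>R x) ` A \<inter> primitive_points)) = real (card {v \<in> L. G v = 1})"
    unfolding eq using inj_ivec by (subst card_image) (auto intro: inj_on_subset)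
  also have "\<dots> = (\<Sum>v\<in>L. if G v = 1 then 1 else 0)"
    using finL by (simp add: sum.If_cases Int_def)
  also have "\<dots> = (\<Sum>v\<in>L. \<Sum>d | d dvd G v. mu d)"
    by (rule sum.cong) (auto simp: sum_mu_divisors G_pos)
  also have "\<dots> = (\<Sum>v\<in>L. \<Sum>d | d \<in> {1..D} \<and> d dvd G v. mu d)"
  proof (rule sum.cong)
    fix v assume v: "v \<in> L"
    have "d \<in> {1..D}" if "d dvd G v" for d
      using that G_pos[OF v] G_le[OF v] dvd_imp_le[OF that] by (auto simp: Suc_le_eq intro: Nat.gr0I)
    then have "{d. d dvd G v} = {d. d \<in> {1..D} \<and> d dvd G v}" by blast
    then show "(\<Sum>d | d dvd G v. mu d) = (\<Sum>d | d \<in> {1..D} \<and> d dvd G v. mu d)" by simp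
  qed auto
  also have "\<dots> = (\<Sum>d=1..D. \<Sum>v | v \<in> L \<and> d dvd G v. mu d)"
    by (rule sum.swap_restrict) (use finL in auto)
  also have "\<dots> = (\<Sum>d=1..D. mu d * real (card (lattice_in A (t / real d))))"
  proof (rule sum.cong)
    fix d assume "d \<in> {1..D}"
    then have d: "d > 0" by simp
    define m where "m v = (int d * fst v, int d * snd v)" for v
    have "{v \<in> L. d dvd G v} = m ` lattice_in A (t / real d)"
    proof (intro equalityI subsetI)
      fix v assume v: "v \<in> {v \<in> L. d dvd G v}"
      then obtain a b where ab: "fst v = int d * a" "snd v = int d * b"
        using dvd_G by (auto elim!: dvdE)
      then have v_eq: "v = m (a, b)" by (simp add: m_def prod_eq_iff)
      have "ivec v = real d *\<^sub>R ivec (a, b)"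
        by (simp add: vec_eq_iff forall_2 ab)
      then have "(1 / t) *\<^sub>R ivec v = (1 / (t / real d)) *\<^sub>R ivec (a, b)" by simp
      moreover have "(a, b) \<noteq> (0, 0)" using v v_eq by (auto simp: m_def L_def lattice_in_def)
      ultimately have "(a, b) \<in> lattice_in A (t / real d)"
        using v t d by (simp add: mem_lattice_in L_def)
      then show "v \<in> m ` lattice_in A (t / real d)" using v_eq by blast
    next
      fix v assume "v \<in> m ` lattice_in A (t / real d)"
      then obtain u where u: "u \<in> lattice_in A (t / real d)" "v = m u" by blast
      have "ivec v = real d *\<^sub>R ivec u" by (simp add: vec_eq_iff forall_2 u m_def)
      then have "(1 / t) *\<^sub>R ivec v = (1 / (t / real d)) *\<^sub>R ivec u" by simp
      moreover have "v \<noteq> (0, 0)" using u d by (auto simp: m_def lattice_in_def prod_eq_iff)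
      ultimately have "v \<in> L" using u t d by (simp add: mem_lattice_in L_def)
      moreover have "d dvd G v" by (simp add: dvd_G u m_def)
      ultimately show "v \<in> {v \<in> L. d dvd G v}" by simp
    qed
    moreover have "inj_on m (lattice_in A (t / real d))"
      using d by (auto simp: inj_on_def m_def prod_eq_iff)
    ultimately have "card {v \<in> L. d dvd G v} = card (lattice_in A (t / real d))"
      by (simp add: card_image)
    then show "(\<Sum>v | v \<in> L \<and> d dvd G v. mu d) = mu d * real (card (lattice_in A (t / real d)))"
      by simp
  qed auto
  finally show ?thesis .
qed

text \<open>Three contributions remain, each O(t): \<open>B\<close> for each of D \<le> \<kappa> t
  values of d; the tail of mu d / d^2, at most 1 / D \<le> 1 / (t R), which meets a factor t^2; and
  the linear term, where the sum of mu d / d is bounded. Hence the two-sided condition on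
  \<open>D\<close>.\<close>

lemma error_expansion:
  fixes A :: "(real^2) set" and w h :: "'b \<Rightarrow> real"
  assumes R: "\<And>x. x \<in> A \<Longrightarrow> norm x \<le> R" "R > 0" and fin: "finite I"
    and count: "\<And>t. t > 0 \<Longrightarrow>
      \<bar>real (card (lattice_in A t)) - (measure lebesgue A * t\<^sup>2 - t * (\<Sum>i\<in>I. w i * saw (h i * t)) + c * t)\<bar> \<le> B"
    and t: "t > 0" and D: "t * R \<le> real D" "real D \<le> \<kappa> * t"
  shows "\<bar>primitive_error A t + t * (\<Sum>i\<in>I. w i * (\<Sum>d=1..D. mu d / real d * saw (h i * t / real d)))\<bar>
    \<le> (B * \<kappa> + measure lebesgue A / R + 2 * \<bar>c\<bar>) * t"
proof -
  define a where "a = measure lebesgue A"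
  have a: "a \<ge> 0" by (simp add: a_def)
  have B: "B \<ge> 0" using count[OF t] by linarith
  have "0 < t * R" using t R by simp
  then have D1: "D \<ge> 1" using D by (simp add: Suc_le_eq)
  define Q where "Q d = a * (t / real d)\<^sup>2 - (t / real d) * (\<Sum>i\<in>I. w i * saw (h i * (t / real d))) + c * (t / real d)" for d
  have 1: "\<bar>(\<Sum>d=1..D. mu d * real (card (lattice_in A (t / real d)))) - (\<Sum>d=1..D. mu d * Q d)\<bar> \<le> B * D"
  proof -
    have "\<bar>(\<Sum>d=1..D. mu d * (real (card (lattice_in A (t / real d))) - Q d))\<bar> \<le> (\<Sum>d=1..D. B)"
    proof (rule order_trans[OF sum_abs sum_mono])
      fix d assume "d \<in> {1..D}"
      then have "t / real d > 0" using t by simp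
      from count[OF this] have "\<bar>real (card (lattice_in A (t / real d))) - Q d\<bar> \<le> B"
        unfolding Q_def a_def .
      then have "\<bar>mu d\<bar> * \<bar>real (card (lattice_in A (t / real d))) - Q d\<bar> \<le> 1 * B"
        by (intro mult_mono abs_mu_le_1) auto
      then show "\<bar>mu d * (real (card (lattice_in A (t / real d))) - Q d)\<bar> \<le> B" by (simp add: abs_mult)
    qed
    then show ?thesis by (simp add: right_diff_distrib sum_subtractf mult.commute)
  qed
  have Qsum: "(\<Sum>d=1..D. mu d * Q d) = a * t\<^sup>2 * (\<Sum>d=1..D. mu d / (real d)\<^sup>2)
      - t * (\<Sum>i\<in>I. w i * (\<Sum>d=1..D. mu d / real d * saw (h i * t / real d))) + c * t * (\<Sum>d=1..D. mu d / real d)"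
  proof -
    have "mu d * Q d = a * t\<^sup>2 * (mu d / (real d)\<^sup>2) - t * (\<Sum>i\<in>I. w i * (mu d / real d * saw (h i * t / real d)))
        + c * t * (mu d / real d)" for d
      unfolding Q_def by (simp add: algebra_simps power_divide sum_distrib_left)
    then have "(\<Sum>d=1..D. mu d * Q d) = (\<Sum>d=1..D. a * t\<^sup>2 * (mu d / (real d)\<^sup>2))
      - (\<Sum>d=1..D. t * (\<Sum>i\<in>I. w i * (mu d / real d * saw (h i * t / real d)))) + (\<Sum>d=1..D. c * t * (mu d / real d))"
      by (simp only: sum.distrib sum_subtractf)
    also have "(\<Sum>d=1..D. t * (\<Sum>i\<in>I. w i * (mu d / real d * saw (h i * t / real d))))
      = t * (\<Sum>i\<in>I. w i * (\<Sum>d=1..D. mu d / real d * saw (h i * t / real d)))"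
      unfolding sum_distrib_left by (rule sum.swap)
    finally show ?thesis by (simp only: sum_distrib_left)
  qed
  have 2: "\<bar>a * t\<^sup>2 * (\<Sum>d=1..D. mu d / (real d)\<^sup>2) - 6 / pi\<^sup>2 * t\<^sup>2 * a\<bar> \<le> a / R * t"
  proof -
    have "\<bar>a * t\<^sup>2 * (\<Sum>d=1..D. mu d / (real d)\<^sup>2) - 6 / pi\<^sup>2 * t\<^sup>2 * a\<bar>
        = a * t\<^sup>2 * \<bar>(\<Sum>d=1..D. mu d / (real d)\<^sup>2) - 6 / pi\<^sup>2\<bar>"
    proof -
      have "a * t\<^sup>2 * (\<Sum>d=1..D. mu d / (real d)\<^sup>2) - 6 / pi\<^sup>2 * t\<^sup>2 * a
          = (a * t\<^sup>2) * ((\<Sum>d=1..D. mu d / (real d)\<^sup>2) - 6 / pi\<^sup>2)"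
        by (simp add: right_diff_distrib)
      then show ?thesis using a by (simp only: abs_mult) simp
    qed
    also have "\<dots> \<le> a * t\<^sup>2 * (1 / D)"
      using a D1 by (intro mult_left_mono sum_mu_over_squares) auto
    also have "\<dots> \<le> a * t\<^sup>2 * (1 / (t * R))"
      using a \<open>0 < t * R\<close> D(1) D1 t R(2) by (intro mult_left_mono divide_left_mono) auto
    also have "\<dots> = a / R * t" using t by (simp add: power2_eq_square)
    finally show ?thesis .
  qed
  have 3: "\<bar>c * t * (\<Sum>d=1..D. mu d / real d)\<bar> \<le> 2 * \<bar>c\<bar> * t"
  proof -
    have "\<bar>c * t\<bar> * \<bar>\<Sum>d=1..D. mu d / real d\<bar> \<le> \<bar>c * t\<bar> * 2"
      by (intro mult_left_mono abs_sum_mu_over_d) auto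
    then show ?thesis using t by (simp add: abs_mult mult_ac)
  qed
  have 4: "B * D \<le> B * \<kappa> * t" using mult_left_mono[OF D(2) B] by (simp add: mult.assoc)
  have E: "primitive_error A t = (\<Sum>d=1..D. mu d * real (card (lattice_in A (t / real d)))) - 6 / pi\<^sup>2 * t\<^sup>2 * a"
    using card_primitive_moebius[OF R(1) t D(1)] unfolding primitive_error_def a_def by simp
  have "(B * \<kappa> + a / R + 2 * \<bar>c\<bar>) * t = B * \<kappa> * t + a / R * t + 2 * \<bar>c\<bar> * t"
    by (simp add: distrib_right)
  then show ?thesis using 1 2 3 4 Qsum unfolding E a_def[symmetric] by linarith
qed

subsection \<open>Averaging over a progression\<close>

text \<open>The cut is at d = q^2. Below it \<open>saw_sum_long\<close> applies, and its error n d
  is divided by d, which leaves n for each d. Above it the step q / (n d) is at most 1, and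
  \<open>saw_sum_small_step\<close> divided by d costs 2 n / q for each of at most \<kappa> q^3
  values of d, plus the summable 2 q^3 / d^2.\<close>

lemma average_saw_series:
  fixes q n D :: nat and b \<kappa> :: real
  assumes q: "q > 0" and n: "n > 0" "coprime q n" and D: "q\<^sup>2 \<le> D" "real D \<le> \<kappa> * real q ^ 3"
  shows "\<bar>(\<Sum>k=q\<^sup>2..<q\<^sup>2+q\<^sup>2. \<Sum>d=1..D. mu d / real d * saw ((q * k + b) / (n * d)))
     - (real q)\<^sup>2 * (1 / n * (\<Sum>d=1..q\<^sup>2. mu d / real d * (gcd q d / real d) * saw (b / gcd q d)))\<bar>
     \<le> (real q)\<^sup>2 * (n + 2 * n * \<kappa> + 2)"
proof -
  define T where "T d = (\<Sum>k=q\<^sup>2..<q\<^sup>2+q\<^sup>2. saw ((q * k + b) / (n * d)))" for d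
  have swap: "(\<Sum>k=q\<^sup>2..<q\<^sup>2+q\<^sup>2. \<Sum>d=1..D. mu d / real d * saw ((q * k + b) / (n * d)))
      = (\<Sum>d=1..D. mu d / real d * T d)"
    unfolding T_def sum_distrib_left by (rule sum.swap)
  have split: "(\<Sum>d=1..D. mu d / real d * T d) = (\<Sum>d=1..q\<^sup>2. mu d / real d * T d) + (\<Sum>d=q\<^sup>2+1..D. mu d / real d * T d)"
    using sum.ub_add_nat[of 1 "q\<^sup>2" "\<lambda>d. mu d / real d * T d" "D - q\<^sup>2"] D(1) q by simp
  have small: "\<bar>(\<Sum>d=1..q\<^sup>2. mu d / real d * T d)
      - (real q)\<^sup>2 * (1 / n * (\<Sum>d=1..q\<^sup>2. mu d / real d * (gcd q d / real d) * saw (b / gcd q d)))\<bar> \<le> (real q)\<^sup>2 * n"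
  proof -
    have term_le: "\<bar>mu d / real d * (T d - (real q)\<^sup>2 * (gcd q d / (n * real d)) * saw (b / gcd q d))\<bar> \<le> n"
      if "d \<in> {1..q\<^sup>2}" for d
    proof -
      have d: "d > 0" using that by simp
      \<comment> \<open>Coprimality with n makes the gcd, and with it the main term, the same for
        all edges up to the factor 1 / n.\<close>
      have "gcd q (n * d) = gcd q d" using n(2) by (simp add: gcd_mult_right_left_cancel)
      then have "\<bar>T d - (real q)\<^sup>2 * (gcd q d / (n * real d)) * saw (b / gcd q d)\<bar> \<le> n * d"
        using saw_sum_long[where q = q and m = "n * d" and M = "q\<^sup>2" and N = "q\<^sup>2" and b = b] q n d unfolding T_def by simp
      then have "\<bar>mu d\<bar> * \<bar>T d - (real q)\<^sup>2 * (gcd q d / (n * real d)) * saw (b / gcd q d)\<bar> \<le> 1 * (real n * real d)"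
        by (intro mult_mono abs_mu_le_1) auto
      then show ?thesis using d by (simp add: abs_mult divide_le_eq)
    qed
    have "(\<Sum>d=1..q\<^sup>2. mu d / real d * T d)
      - (real q)\<^sup>2 * (1 / n * (\<Sum>d=1..q\<^sup>2. mu d / real d * (gcd q d / real d) * saw (b / gcd q d)))
      = (\<Sum>d=1..q\<^sup>2. mu d / real d * (T d - (real q)\<^sup>2 * (gcd q d / (n * real d)) * saw (b / gcd q d)))"
      unfolding sum_distrib_left sum_subtractf[symmetric]
      by (rule sum.cong) (auto simp: right_diff_distrib mult_ac)
    moreover have "\<bar>\<dots>\<bar> \<le> (\<Sum>d=1..q\<^sup>2. real n)"
      by (rule order_trans[OF sum_abs sum_mono[OF term_le]])
    ultimately show ?thesis by simp
  qed
  have large: "\<bar>\<Sum>d=q\<^sup>2+1..D. mu d / real d * T d\<bar> \<le> (real q)\<^sup>2 * (2 * n * \<kappa> + 2)"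
  proof -
    have "\<bar>mu d / real d * T d\<bar> \<le> 2 * n / q + 2 * (real q)^3 * (1 / (real d)\<^sup>2)" if "d \<in> {q\<^sup>2+1..D}" for d
    proof -
      have d: "d > q\<^sup>2" "d > 0" using that by auto
      have "q \<le> q\<^sup>2" using q by (simp add: power2_eq_square)
      moreover have "d \<le> n * d" using n by simp
      ultimately have qd: "q \<le> n * d" using d by linarith
      define \<gamma> where "\<gamma> = real q / (real n * real d)"
      have nd: "real n * real d > 0" using n d by simp
      have \<gamma>: "0 < \<gamma>" "\<gamma> \<le> 1" using q qd nd of_nat_mono[OF qd, where ?'a = real] by (auto simp: \<gamma>_def divide_le_eq)
      have "T d = (\<Sum>k=q\<^sup>2..<q\<^sup>2+q\<^sup>2. saw (\<gamma> * k + b / (n * d)))"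
        unfolding T_def \<gamma>_def by (simp add: add_divide_distrib)
      then have "\<bar>T d\<bar> \<le> 2 * (1 / \<gamma> + (real q)\<^sup>2 * \<gamma>)"
        using saw_sum_small_step[OF \<gamma>, where M = "q\<^sup>2" and N = "q\<^sup>2" and \<delta> = "b / (n * d)"] by simp
      then have "\<bar>mu d\<bar> * \<bar>T d\<bar> \<le> 1 * (2 * (1 / \<gamma> + (real q)\<^sup>2 * \<gamma>))"
        by (intro mult_mono abs_mu_le_1) auto
      then have "\<bar>mu d / real d * T d\<bar> \<le> 2 * (1 / \<gamma> + (real q)\<^sup>2 * \<gamma>) / real d"
        using d by (simp add: abs_mult divide_right_mono)
      also have "\<dots> = 2 * (1 / \<gamma>) / real d + 2 * ((real q)\<^sup>2 * \<gamma>) / real d"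
        by (simp add: add_divide_distrib)
      also have "2 * (1 / \<gamma>) / real d = 2 * n / q" using d q by (simp add: \<gamma>_def)
      also have "2 * ((real q)\<^sup>2 * \<gamma>) / real d = 2 * (real q)^3 * (1 / (real d)\<^sup>2) / n"
        using d q n by (simp add: \<gamma>_def power2_eq_square power3_eq_cube)
      also have "\<dots> \<le> 2 * (real q)^3 * (1 / (real d)\<^sup>2) / 1"
        using n by (intro divide_left_mono) auto
      finally show ?thesis by simp
    qed
    then have "\<bar>\<Sum>d=q\<^sup>2+1..D. mu d / real d * T d\<bar> \<le> (\<Sum>d=q\<^sup>2+1..D. 2 * n / q + 2 * (real q)^3 * (1 / (real d)\<^sup>2))"
      by (intro order_trans[OF sum_abs sum_mono]) auto
    also have "\<dots> = (real D - (real q)\<^sup>2) * (2 * n / q) + 2 * (real q)^3 * (\<Sum>d=q\<^sup>2+1..D. 1 / (real d)\<^sup>2)"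
      using D(1) by (simp add: sum.distrib sum_distrib_left of_nat_diff)
    also have "\<dots> \<le> (\<kappa> * real q ^ 3) * (2 * n / q) + 2 * (real q)^3 * (1 / (real (q\<^sup>2)))"
      using D q by (intro add_mono mult_right_mono mult_left_mono sum_inverse_squares_tail)
        (auto simp: Suc_le_eq intro: order_trans[rotated])
    also have "\<dots> = (real q)\<^sup>2 * (2 * n * \<kappa>) + 2 * real q"
      using q by (simp add: power2_eq_square power3_eq_cube)
    also have "\<dots> \<le> (real q)\<^sup>2 * (2 * n * \<kappa>) + 2 * (real q)\<^sup>2"
      using q by (simp add: power2_eq_square)
    finally show ?thesis by (simp add: algebra_simps)
  qed
  have "(real q)\<^sup>2 * (n + 2 * n * \<kappa> + 2) = (real q)\<^sup>2 * n + (real q)\<^sup>2 * (2 * n * \<kappa> + 2)"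
    by (simp add: algebra_simps)
  then show ?thesis unfolding swap split using small large by linarith
qed

section \<open>From averages to upper and lower limits\<close>

lemma Limsup_pos_of_frequently:
  fixes f :: "real \<Rightarrow> real"
  assumes "C > 0" "\<And>T. \<exists>t\<ge>T. f t \<ge> C"
  shows "Limsup at_top (\<lambda>t. ereal (f t)) > 0"
proof (rule ccontr)
  assume "\<not> ?thesis"
  moreover have "(0::ereal) < ereal C" using assms by simp
  ultimately have "Limsup at_top (\<lambda>t. ereal (f t)) < ereal C" by (meson le_less_trans not_less)
  then have "\<forall>\<^sub>F t in at_top. ereal (f t) < ereal C" by (rule Limsup_lessD)
  then obtain T where "\<And>t. t \<ge> T \<Longrightarrow> f t < C" by (auto simp: eventually_at_top_linorder)
  with assms(2)[of T] show False by force
qed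

lemma Liminf_neg_of_frequently:
  fixes f :: "real \<Rightarrow> real"
  assumes "C > 0" "\<And>T. \<exists>t\<ge>T. f t \<le> - C"
  shows "Liminf at_top (\<lambda>t. ereal (f t)) < 0"
proof (rule ccontr)
  assume "\<not> ?thesis"
  moreover have "ereal (- C) < (0::ereal)" using assms by simp
  ultimately have "ereal (- C) < Liminf at_top (\<lambda>t. ereal (f t))" by (meson less_le_trans not_less)
  then have "\<forall>\<^sub>F t in at_top. ereal (- C) < ereal (f t)" by (rule less_LiminfD)
  then obtain T where "\<And>t. t \<ge> T \<Longrightarrow> - C < f t" by (auto simp: eventually_at_top_linorder)
  with assms(2)[of T] show False by force
qed

lemma sum_inverse_divisors_le:
  assumes "q > 0"
  shows "(\<Sum>g | g dvd q. 1 / real g) \<le> real q"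
proof -
  have "(\<Sum>g | g dvd q. 1 / real g) \<le> (\<Sum>g | g dvd q. 1)"
    using assms by (intro sum_mono) (auto simp: divide_le_eq Suc_le_eq intro: dvd_pos_nat)
  also have "\<dots> \<le> (\<Sum>g\<in>{1..q}. 1)"
    using assms by (intro sum_mono2) (auto simp: Suc_le_eq intro: dvd_pos_nat dvd_imp_le)
  finally show ?thesis by simp
qed

lemma sum_weighted_scale: "(\<Sum>i\<in>I. w i * (x * k i)) = (x::real) * (\<Sum>i\<in>I. w i * k i)"
  by (simp add: sum_distrib_left mult_ac)

text \<open>Only the numerators have to be cleared: with h i = P i / Q i and \<alpha> the reciprocal
  of the product of all P i, h i \<alpha> is the reciprocal of Q i times the other
  numerators.\<close>

lemma exists_common_scale:
  fixes h :: "'b \<Rightarrow> real"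
  assumes "finite I" "\<And>i. i \<in> I \<Longrightarrow> h i > 0 \<and> h i \<in> \<rat>"
  obtains \<alpha> and n :: "'b \<Rightarrow> nat"
  where "\<alpha> > 0" "\<And>i. i \<in> I \<Longrightarrow> n i > 0 \<and> h i * \<alpha> = 1 / real (n i)"
proof -
  have "\<exists>a b::nat. a > 0 \<and> b > 0 \<and> h i = real a / real b" if "i \<in> I" for i
  proof -
    from assms(2)[OF that] obtain m k :: nat where "k \<noteq> 0" "\<bar>h i\<bar> = real m / real k"
      using Rats_abs_nat_div_natE by metis
    moreover have "m > 0" using assms(2)[OF that] calculation by (cases m) auto
    ultimately show ?thesis using assms(2)[OF that] by (intro exI[of _ m] exI[of _ k]) auto
  qed
  then obtain P Q :: "'b \<Rightarrow> nat" where PQ: "\<And>i. i \<in> I \<Longrightarrow> P i > 0 \<and> Q i > 0 \<and> h i = real (P i) / real (Q i)"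
    by metis
  show ?thesis
  proof (rule that[of "1 / (\<Prod>i\<in>I. real (P i))" "\<lambda>i. Q i * (\<Prod>j\<in>I - {i}. P j)"])
    show "1 / (\<Prod>i\<in>I. real (P i)) > 0" using PQ by (simp add: prod_pos)
    fix i assume i: "i \<in> I"
    have "(\<Prod>j\<in>I. real (P j)) = real (P i) * (\<Prod>j\<in>I - {i}. real (P j))"
      using assms(1) i by (rule prod.remove)
    then show "Q i * (\<Prod>j\<in>I - {i}. P j) > 0 \<and>
        h i * (1 / (\<Prod>i\<in>I. real (P i))) = 1 / real (Q i * (\<Prod>j\<in>I - {i}. P j))"
    proof -
      have "P i > 0" "Q i > 0" "h i = real (P i) / real (Q i)" using PQ[OF i] by auto
      moreover have "(\<Prod>j\<in>I - {i}. P j) > 0" using PQ by (intro prod_pos) auto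
      moreover have "(\<Prod>j\<in>I - {i}. real (P j)) = real (\<Prod>j\<in>I - {i}. P j)" by simp
      ultimately show ?thesis
        using \<open>(\<Prod>j\<in>I. real (P j)) = _\<close> by (simp del: of_nat_prod)
    qed
  qed
qed

text \<open>Averaged over the progression \<open>\<alpha> (q k + b)\<close>, the error is the common resonance sum times the
  positive weight \<open>\<Sum> w i / n i\<close>: the scale \<open>\<alpha>\<close> makes every \<open>h i\<close> the reciprocal of an integer
  coprime to \<open>q\<close>, so that no edge can cancel another.\<close>

lemma exists_large_error_in_progression:
  fixes A :: "(real^2) set" and w h :: "'b \<Rightarrow> real" and n :: "'b \<Rightarrow> nat"
  assumes R: "\<And>x. x \<in> A \<Longrightarrow> norm x \<le> R" "R > 0" and fin: "finite I"
    and count: "\<And>t. t > 0 \<Longrightarrow>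
      \<bar>real (card (lattice_in A t)) - (measure lebesgue A * t\<^sup>2 - t * (\<Sum>i\<in>I. w i * saw (h i * t)) + c * t)\<bar> \<le> B"
    and w: "\<And>i. i \<in> I \<Longrightarrow> w i \<ge> 0"
    and \<alpha>: "\<alpha> > 0" "\<And>i. i \<in> I \<Longrightarrow> n i > 0 \<and> h i * \<alpha> = 1 / real (n i)"
  obtains K where "\<And>q \<epsilon>. squarefree q \<Longrightarrow> (\<And>p. prime p \<Longrightarrow> p dvd q \<Longrightarrow> p mod 4 = 3) \<Longrightarrow>
      (\<And>i. i \<in> I \<Longrightarrow> coprime q (n i)) \<Longrightarrow> \<epsilon> = 1 \<or> \<epsilon> = -1 \<Longrightarrow>
      \<exists>t. \<alpha> * real q ^ 3 \<le> t \<and> t \<le> 2 * \<alpha> * real q ^ 3 \<and>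
        \<epsilon> * primitive_error A t / t \<ge> (\<Sum>i\<in>I. w i / real (n i)) / 16 * (\<Sum>g | g dvd q. 1 / real g) - K"
proof -
  \<comment> \<open>One cut-off \<open>D\<close> serves the whole progression, so that the sums over
    k and d can be exchanged. It must be at least t R for t up to 2 \<alpha> q^3, and at least q^2;
    of the extra 2, one unit provides q^2 and the other absorbs the rounding.\<close>
  define \<kappa>1 where "\<kappa>1 = 2 * R * \<alpha> + 2"
  define \<kappa> where "\<kappa> = \<kappa>1 / \<alpha>"
  define K1 where "K1 = B * \<kappa> + measure lebesgue A / R + 2 * \<bar>c\<bar>"
  define K2 where "K2 = (\<Sum>i\<in>I. w i * (n i + 2 * n i * \<kappa>1 + 2))"
  show ?thesis
  proof (rule that[of "K1 + K2"])
    fix q :: nat and \<epsilon> :: real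
    assume q: "squarefree q" "\<And>p. prime p \<Longrightarrow> p dvd q \<Longrightarrow> p mod 4 = 3"
      and cop: "\<And>i. i \<in> I \<Longrightarrow> coprime q (n i)" and \<epsilon>: "\<epsilon> = 1 \<or> \<epsilon> = -1"
    have q0: "q > 0" using q(1) not_squarefree_0 by (metis gr0I)
    \<comment> \<open>The sawtooth sum enters the error with a minus sign, so the resonance is
      chosen for -\<epsilon>.\<close>
    have "- \<epsilon> = 1 \<or> - \<epsilon> = -1" using \<epsilon> by auto
    from exists_resonant_shift[OF q this] obtain b where b: "0 \<le> b" "b \<le> real q"
      and res: "\<And>g. g dvd q \<Longrightarrow> mu g * (- \<epsilon> * saw (b / g)) = 1 / 4" by auto
    define S where "S = (\<Sum>d=1..q\<^sup>2. mu d / real d * (gcd q d / real d) * saw (b / gcd q d))"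
    define \<sigma> where "\<sigma> = (\<Sum>g | g dvd q. 1 / real g)"
    have "1 / 4 / 4 * \<sigma> \<le> (\<Sum>d=1..q\<^sup>2. mu d / real d * (gcd q d / real d) * (- \<epsilon> * saw (b / gcd q d)))"
      using sum_mu_gcd_lower[where q = q and Y = "q\<^sup>2" and \<kappa> = "1 / 4" and F = "\<lambda>g. - \<epsilon> * saw (b / real g)"]
        q(1) res q0 unfolding \<sigma>_def by (simp only: power2_eq_square) simp
    also have "\<dots> = - \<epsilon> * S" unfolding S_def sum_distrib_left by (rule sum.cong) auto
    finally have S: "1 / 16 * \<sigma> \<le> - \<epsilon> * S" by simp
    define D where "D = nat \<lceil>\<kappa>1 * real q ^ 3 - 1\<rceil>"
    have q3: "real q ^ 3 \<ge> 1" using q0 by simp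
    have "\<kappa>1 > 2" using R \<alpha> by (simp add: \<kappa>1_def)
    have Dge: "(2 * R * \<alpha> + 1) * real q ^ 3 \<le> real D"
    proof -
      have "\<kappa>1 * real q ^ 3 - 1 \<le> real D" unfolding D_def by (rule real_nat_ceiling_ge)
      moreover have "(2 * R * \<alpha> + 1) * real q ^ 3 = \<kappa>1 * real q ^ 3 - real q ^ 3"
        by (simp add: \<kappa>1_def algebra_simps)
      ultimately show ?thesis using q3 by linarith
    qed
    have "0 \<le> \<kappa>1 * real q ^ 3 - 1"
      using mult_mono[of 1 \<kappa>1 1 "real q ^ 3"] \<open>\<kappa>1 > 2\<close> q3 by simp
    then have Dle: "real D \<le> \<kappa>1 * real q ^ 3"
      unfolding D_def using of_int_ceiling_le_add_one[of "\<kappa>1 * real q ^ 3 - 1"] by simp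
    have Dq: "q\<^sup>2 \<le> D"
    proof -
      have "(real q)\<^sup>2 * 1 \<le> (real q)\<^sup>2 * real q" using q0 by (intro mult_left_mono) auto
      then have "(real q)\<^sup>2 \<le> 1 * real q ^ 3" by (simp add: power3_eq_cube power2_eq_square)
      also have "\<dots> \<le> (2 * R * \<alpha> + 1) * real q ^ 3" using R \<alpha> by (intro mult_right_mono) auto
      finally have "(real q)\<^sup>2 \<le> real D" using Dge by linarith
      then have "real (q\<^sup>2) \<le> real D" by (simp only: of_nat_power)
      then show ?thesis by (simp only: of_nat_le_iff)
    qed
    define t where "t k = \<alpha> * (real q * real k + b)" for k :: nat
    have t_range: "\<alpha> * real q ^ 3 \<le> t k" "t k \<le> 2 * \<alpha> * real q ^ 3" if k: "k \<in> {q\<^sup>2..<q\<^sup>2+q\<^sup>2}" for k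
    proof -
      have "real (q\<^sup>2) \<le> real k" using k by (simp only: of_nat_le_iff) auto
      then have "real q * (real q)\<^sup>2 \<le> real q * real k + b" using b by (intro add_increasing2 mult_left_mono) auto
      then have "\<alpha> * (real q * (real q)\<^sup>2) \<le> t k" unfolding t_def using \<alpha> by (intro mult_left_mono) auto
      then show "\<alpha> * real q ^ 3 \<le> t k" by (simp add: power3_eq_cube power2_eq_square mult.assoc)
      \<comment> \<open>The inequality k + 1 \<le> 2 q^2 leaves room for the shift b \<le>
        q.\<close>
      have "real (k + 1) \<le> real (2 * q\<^sup>2)" using k by (simp only: of_nat_le_iff) auto
      then have "real q * real (k + 1) \<le> real q * real (2 * q\<^sup>2)" by (intro mult_left_mono) auto
      then have "real q * real k + b \<le> real q * real (2 * q\<^sup>2)" using b by (simp add: algebra_simps)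
      then have "t k \<le> \<alpha> * (real q * real (2 * q\<^sup>2))" unfolding t_def using \<alpha> by (intro mult_left_mono) auto
      then show "t k \<le> 2 * \<alpha> * real q ^ 3" by (simp add: power3_eq_cube power2_eq_square mult_ac)
    qed
    have t_pos: "t k > 0" if "k \<in> {q\<^sup>2..<q\<^sup>2+q\<^sup>2}" for k
    proof -
      have "0 < \<alpha> * real q ^ 3" using \<alpha>(1) q0 by simp
      then show ?thesis using t_range(1)[OF that] by linarith
    qed
    define V where "V k = (\<Sum>i\<in>I. w i * (\<Sum>d=1..D. mu d / real d * saw ((q * k + b) / (n i * d))))" for k :: nat
    have V: "\<epsilon> * primitive_error A (t k) / t k \<ge> - \<epsilon> * V k - K1" if k: "k \<in> {q\<^sup>2..<q\<^sup>2+q\<^sup>2}" for k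
    proof -
      have "t k * R \<le> 2 * \<alpha> * real q ^ 3 * R" using t_range[OF k] R(2) by (intro mult_right_mono) auto
      also have "\<dots> \<le> (2 * R * \<alpha> + 1) * real q ^ 3" by (simp add: algebra_simps)
      finally have D1: "t k * R \<le> real D" using Dge by linarith
      have "\<kappa>1 * real q ^ 3 = \<kappa> * (\<alpha> * real q ^ 3)" using \<alpha> by (simp add: \<kappa>_def)
      also have "\<dots> \<le> \<kappa> * t k" using t_range[OF k] \<alpha> \<open>\<kappa>1 > 2\<close> by (intro mult_left_mono) (auto simp: \<kappa>_def)
      finally have D2: "real D \<le> \<kappa> * t k" using Dle by linarith
      have arg: "h i * t k / real d = (q * k + b) / (n i * d)" if "i \<in> I" for i d
      proof -
        have "h i * t k = (h i * \<alpha>) * (q * k + b)" by (simp add: t_def)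
        then show ?thesis using \<alpha>(2)[OF that] by simp
      qed
      have "(\<Sum>i\<in>I. w i * (\<Sum>d=1..D. mu d / real d * saw (h i * t k / real d))) = V k"
        unfolding V_def by (rule sum.cong) (auto simp: arg)
      then have "\<bar>primitive_error A (t k) + t k * V k\<bar> \<le> K1 * t k"
        using error_expansion[OF R fin count t_pos[OF k] D1 D2] by (simp add: K1_def)
      then have "\<epsilon> * primitive_error A (t k) \<ge> (- \<epsilon> * V k - K1) * t k"
        using \<epsilon> by (auto simp: abs_le_iff algebra_simps)
      then show ?thesis using t_pos[OF k] by (simp add: pos_le_divide_eq)
    qed
    define W where "W = (\<Sum>i\<in>I. w i / real (n i))"
    have avg: "\<bar>(\<Sum>k=q\<^sup>2..<q\<^sup>2+q\<^sup>2. V k) - (real q)\<^sup>2 * (W * S)\<bar> \<le> (real q)\<^sup>2 * K2"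
    proof -
      have "(\<Sum>k=q\<^sup>2..<q\<^sup>2+q\<^sup>2. V k)
          = (\<Sum>i\<in>I. w i * (\<Sum>k=q\<^sup>2..<q\<^sup>2+q\<^sup>2. \<Sum>d=1..D. mu d / real d * saw ((q * k + b) / (n i * d))))"
        unfolding V_def by (subst sum.swap) (simp only: sum_distrib_left)
      moreover have "(real q)\<^sup>2 * (W * S) = (\<Sum>i\<in>I. w i * ((real q)\<^sup>2 * (1 / real (n i) * S)))"
        unfolding W_def by (simp add: sum_distrib_left sum_distrib_right mult_ac)
      ultimately have eq: "(\<Sum>k=q\<^sup>2..<q\<^sup>2+q\<^sup>2. V k) - (real q)\<^sup>2 * (W * S) = (\<Sum>i\<in>I. w i *
          ((\<Sum>k=q\<^sup>2..<q\<^sup>2+q\<^sup>2. \<Sum>d=1..D. mu d / real d * saw ((q * k + b) / (n i * d))) - (real q)\<^sup>2 * (1 / real (n i) * S)))"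
        by (simp only: right_diff_distrib sum_subtractf)
      have "\<bar>(\<Sum>k=q\<^sup>2..<q\<^sup>2+q\<^sup>2. V k) - (real q)\<^sup>2 * (W * S)\<bar> \<le> (\<Sum>i\<in>I. w i * ((real q)\<^sup>2 * (n i + 2 * n i * \<kappa>1 + 2)))"
        unfolding eq
      proof (rule order_trans[OF sum_abs sum_mono])
        fix i assume i: "i \<in> I"
        show "\<bar>w i * ((\<Sum>k=q\<^sup>2..<q\<^sup>2+q\<^sup>2. \<Sum>d=1..D. mu d / real d * saw ((q * k + b) / (n i * d))) - (real q)\<^sup>2 * (1 / real (n i) * S))\<bar>
            \<le> w i * ((real q)\<^sup>2 * (n i + 2 * n i * \<kappa>1 + 2))"
          unfolding abs_mult abs_of_nonneg[OF w[OF i]] S_def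
        proof (rule mult_left_mono)
          show "\<bar>(\<Sum>k=q\<^sup>2..<q\<^sup>2+q\<^sup>2. \<Sum>d=1..D. mu d / real d * saw ((q * k + b) / (n i * d)))
            - (real q)\<^sup>2 * (1 / real (n i) * (\<Sum>d=1..q\<^sup>2. mu d / real d * (gcd q d / real d) * saw (b / gcd q d)))\<bar>
            \<le> (real q)\<^sup>2 * (n i + 2 * n i * \<kappa>1 + 2)"
            using \<alpha>(2)[OF i] cop[OF i] q0 by (intro average_saw_series Dq Dle) auto
        qed (rule w[OF i])
      qed
      also have "\<dots> = (real q)\<^sup>2 * K2"
        unfolding K2_def by (rule sum_weighted_scale)
      finally show ?thesis .
    qed
    have W: "W \<ge> 0" unfolding W_def using w by (intro sum_nonneg) auto
    \<comment> \<open>If all q^2 terms were below the claimed value, so would be their mean, which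
      \<open>avg\<close> and \<open>S\<close> bound from below.\<close>
    show "\<exists>t. \<alpha> * real q ^ 3 \<le> t \<and> t \<le> 2 * \<alpha> * real q ^ 3 \<and>
        \<epsilon> * primitive_error A t / t \<ge> (\<Sum>i\<in>I. w i / real (n i)) / 16 * (\<Sum>g | g dvd q. 1 / real g) - (K1 + K2)"
    proof (rule ccontr)
      assume "\<not> ?thesis"
      then have less: "\<epsilon> * primitive_error A (t k) / t k < W / 16 * \<sigma> - (K1 + K2)" if "k \<in> {q\<^sup>2..<q\<^sup>2+q\<^sup>2}" for k
        using t_range[OF that] unfolding W_def \<sigma>_def by (meson not_le)
      have lt: "- \<epsilon> * V k - K1 < W / 16 * \<sigma> - (K1 + K2)" if "k \<in> {q\<^sup>2..<q\<^sup>2+q\<^sup>2}" for k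
        by (rule le_less_trans[OF V[OF that] less[OF that]])
      define y where "y = (real q)\<^sup>2"
      define SV where "SV = (\<Sum>k=q\<^sup>2..<q\<^sup>2+q\<^sup>2. V k)"
      define p where "p = y * (W * S)"
      define r where "r = y * (W / 16 * \<sigma>)"
      have "(\<Sum>k=q\<^sup>2..<q\<^sup>2+q\<^sup>2. - \<epsilon> * V k - K1) < (\<Sum>k=q\<^sup>2..<q\<^sup>2+q\<^sup>2. W / 16 * \<sigma> - (K1 + K2))"
        using q0 lt by (intro sum_strict_mono) auto
      moreover have "(\<Sum>k=q\<^sup>2..<q\<^sup>2+q\<^sup>2. - \<epsilon> * V k - K1) = - \<epsilon> * SV - y * K1"
        unfolding SV_def sum_distrib_left sum_subtractf by (simp add: y_def)
      moreover have "(\<Sum>k=q\<^sup>2..<q\<^sup>2+q\<^sup>2. W / 16 * \<sigma> - (K1 + K2)) = r - y * K1 - y * K2"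
        by (simp add: r_def y_def right_diff_distrib distrib_left)
      ultimately have 1: "- \<epsilon> * SV < r - y * K2" by linarith
      have 2: "\<bar>SV - p\<bar> \<le> y * K2" using avg unfolding SV_def p_def y_def .
      have le: "y * (W * (1 / 16 * \<sigma>)) \<le> y * (W * (- \<epsilon> * S))"
        using S W by (intro mult_left_mono) (auto simp: y_def)
      have eqs: "y * (W * (1 / 16 * \<sigma>)) = r" "y * (W * (- \<epsilon> * S)) = - \<epsilon> * p"
        by (simp_all add: r_def p_def)
      have 3: "r \<le> - \<epsilon> * p" using le unfolding eqs .
      show False using \<epsilon> 1 2 3 by (elim disjE) auto
    qed
  qed
qed

text \<open>Since \<open>t \<le> 2 \<alpha> q\<^sup>3\<close> and \<open>q \<le> z\<^sup>z\<close>, one has \<open>ln (ln t) \<le> 2 ln z\<close>, so \<open>sqrt (ln z)\<close> is of the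
  claimed order.\<close>

lemma omega_of_lattice_count:
  fixes A :: "(real^2) set" and w h :: "'b \<Rightarrow> real"
  assumes R: "\<And>x. x \<in> A \<Longrightarrow> norm x \<le> R" "R > 0" and fin: "finite I"
    and count: "\<And>t. t > 0 \<Longrightarrow>
      \<bar>real (card (lattice_in A t)) - (measure lebesgue A * t\<^sup>2 - t * (\<Sum>i\<in>I. w i * saw (h i * t)) + c * t)\<bar> \<le> B"
    and w: "\<And>i. i \<in> I \<Longrightarrow> w i \<ge> 0" "\<exists>i\<in>I. w i > 0"
    and h: "\<And>i. i \<in> I \<Longrightarrow> h i > 0 \<and> h i \<in> \<rat>"
  obtains C where "C > 0" "\<And>T \<epsilon>. \<epsilon> = 1 \<or> \<epsilon> = -1 \<Longrightarrow>
    \<exists>t\<ge>T. \<epsilon> * (primitive_error A t / (t * sqrt (ln (ln t)))) \<ge> C"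
proof -
  obtain \<alpha> and n :: "'b \<Rightarrow> nat" where \<alpha>: "\<alpha> > 0" "\<And>i. i \<in> I \<Longrightarrow> n i > 0 \<and> h i * \<alpha> = 1 / real (n i)"
    by (rule exists_common_scale[of I h]) (use fin h in blast)+
  obtain K where K: "\<And>q \<epsilon>. squarefree q \<Longrightarrow> (\<And>p. prime p \<Longrightarrow> p dvd q \<Longrightarrow> p mod 4 = 3) \<Longrightarrow>
      (\<And>i. i \<in> I \<Longrightarrow> coprime q (n i)) \<Longrightarrow> \<epsilon> = 1 \<or> \<epsilon> = -1 \<Longrightarrow>
      \<exists>t. \<alpha> * real q ^ 3 \<le> t \<and> t \<le> 2 * \<alpha> * real q ^ 3 \<and>
        \<epsilon> * primitive_error A t / t \<ge> (\<Sum>i\<in>I. w i / real (n i)) / 16 * (\<Sum>g | g dvd q. 1 / real g) - K"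
    using exists_large_error_in_progression[OF R fin count w(1) \<alpha>] by blast
  define n0 where "n0 = (\<Prod>i\<in>I. n i)"
  have "n0 > 0" unfolding n0_def using \<alpha> by (intro prod_pos) auto
  then obtain q :: "nat \<Rightarrow> nat" and c0 :: real where c0: "c0 > 0"
    and q: "\<And>z. squarefree (q z)" "\<And>z p. prime p \<Longrightarrow> p dvd q z \<Longrightarrow> p mod 4 = 3" "\<And>z. coprime (q z) n0"
    and q_le: "\<And>z. z \<ge> 1 \<Longrightarrow> q z \<le> z ^ z"
    and \<sigma>: "\<And>z. z \<ge> 3 \<Longrightarrow> c0 * sqrt (ln (real z)) \<le> (\<Sum>g | g dvd q z. 1 / real g)"
    by (rule exists_resonant_moduli) blast
  have cop: "coprime (q z) (n i)" if "i \<in> I" for z i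
  proof -
    have "n i dvd n0" unfolding n0_def using fin that by (rule dvd_prodI)
    then show ?thesis by (rule coprime_divisors[OF dvd_refl _ q(3)])
  qed
  define W where "W = (\<Sum>i\<in>I. w i / real (n i))"
  have W: "W > 0"
  proof -
    obtain i where i: "i \<in> I" "w i > 0" using w(2) by blast
    show ?thesis unfolding W_def
      by (rule sum_pos2[OF fin i(1)]) (use i \<alpha>(2) w(1) in auto)
  qed
  \<comment> \<open>Starting from W c0 / 16, one factor 2 pays for \<open>K\<close> and another for
    sqrt (ln (ln t)) \<le> 2 s.\<close>
  define C where "C = W * c0 / 64"
  have C: "C > 0" using W c0 by (simp add: C_def)
  show ?thesis
  proof (rule that[OF C])
    fix T \<epsilon> :: real
    assume \<epsilon>: "\<epsilon> = 1 \<or> \<epsilon> = -1"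
    have q0: "q z > 0" for z using q(1)[of z] not_squarefree_0 by (metis gr0I)
    have lim: "filterlim (\<lambda>z. sqrt (ln (real z))) at_top sequentially" by real_asymp
    \<comment> \<open>The second condition lets \<open>K\<close> take at most half of the main term,
      the third forces t beyond T and exp 3, and the fourth gives ln t \<le> z^2.\<close>
    have "\<forall>\<^sub>F z in sequentially. z \<ge> 3" by (rule eventually_ge_at_top)
    moreover have "\<forall>\<^sub>F z in sequentially. sqrt (ln (real z)) \<ge> 32 * K / (W * c0)"
      using lim by (simp add: filterlim_at_top)
    moreover have "\<forall>\<^sub>F z in sequentially. sqrt (ln (real z)) \<ge> max T (exp 3) / (\<alpha> * c0)"
      using lim by (simp add: filterlim_at_top)
    moreover have "\<forall>\<^sub>F z in sequentially. ln (2 * \<alpha>) + 3 * (real z * ln (real z)) \<le> (real z)\<^sup>2"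
      by real_asymp
    ultimately have "\<forall>\<^sub>F z in sequentially. z \<ge> 3 \<and> sqrt (ln (real z)) \<ge> 32 * K / (W * c0)
      \<and> sqrt (ln (real z)) \<ge> max T (exp 3) / (\<alpha> * c0) \<and> ln (2 * \<alpha>) + 3 * (real z * ln (real z)) \<le> (real z)\<^sup>2"
      by eventually_elim auto
    then obtain z where z: "z \<ge> 3" "sqrt (ln (real z)) \<ge> 32 * K / (W * c0)"
      "sqrt (ln (real z)) \<ge> max T (exp 3) / (\<alpha> * c0)" "ln (2 * \<alpha>) + 3 * (real z * ln (real z)) \<le> (real z)\<^sup>2"
      by (auto simp: eventually_sequentially)
    define s where "s = sqrt (ln (real z))"
    have lnz: "ln (real z) > 0" using z(1) by simp
    then have s: "s > 0" by (simp add: s_def)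
    have "\<exists>t. \<alpha> * real (q z) ^ 3 \<le> t \<and> t \<le> 2 * \<alpha> * real (q z) ^ 3 \<and>
        \<epsilon> * primitive_error A t / t \<ge> W / 16 * (\<Sum>g | g dvd q z. 1 / real g) - K"
      unfolding W_def by (rule K) (use q(1) q(2)[of _ z] cop \<epsilon> in simp_all)
    then obtain t where t: "\<alpha> * real (q z) ^ 3 \<le> t" "t \<le> 2 * \<alpha> * real (q z) ^ 3"
      "\<epsilon> * primitive_error A t / t \<ge> W / 16 * (\<Sum>g | g dvd q z. 1 / real g) - K"
      by (elim exE conjE)
    have "W / 16 * (c0 * s) \<le> W / 16 * (\<Sum>g | g dvd q z. 1 / real g)"
      using W \<sigma>[OF z(1)] unfolding s_def by (intro mult_left_mono) auto
    moreover have "K \<le> W * c0 / 32 * s"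
      using z(2) W c0 unfolding s_def by (simp add: divide_le_eq mult_ac)
    moreover have "W / 16 * (c0 * s) = 2 * (W * c0 / 32 * s)" by simp
    ultimately have E: "\<epsilon> * primitive_error A t / t \<ge> W * c0 / 32 * s" using t(3) by linarith
    \<comment> \<open>The sum of reciprocal divisors is at most q, so its lower bound also shows
      that q, and hence t, becomes arbitrarily large.\<close>
    have "c0 * s \<le> real (q z)"
      using \<sigma>[OF z(1)] sum_inverse_divisors_le[OF q0, of z] unfolding s_def by linarith
    moreover have "max T (exp 3) \<le> \<alpha> * (c0 * s)"
      using z(3) \<alpha>(1) c0 unfolding s_def by (simp add: divide_le_eq mult_ac)
    ultimately have "max T (exp 3) \<le> \<alpha> * real (q z)"
      using mult_left_mono[of "c0 * s" "real (q z)" \<alpha>] \<alpha>(1) by linarith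
    also have "\<dots> \<le> \<alpha> * real (q z) ^ 3"
      using \<alpha>(1) q0[of z] by (intro mult_left_mono) (auto intro: self_le_power)
    finally have t_ge: "T \<le> t" "exp 3 \<le> t" using t(1) by auto
    have t0: "t > 0" using t_ge(2) by (meson exp_gt_zero less_le_trans)
    have lnt3: "ln t \<ge> 3" using t_ge(2) t0 by (simp add: ln_ge_iff)
    have "ln t \<le> ln (2 * \<alpha> * real (q z) ^ 3)" using t(2) t0 by simp
    also have "\<dots> = ln (2 * \<alpha>) + 3 * ln (real (q z))"
      using \<alpha>(1) q0[of z] by (simp add: ln_mult ln_realpow)
    also have "\<dots> \<le> ln (2 * \<alpha>) + 3 * (real z * ln (real z))"
    proof -
      have "q z \<le> z ^ z" using q_le[of z] z(1) by simp
      then have "real (q z) \<le> real (z ^ z)" by (rule of_nat_mono)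
      then have "real (q z) \<le> real z ^ z" by simp
      then have "ln (real (q z)) \<le> ln (real z ^ z)" using q0[of z] z(1) by simp
      also have "\<dots> = real z * ln (real z)" using z(1) by (simp add: ln_realpow)
      finally show ?thesis by simp
    qed
    also have "\<dots> \<le> (real z)\<^sup>2" by (rule z(4))
    finally have "ln (ln t) \<le> ln ((real z)\<^sup>2)"
      using lnt3 z(1) by (subst ln_le_cancel_iff) auto
    also have "\<dots> = 2 * ln (real z)" using z(1) by (simp add: ln_realpow)
    \<comment> \<open>The constant 2 is weakened to the perfect square 4, which makes the root 2
      s.\<close>
    finally have "ln (ln t) \<le> 4 * ln (real z)" using lnz by linarith
    then have "sqrt (ln (ln t)) \<le> sqrt (4 * ln (real z))" by (rule real_sqrt_le_mono)
    then have lnln: "sqrt (ln (ln t)) \<le> 2 * s" by (simp add: s_def real_sqrt_mult)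
    have pos: "sqrt (ln (ln t)) > 0" using lnt3 by simp
    have "C * sqrt (ln (ln t)) \<le> C * (2 * s)" using C lnln by (intro mult_left_mono) auto
    also have "\<dots> = W * c0 / 32 * s" by (simp add: C_def)
    finally have "C * sqrt (ln (ln t)) \<le> \<epsilon> * primitive_error A t / t" using E by linarith
    then have "C \<le> \<epsilon> * primitive_error A t / t / sqrt (ln (ln t))" by (rule iffD2[OF pos_le_divide_eq[OF pos]])
    then show "\<exists>t\<ge>T. \<epsilon> * (primitive_error A t / (t * sqrt (ln (ln t)))) \<ge> C"
      using t_ge(1) by (intro exI[of _ t]) (simp add: divide_divide_eq_left)
  qed
qed

lemma Limsup_Liminf_of_lattice_count:
  fixes A :: "(real^2) set" and w h :: "'b \<Rightarrow> real"
  assumes R: "\<And>x. x \<in> A \<Longrightarrow> norm x \<le> R" "R > 0" and fin: "finite I"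
    and count: "\<And>t. t > 0 \<Longrightarrow>
      \<bar>real (card (lattice_in A t)) - (measure lebesgue A * t\<^sup>2 - t * (\<Sum>i\<in>I. w i * saw (h i * t)) + c * t)\<bar> \<le> B"
    and w: "\<And>i. i \<in> I \<Longrightarrow> w i \<ge> 0" "\<exists>i\<in>I. w i > 0"
    and h: "\<And>i. i \<in> I \<Longrightarrow> h i > 0 \<and> h i \<in> \<rat>"
  shows "Limsup at_top (\<lambda>t::real. ereal (primitive_error A t / (t * sqrt (ln (ln t))))) > 0
       \<and> Liminf at_top (\<lambda>t::real. ereal (primitive_error A t / (t * sqrt (ln (ln t))))) < 0"
proof -
  obtain C where C: "C > 0" "\<And>T \<epsilon>. \<epsilon> = 1 \<or> \<epsilon> = -1 \<Longrightarrow>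
    \<exists>t\<ge>T. \<epsilon> * (primitive_error A t / (t * sqrt (ln (ln t)))) \<ge> C"
    using omega_of_lattice_count[OF R fin count w h] by blast
  have "\<exists>t\<ge>T. C \<le> primitive_error A t / (t * sqrt (ln (ln t)))" for T
    using C(2)[of 1 T] by simp
  note pos = Limsup_pos_of_frequently[OF C(1) this]
  have "\<exists>t\<ge>T. primitive_error A t / (t * sqrt (ln (ln t))) \<le> - C" for T
    using C(2)[of "-1" T] by auto
  note neg = Liminf_neg_of_frequently[OF C(1) this]
  show ?thesis using pos neg by blast
qed

subsection \<open>Counting lattice points in a rational cone\<close>

definition rational_vec :: "real^2 \<Rightarrow> bool" where
  "rational_vec x \<longleftrightarrow> (\<forall>i. x $ i \<in> \<rat>)"

lemma inner_real2: "(x::real^2) \<bullet> y = x $ 1 * y $ 1 + x $ 2 * y $ 2"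
  by (simp add: inner_vec_def sum_2)

lemma vec2_eq_iff: "(x::real^2) = y \<longleftrightarrow> x $ 1 = y $ 1 \<and> x $ 2 = y $ 2"
  by (simp add: vec_eq_iff forall_2)

lemma rational_vec_inner: "rational_vec x \<Longrightarrow> rational_vec y \<Longrightarrow> x \<bullet> y \<in> \<rat>"
  by (simp add: rational_vec_def inner_real2)

lemma rational_vec_ivec: "rational_vec (ivec v)"
  by (simp add: rational_vec_def forall_2)

text \<open>The signs of the functionals in \<open>U\<close> at \<open>x\<close>; its fibres cut the plane into convex cones.\<close>

definition signature :: "(real^2) set \<Rightarrow> real^2 \<Rightarrow> (real^2) set \<times> (real^2) set" where
  "signature U x = ({u \<in> U. u \<bullet> x > 0}, {u \<in> U. u \<bullet> x < 0})"

lemma signature_eq_iff: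
  "signature U x = signature U y \<longleftrightarrow> (\<forall>u\<in>U. sgn (u \<bullet> x) = sgn (u \<bullet> y))"
proof
  assume *: "signature U x = signature U y"
  show "\<forall>u\<in>U. sgn (u \<bullet> x) = sgn (u \<bullet> y)"
  proof
    fix u assume "u \<in> U"
    with * have "u \<bullet> x > 0 \<longleftrightarrow> u \<bullet> y > 0" "u \<bullet> x < 0 \<longleftrightarrow> u \<bullet> y < 0"
      by (auto simp: signature_def set_eq_iff)
    then show "sgn (u \<bullet> x) = sgn (u \<bullet> y)" by (auto simp: sgn_if)
  qed
next
  assume *: "\<forall>u\<in>U. sgn (u \<bullet> x) = sgn (u \<bullet> y)"
  have "u \<bullet> x > 0 \<longleftrightarrow> u \<bullet> y > 0" "u \<bullet> x < 0 \<longleftrightarrow> u \<bullet> y < 0" if "u \<in> U" for u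
    using *[rule_format, OF that] by (auto simp: sgn_if split: if_splits)
  then show "signature U x = signature U y" by (auto simp: signature_def)
qed

lemma signature_scaleR: "c > 0 \<Longrightarrow> signature U (c *\<^sub>R x) = signature U x"
  by (simp add: signature_eq_iff sgn_mult)

lemma rat_fraction:
  assumes "(x::real) \<in> \<rat>"
  shows "\<exists>(p::int) (q::nat). q \<noteq> 0 \<and> x = of_int p / real q"
  using assms unfolding Rats_eq_int_div_nat by blast

text \<open>The form N1 x + N2 y takes integer values on the lattice, so the condition that w is at
  most t says that an integer is at most H t; this is where the argument of the sawtooth comes
  from.\<close>

lemma rational_functional_primitive:
  assumes "rational_vec w" "w \<noteq> 0"
  obtains N1 N2 :: int and H :: real
  where "coprime N1 N2" "H > 0" "H \<in> \<rat>" "w = (1 / H) *\<^sub>R ivec (N1, N2)"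
proof -
  obtain p1 q1 where pq1: "q1 \<noteq> 0" "w $ 1 = of_int p1 / real q1"
    using assms(1) rat_fraction unfolding rational_vec_def by blast
  obtain p2 q2 where pq2: "q2 \<noteq> 0" "w $ 2 = of_int p2 / real q2"
    using assms(1) rat_fraction unfolding rational_vec_def by blast
  define g where "g = gcd (p1 * int q2) (p2 * int q1)"
  have nz: "p1 * int q2 \<noteq> 0 \<or> p2 * int q1 \<noteq> 0" using assms(2) pq1 pq2 by (auto simp: vec2_eq_iff)
  then have g: "g > 0" by (simp add: g_def)
  then obtain a1 a2 where a: "p1 * int q2 = a1 * g" "p2 * int q1 = a2 * g" "coprime a1 a2"
    using gcd_coprime_exists[of "p1 * int q2" "p2 * int q1"] unfolding g_def by auto
  show ?thesis
  proof (rule that[of a1 a2 "real q1 * real q2 / of_int g"])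
    show "real q1 * real q2 / of_int g > 0" using pq1 pq2 g by simp
    have "of_int p1 * real q2 = of_int a1 * of_int g" "of_int p2 * real q1 = of_int a2 * of_int g"
      using arg_cong[OF a(1), of real_of_int] arg_cong[OF a(2), of real_of_int] by simp_all
    then show "w = (1 / (real q1 * real q2 / of_int g)) *\<^sub>R ivec (a1, a2)"
      using g pq1(1) pq2(1) unfolding vec2_eq_iff by (simp add: pq1(2) pq2(2) divide_simps)
  qed (use a in auto)
qed

text \<open>The class of \<open>y0\<close> is a point of \<open>R\<close> or a component of its
  complement. Boundedness excludes the unbounded components, so the endpoints belong to
  \<open>R\<close>; this is how they turn out rational in \<open>cell_structure\<close>.\<close>

lemma bounded_sign_cell_real:
  fixes R :: "real set"
  assumes "finite R" and I: "I = {y. \<forall>c\<in>R. sgn (y - c) = sgn (y0 - c)}" and bdd: "bounded I"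
  obtains \<alpha> where "\<alpha> \<in> R" "I = {\<alpha>}" | \<alpha> \<beta> where "\<alpha> \<in> R" "\<beta> \<in> R" "\<alpha> < \<beta>" "I = {\<alpha><..<\<beta>}"
proof (cases "y0 \<in> R")
  case True
  have "I = {y0}"
  proof (intro equalityI subsetI)
    fix y assume "y \<in> I"
    then have "sgn (y - y0) = sgn (y0 - y0)" using True unfolding I by blast
    then show "y \<in> {y0}" by (simp add: sgn_zero_iff)
  qed (simp add: I)
  then show ?thesis using True that(1) by blast
next
  case False
  obtain M where M: "\<And>y. y \<in> I \<Longrightarrow> \<bar>y\<bar> \<le> M" using bdd unfolding bounded_real by blast
  define L where "L = {c \<in> R. c < y0}"
  define G where "G = {c \<in> R. c > y0}"
  have fin: "finite L" "finite G" using assms(1) by (auto simp: L_def G_def)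
  have mem: "y \<in> I \<longleftrightarrow> (\<forall>c\<in>L. c < y) \<and> (\<forall>c\<in>G. y < c)" for y
  proof -
    have "sgn (y - c) = sgn (y0 - c) \<longleftrightarrow> (if c < y0 then c < y else y < c)" if "c \<in> R" for c
      using that False by (auto simp: sgn_if split: if_splits)
    then show ?thesis using False unfolding I L_def G_def by (auto split: if_splits) (metis linorder_cases)+
  qed
  have "L \<noteq> {}"
  proof
    assume "L = {}"
    then have "min y0 (- M - 1) \<in> I" unfolding mem by (auto simp: G_def)
    from M[OF this] show False by linarith
  qed
  moreover have "G \<noteq> {}"
  proof
    assume "G = {}"
    then have "max y0 (M + 1) \<in> I" unfolding mem by (auto simp: L_def)
    from M[OF this] show False by linarith
  qed
  ultimately have LG: "Max L \<in> L" "Min G \<in> G" using fin by auto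
  have "I = {Max L<..<Min G}"
    using Max_less_iff[OF fin(1) \<open>L \<noteq> {}\<close>] Min_gr_iff[OF fin(2) \<open>G \<noteq> {}\<close>]
    by (intro set_eqI) (simp only: mem greaterThanLessThan_iff)
  moreover have LR: "c \<in> R" "c < y0" if "c \<in> L" for c using that by (auto simp: L_def)
  moreover have GR: "c \<in> R" "y0 < c" if "c \<in> G" for c using that by (auto simp: G_def)
  ultimately show ?thesis
    using that(2)[of "Max L" "Min G"] LR[OF LG(1)] GR[OF LG(2)] by simp
qed

section \<open>Integers in dilated rational intervals\<close>

lemma card_int_between:
  fixes x y :: real
  assumes "x < y"
  shows "finite {m::int. x < of_int m \<and> of_int m < y}"
    "real (card {m::int. x < of_int m \<and> of_int m < y}) = of_int (\<lceil>y\<rceil> - \<lfloor>x\<rfloor> - 1)"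
proof -
  have "{m::int. x < of_int m \<and> of_int m < y} = {\<lfloor>x\<rfloor>+1..\<lceil>y\<rceil>-1}"
    by (auto simp: floor_less_iff less_ceiling_iff le_floor_iff ceiling_le_iff) linarith+
  moreover have "\<lfloor>x\<rfloor> < \<lceil>y\<rceil>" using assms by linarith
  ultimately show "finite {m::int. x < of_int m \<and> of_int m < y}"
    "real (card {m::int. x < of_int m \<and> of_int m < y}) = of_int (\<lceil>y\<rceil> - \<lfloor>x\<rfloor> - 1)"
    by auto
qed

text \<open>The floor and ceiling expression is 1 at integers and 0 elsewhere, and it is visibly
  invariant under integer translations, which \<open>count_scaled_interval\<close> uses for
  periodicity.\<close>

lemma card_int_point:
  fixes x :: real
  shows "finite {m::int. of_int m = x}" "real (card {m::int. of_int m = x}) = of_int (\<lfloor>x\<rfloor> - \<lceil>x\<rceil> + 1)"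
proof -
  have sub: "{m::int. of_int m = x} \<subseteq> {\<lfloor>x\<rfloor>}" by auto
  then show "finite {m::int. of_int m = x}" by (rule finite_subset) simp
  show "real (card {m::int. of_int m = x}) = of_int (\<lfloor>x\<rfloor> - \<lceil>x\<rceil> + 1)"
  proof (cases "x \<in> \<int>")
    case True
    then obtain k :: int where "x = of_int k" by (elim Ints_cases)
    then show ?thesis by simp
  next
    case False
    then have "{m::int. of_int m = x} = {}" by auto
    moreover have "x \<noteq> of_int \<lfloor>x\<rfloor>" using False Ints_of_int by metis
    then have "\<lceil>x\<rceil> = \<lfloor>x\<rfloor> + 1" by (simp add: ceiling_altdef)
    ultimately show ?thesis by simp
  qed
qed

lemma rational_period:
  assumes "\<alpha> \<in> \<rat>" "\<beta> \<in> \<rat>"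
  obtains D :: nat and a b :: int where "D > 0" "real D * \<alpha> = of_int a" "real D * \<beta> = of_int b"
proof -
  obtain p1 q1 where pq1: "q1 \<noteq> 0" "\<alpha> = of_int p1 / real q1"
    using rat_fraction[OF assms(1)] by blast
  obtain p2 q2 where pq2: "q2 \<noteq> 0" "\<beta> = of_int p2 / real q2"
    using rat_fraction[OF assms(2)] by blast
  show ?thesis
    by (rule that[of "q1 * q2" "p1 * int q2" "p2 * int q1"]) (use pq1 pq2 in auto)
qed

text \<open>With c the mean over a period, the difference is itself periodic in K, hence
  bounded.\<close>

lemma sum_periodic:
  fixes \<rho> :: "nat \<Rightarrow> real"
  assumes "D > 0" "\<And>k. \<rho> (k + D) = \<rho> k"
  obtains c B where "\<And>K. \<bar>(\<Sum>k=1..K. \<rho> k) - c * real K\<bar> \<le> B"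
proof -
  define c where "c = (\<Sum>k=1..D. \<rho> k) / D"
  define F where "F K = (\<Sum>k=1..K. \<rho> k) - c * real K" for K
  have shift: "(\<Sum>k=1..K+D. \<rho> k) = (\<Sum>k=1..D. \<rho> k) + (\<Sum>k=1..K. \<rho> k)" for K
  proof (induction K)
    case (Suc K)
    have "(\<Sum>k=1..Suc K+D. \<rho> k) = (\<Sum>k=1..K+D. \<rho> k) + \<rho> (Suc K + D)" by simp
    then show ?case using Suc assms(2)[of "Suc K"] by simp
  qed simp
  have per: "F (K + D) = F K" for K
    using assms(1) unfolding F_def shift by (simp add: c_def distrib_left)
  have mod: "F K = F (K mod D)" for K
  proof (induction K rule: less_induct)
    case (less K)
    show ?case
    proof (cases "K < D")
      case False
      then have "F K = F (K - D)" using per[of "K - D"] by simp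
      also have "\<dots> = F ((K - D) mod D)" using False assms(1) by (intro less) auto
      also have "(K - D) mod D = K mod D" using False by (simp add: le_mod_geq)
      finally show ?thesis .
    qed simp
  qed
  have "\<bar>F K\<bar> \<le> (\<Sum>r<D. \<bar>F r\<bar>)" for K
    unfolding mod[of K] using assms(1) by (intro member_le_sum) auto
  then show ?thesis using that[of c] unfolding F_def by blast
qed

text \<open>This is the source of the sawtooth: with x = H t, f = frac x and K = x - f, K (K + 1) /
  2 = x^2 / 2 - x (f - 1/2) + (f^2 - f) / 2. The periodic part adds only its mean, which gives the
  linear term, and a bounded error.\<close>

lemma sum_linear_periodic:
  fixes \<rho> :: "nat \<Rightarrow> real"
  assumes "D > 0" "\<And>k. \<rho> (k + D) = \<rho> k" and H: "H > 0"
  obtains c B where "\<And>t. t > 0 \<Longrightarrow> \<bar>(\<Sum>k=1..nat \<lfloor>H * t\<rfloor>. l * real k + \<rho> k)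
      - (l * H\<^sup>2 / 2 * t\<^sup>2 - t * (l * H * saw (H * t)) + c * t)\<bar> \<le> B"
proof -
  obtain c B where cB: "\<And>K. \<bar>(\<Sum>k=1..K. \<rho> k) - c * real K\<bar> \<le> B"
    by (rule sum_periodic[of D \<rho>]) (use assms(1,2) in blast)+
  have "\<bar>(\<Sum>k=1..nat \<lfloor>H * t\<rfloor>. l * real k + \<rho> k)
      - (l * H\<^sup>2 / 2 * t\<^sup>2 - t * (l * H * saw (H * t)) + (c * H) * t)\<bar> \<le> B + \<bar>l\<bar> + \<bar>c\<bar>"
    if "t > 0" for t
  proof -
    define x where "x = H * t"
    have "x > 0" using that H by (simp add: x_def)
    define f where "f = frac x"
    have f: "0 \<le> f" "f < 1" by (auto simp: f_def frac_lt_1)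
    define K where "K = nat \<lfloor>x\<rfloor>"
    have K: "real K = x - f" using \<open>x > 0\<close> by (simp add: K_def f_def frac_def)
    have gauss: "(\<Sum>k=1..K. real k) = real K * (real K + 1) / 2"
      by (induction K) (auto simp: field_simps)
    have "(\<Sum>k=1..K. l * real k + \<rho> k) = l * (real K * (real K + 1) / 2) + (\<Sum>k=1..K. \<rho> k)"
      by (simp only: sum.distrib sum_distrib_left[symmetric] gauss)
    moreover have "l * (real K * (real K + 1) / 2) = l * H\<^sup>2 / 2 * t\<^sup>2 - t * (l * H * saw (H * t)) + l * ((f\<^sup>2 - f) / 2)"
      unfolding K saw_def x_def[symmetric] f_def[symmetric]
      by (simp add: x_def power2_eq_square field_simps)
    moreover have "\<bar>l * ((f\<^sup>2 - f) / 2)\<bar> \<le> \<bar>l\<bar>"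
    proof -
      have "f\<^sup>2 \<le> 1" using f by (simp add: power_le_one)
      then have "f\<^sup>2 - f \<le> 2" "- 2 \<le> f\<^sup>2 - f" using f zero_le_power2[of f] by linarith+
      then have "\<bar>(f\<^sup>2 - f) / 2\<bar> \<le> 1" by (simp add: abs_le_iff)
      then show ?thesis unfolding abs_mult by (rule mult_left_le) simp
    qed
    moreover have "\<bar>(\<Sum>k=1..K. \<rho> k) - c * H * t\<bar> \<le> B + \<bar>c\<bar>"
    proof -
      have "c * real K = c * H * t - c * f" unfolding K x_def by (simp add: algebra_simps)
      moreover have "\<bar>c * f\<bar> \<le> \<bar>c\<bar>" using f by (simp add: abs_mult mult_left_le)
      ultimately show ?thesis using cB[of K] by linarith
    qed
    ultimately show ?thesis unfolding K_def x_def by linarith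
  qed
  then show ?thesis using that by blast
qed

text \<open>Increasing k by a common denominator \<open>D\<close> of the endpoints moves k \<alpha>
  and k \<beta> by integers, so the deviation from (\<beta> - \<alpha>) k is periodic. A single
  point is treated as an interval of length 0.\<close>

lemma count_scaled_interval:
  assumes "\<alpha> \<in> \<rat>" "\<beta> \<in> \<rat>" and I: "(\<alpha> = \<beta> \<and> I = {\<alpha>}) \<or> (\<alpha> < \<beta> \<and> I = {\<alpha><..<\<beta>})"
  obtains D :: nat and \<rho> :: "nat \<Rightarrow> real"
  where "D > 0" "\<And>k. \<rho> (k + D) = \<rho> k"
    "\<And>k. k \<ge> 1 \<Longrightarrow> finite {m::int. of_int m / real k \<in> I}"
    "\<And>k. k \<ge> 1 \<Longrightarrow> real (card {m::int. of_int m / real k \<in> I}) = (\<beta> - \<alpha>) * real k + \<rho> k"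
proof -
  obtain D :: nat and a b :: int where D: "D > 0" "real D * \<alpha> = of_int a" "real D * \<beta> = of_int b"
    using rational_period[OF assms(1,2)] .
  have sa: "real (k + D) * \<alpha> = real k * \<alpha> + of_int a" "real (k + D) * \<beta> = real k * \<beta> + of_int b" for k
    using D by (simp_all add: distrib_right)
  have lin: "(\<beta> - \<alpha>) * real (k + D) = (\<beta> - \<alpha>) * real k + of_int b - of_int a" for k
    using D by (simp add: algebra_simps)
  show ?thesis
  proof (cases "\<alpha> < \<beta>")
    case True
    have eq: "{m::int. of_int m / real k \<in> I} = {m::int. real k * \<alpha> < of_int m \<and> of_int m < real k * \<beta>}"
      if "k \<ge> 1" for k :: nat
      using that I True by (auto simp: field_simps)
    have lt: "real k * \<alpha> < real k * \<beta>" if "k \<ge> 1" for k :: nat using that True by simp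
    show ?thesis
    proof (rule that[of D "\<lambda>k. of_int (\<lceil>real k * \<beta>\<rceil> - \<lfloor>real k * \<alpha>\<rfloor> - 1) - (\<beta> - \<alpha>) * real k"])
      show "D > 0" by (rule D)
      show "of_int (\<lceil>real (k + D) * \<beta>\<rceil> - \<lfloor>real (k + D) * \<alpha>\<rfloor> - 1) - (\<beta> - \<alpha>) * real (k + D)
        = of_int (\<lceil>real k * \<beta>\<rceil> - \<lfloor>real k * \<alpha>\<rfloor> - 1) - (\<beta> - \<alpha>) * real k" for k
        unfolding lin sa by simp
    qed (auto simp: eq card_int_between[OF lt])
  next
    case False
    then have I: "\<alpha> = \<beta>" "I = {\<alpha>}" using assms(3) by auto
    have eq: "{m::int. of_int m / real k \<in> I} = {m::int. of_int m = real k * \<alpha>}"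
      if "k \<ge> 1" for k :: nat
      using that I by (auto simp: field_simps)
    show ?thesis
    proof (rule that[of D "\<lambda>k. of_int (\<lfloor>real k * \<alpha>\<rfloor> - \<lceil>real k * \<alpha>\<rceil> + 1)"])
      show "D > 0" by (rule D)
      show "real_of_int (\<lfloor>real (k + D) * \<alpha>\<rfloor> - \<lceil>real (k + D) * \<alpha>\<rceil> + 1) = of_int (\<lfloor>real k * \<alpha>\<rfloor> - \<lceil>real k * \<alpha>\<rceil> + 1)" for k
        unfolding sa by simp
    qed (auto simp: eq card_int_point I(1)[symmetric])
  qed
qed

text \<open>The frame has determinant N1 a1 + N2 a2 = 1, so the same formula gives integer
  coordinates to lattice points; its second vector spans the kernel of (N1, N2).\<close>

lemma unimodular_decomposition:
  fixes N1 N2 a1 a2 :: int and x :: "real^2"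
  assumes "N1 * a1 + N2 * a2 = 1"
  shows "x = (ivec (N1, N2) \<bullet> x) *\<^sub>R ivec (a1, a2)
    + (of_int a1 * x $ 2 - of_int a2 * x $ 1) *\<^sub>R ivec (- N2, N1)"
proof -
  have e: "real_of_int N1 * of_int a1 + of_int N2 * of_int a2 = 1"
    using arg_cong[OF assms, of real_of_int] by simp
  have "x $ 1 = x $ 1 * (of_int N1 * of_int a1 + of_int N2 * of_int a2)"
    "x $ 2 = x $ 2 * (of_int N1 * of_int a1 + of_int N2 * of_int a2)" by (simp_all add: e)
  then show ?thesis by (simp add: vec2_eq_iff inner_real2 algebra_simps)
qed

text \<open>Transversally to the level lines of \<open>w\<close> a cell is a rational interval \<open>I\<close>, and all level
  lines are traced by one unimodular frame.\<close>

lemma cell_structure: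
  fixes U :: "(real^2) set" and w x0 :: "real^2"
  defines "C \<equiv> {x. signature U x = signature U x0}"
  assumes U: "finite U" "\<And>u. u \<in> U \<Longrightarrow> rational_vec u" and w: "rational_vec w"
    and pos: "\<And>x. x \<in> C \<Longrightarrow> w \<bullet> x > 0" and bdd: "bounded {x \<in> C. w \<bullet> x \<le> 1}"
  obtains N1 N2 a1 a2 :: int and H \<alpha> \<beta> :: real and I :: "real set" where
    "N1 * a1 + N2 * a2 = 1" "H > 0" "H \<in> \<rat>" "w = (1 / H) *\<^sub>R ivec (N1, N2)"
    "\<alpha> \<in> \<rat>" "\<beta> \<in> \<rat>" "(\<alpha> = \<beta> \<and> I = {\<alpha>}) \<or> (\<alpha> < \<beta> \<and> I = {\<alpha><..<\<beta>})"
    "\<And>k y. k > 0 \<Longrightarrow> k *\<^sub>R (ivec (a1, a2) + y *\<^sub>R ivec (- N2, N1)) \<in> C \<longleftrightarrow> y \<in> I"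
proof -
  have x0: "x0 \<in> C" by (simp add: C_def)
  have "w \<noteq> 0" using pos[OF x0] by auto
  then obtain N1 N2 :: int and H :: real where N: "coprime N1 N2" "H > 0" "H \<in> \<rat>" "w = (1 / H) *\<^sub>R ivec (N1, N2)"
    using rational_functional_primitive[OF w] by blast
  obtain a1 a2 :: int where a: "N1 * a1 + N2 * a2 = 1"
    using bezout_int[of N1 N2] N(1) by (auto simp: mult.commute coprime_iff_gcd_eq_1)
  define X T where "X = ivec (a1, a2)" and "T = ivec (- N2, N1)"
  have NX: "ivec (N1, N2) \<bullet> X = 1" "ivec (N1, N2) \<bullet> T = 0"
    using arg_cong[OF a, of real_of_int] by (simp_all add: X_def T_def inner_real2)
  have T0: "norm T > 0"
  proof -
    have "T \<noteq> 0" using a by (auto simp: T_def vec2_eq_iff)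
    then show ?thesis by simp
  qed
  define k0 where "k0 = ivec (N1, N2) \<bullet> x0"
  have "w \<bullet> x0 = k0 / H" by (simp add: N(4) k0_def)
  then have k0: "k0 > 0" using pos[OF x0] N(2) by (simp add: zero_less_divide_iff)
  define y0 where "y0 = (of_int a1 * x0 $ 2 - of_int a2 * x0 $ 1) / k0"
  have "x0 = k0 *\<^sub>R (X + y0 *\<^sub>R T)"
    using unimodular_decomposition[OF a, of x0] k0 by (simp add: X_def T_def k0_def y0_def scaleR_add_right)
  then have sig0: "signature U x0 = signature U (X + y0 *\<^sub>R T)" using k0 signature_scaleR by metis
  define I where "I = {y. X + y *\<^sub>R T \<in> C}"
  \<comment> \<open>These are the parameters at which the line through X in direction T meets the
    kernel of a functional in \<open>U\<close>; functionals that vanish on T have constant sign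
    along this line.\<close>
  define R where "R = (\<lambda>u. - (u \<bullet> X) / (u \<bullet> T)) ` {u \<in> U. u \<bullet> T \<noteq> 0}"
  have sgn_eq: "sgn (u \<bullet> (X + y *\<^sub>R T)) = sgn (u \<bullet> T) * sgn (y - (- (u \<bullet> X) / (u \<bullet> T)))"
    if "u \<bullet> T \<noteq> 0" for u y
  proof -
    have "u \<bullet> (X + y *\<^sub>R T) = (u \<bullet> T) * (y - (- (u \<bullet> X) / (u \<bullet> T)))"
      using that by (simp add: inner_add_right field_simps)
    then show ?thesis by (simp only: sgn_mult)
  qed
  have I_eq: "I = {y. \<forall>c\<in>R. sgn (y - c) = sgn (y0 - c)}"
  proof -
    have "(sgn (u \<bullet> (X + y *\<^sub>R T)) = sgn (u \<bullet> (X + y0 *\<^sub>R T))) \<longleftrightarrow>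
        (u \<bullet> T \<noteq> 0 \<longrightarrow> sgn (y - (- (u \<bullet> X) / (u \<bullet> T))) = sgn (y0 - (- (u \<bullet> X) / (u \<bullet> T))))" for u y
    proof (cases "u \<bullet> T = 0")
      case False
      then have "sgn (u \<bullet> T) \<noteq> 0" by (simp add: sgn_zero_iff)
      then show ?thesis unfolding sgn_eq[OF False] using False by simp
    qed (simp add: inner_add_right)
    then show ?thesis unfolding I_def C_def sig0 mem_Collect_eq signature_eq_iff R_def by blast
  qed
  \<comment> \<open>The functional w is 1 at H (X + y T), so for y in I this point lies in the
    truncated cell, which is bounded.\<close>
  have "bounded I"
  proof -
    obtain M where M: "\<And>x. x \<in> C \<Longrightarrow> w \<bullet> x \<le> 1 \<Longrightarrow> norm x \<le> M" using bdd unfolding bounded_iff by blast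
    have "\<bar>y\<bar> \<le> (M / H + norm X) / norm T" if "y \<in> I" for y
    proof -
      have "H *\<^sub>R (X + y *\<^sub>R T) \<in> C" using that N(2) by (simp add: I_def C_def signature_scaleR)
      moreover have "w \<bullet> (H *\<^sub>R (X + y *\<^sub>R T)) \<le> 1" using N(2) NX by (simp add: N(4) inner_add_right)
      ultimately have "norm (H *\<^sub>R (X + y *\<^sub>R T)) \<le> M" by (rule M)
      then have "norm (X + y *\<^sub>R T) \<le> M / H" using N(2) by (simp add: pos_le_divide_eq mult.commute)
      moreover have "norm (y *\<^sub>R T) \<le> norm (X + y *\<^sub>R T) + norm X"
        using norm_triangle_ineq4[of "X + y *\<^sub>R T" X] by simp
      ultimately show ?thesis using T0 by (simp add: pos_le_divide_eq)
    qed
    then show ?thesis unfolding bounded_real by blast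
  qed
  moreover have "finite R" unfolding R_def using U(1) by simp
  moreover have R_rat: "c \<in> \<rat>" if "c \<in> R" for c
    using that U(2) unfolding R_def X_def T_def by (auto intro!: Rats_divide Rats_minus_iff[THEN iffD2] rational_vec_inner rational_vec_ivec)
  ultimately obtain \<alpha> \<beta> where "\<alpha> \<in> \<rat>" "\<beta> \<in> \<rat>" "(\<alpha> = \<beta> \<and> I = {\<alpha>}) \<or> (\<alpha> < \<beta> \<and> I = {\<alpha><..<\<beta>})"
    using bounded_sign_cell_real[OF _ I_eq] by metis
  moreover have "k *\<^sub>R (X + y *\<^sub>R T) \<in> C \<longleftrightarrow> y \<in> I" if "k > 0" for k y
    using that by (simp add: I_def C_def signature_scaleR)
  ultimately show ?thesis using that[OF a N(2-4)] unfolding X_def T_def by blast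
qed

text \<open>In the frame, the lattice points of the cell are pairs (k, m) with m / k in I, and the
  bound t on w becomes k \<le> H t. Up to a null set the truncated cell is the triangle with
  vertices 0, H (X + \<alpha> T), H (X + \<beta> T), so its area is the leading coefficient of the
  count.\<close>

lemma cell_count_area:
  fixes C :: "(real^2) set" and w :: "real^2"
    and N1 N2 a1 a2 :: int and H \<alpha> \<beta> :: real and I :: "real set"
  assumes a: "N1 * a1 + N2 * a2 = 1" and H: "H > 0" and w: "w = (1 / H) *\<^sub>R ivec (N1, N2)"
    and \<alpha>\<beta>: "\<alpha> \<in> \<rat>" "\<beta> \<in> \<rat>" and I: "(\<alpha> = \<beta> \<and> I = {\<alpha>}) \<or> (\<alpha> < \<beta> \<and> I = {\<alpha><..<\<beta>})"
    and pos: "\<And>x. x \<in> C \<Longrightarrow> w \<bullet> x > 0"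
    and C: "\<And>k y. k > 0 \<Longrightarrow> k *\<^sub>R (ivec (a1, a2) + y *\<^sub>R ivec (- N2, N1)) \<in> C \<longleftrightarrow> y \<in> I"
  shows "\<exists>c B. \<forall>t>0. finite {v. ivec v \<in> C \<and> w \<bullet> ivec v \<le> t} \<and>
      \<bar>real (card {v. ivec v \<in> C \<and> w \<bullet> ivec v \<le> t})
        - ((\<beta> - \<alpha>) * H\<^sup>2 / 2 * t\<^sup>2 - t * ((\<beta> - \<alpha>) * H * saw (H * t)) + c * t)\<bar> \<le> B" (is ?count)
    and "{x \<in> C. w \<bullet> x \<le> 1} \<in> lmeasurable"
    and "measure lebesgue {x \<in> C. w \<bullet> x \<le> 1} = (\<beta> - \<alpha>) * H\<^sup>2 / 2"
proof -
  define X T where "X = ivec (a1, a2)" and "T = ivec (- N2, N1)"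
  have ra: "of_int N1 * of_int a1 + of_int N2 * of_int a2 = (1::real)"
    using arg_cong[OF a, of real_of_int] by simp
  have NX: "ivec (N1, N2) \<bullet> X = 1" "ivec (N1, N2) \<bullet> T = 0"
    using ra by (simp_all add: X_def T_def inner_real2)
  have wXT: "w \<bullet> (X + y *\<^sub>R T) = 1 / H" for y
    by (simp add: w inner_add_right NX)
  have C': "k *\<^sub>R (X + y *\<^sub>R T) \<in> C \<longleftrightarrow> y \<in> I" if "k > 0" for k y
    using C[OF that] by (simp add: X_def T_def)
  have C_repr: "\<exists>k y. k > 0 \<and> x = k *\<^sub>R (X + y *\<^sub>R T) \<and> y \<in> I" if "x \<in> C" for x
  proof -
    define k where "k = ivec (N1, N2) \<bullet> x"
    have "w \<bullet> x = k / H" by (simp add: w k_def)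
    then have k: "k > 0" using pos[OF that] H by (simp add: zero_less_divide_iff)
    have "x = k *\<^sub>R (X + ((of_int a1 * x $ 2 - of_int a2 * x $ 1) / k) *\<^sub>R T)"
      using unimodular_decomposition[OF a, of x] k by (simp add: X_def T_def k_def scaleR_add_right)
    then show ?thesis using k C'[OF k] that by metis
  qed
  have ab: "\<alpha> \<le> \<beta>" "I \<subseteq> {\<alpha>..\<beta>}" using I by auto
  show ?count
  proof -
    obtain D :: nat and \<rho> :: "nat \<Rightarrow> real" where \<rho>: "D > 0" "\<And>k. \<rho> (k + D) = \<rho> k"
      "\<And>k. k \<ge> 1 \<Longrightarrow> finite {m::int. of_int m / real k \<in> I}"
      "\<And>k. k \<ge> 1 \<Longrightarrow> real (card {m::int. of_int m / real k \<in> I}) = (\<beta> - \<alpha>) * real k + \<rho> k"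
      by (rule count_scaled_interval[OF \<alpha>\<beta> I]) (rule that)
    obtain c B where cB: "\<And>t. t > 0 \<Longrightarrow> \<bar>(\<Sum>k=1..nat \<lfloor>H * t\<rfloor>. (\<beta> - \<alpha>) * real k + \<rho> k)
      - ((\<beta> - \<alpha>) * H\<^sup>2 / 2 * t\<^sup>2 - t * ((\<beta> - \<alpha>) * H * saw (H * t)) + c * t)\<bar> \<le> B"
      by (rule sum_linear_periodic[where D = D and \<rho> = \<rho> and H = H and l = "\<beta> - \<alpha>", OF \<rho>(1) \<rho>(2) H]) (rule that)
    have card: "finite {v. ivec v \<in> C \<and> w \<bullet> ivec v \<le> t} \<and>
        real (card {v. ivec v \<in> C \<and> w \<bullet> ivec v \<le> t}) = (\<Sum>k=1..nat \<lfloor>H * t\<rfloor>. (\<beta> - \<alpha>) * real k + \<rho> k)"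
      if t: "t > 0" for t
    proof -
      define S where "S = (SIGMA k:{1..nat \<lfloor>H * t\<rfloor>}. {m::int. of_int m / real k \<in> I})"
      define f where "f = (\<lambda>(k::nat, m::int). (int k * a1 - m * N2, int k * a2 + m * N1))"
      have ivec_f: "ivec (f (k, m)) = real k *\<^sub>R X + of_int m *\<^sub>R T" for k m
        by (simp add: f_def X_def T_def vec2_eq_iff)
      have ivec_f': "ivec (f (k, m)) = real k *\<^sub>R (X + (of_int m / real k) *\<^sub>R T)" if "k \<ge> 1" for k m
        using that by (simp add: ivec_f scaleR_add_right)
      have "f ` S = {v. ivec v \<in> C \<and> w \<bullet> ivec v \<le> t}"
      proof (intro equalityI subsetI)
        fix v assume "v \<in> f ` S"
        then obtain k m where km: "v = f (k, m)" "1 \<le> k" "k \<le> nat \<lfloor>H * t\<rfloor>" "of_int m / real k \<in> I"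
          by (auto simp: S_def)
        have "ivec v \<in> C" using km C' by (simp add: ivec_f')
        moreover have "real k \<le> H * t" using km H t by (simp add: le_nat_floor nat_le_iff) linarith
        then have "w \<bullet> ivec v \<le> t" using km H by (simp add: ivec_f' wXT divide_le_eq mult.commute)
        ultimately show "v \<in> {v. ivec v \<in> C \<and> w \<bullet> ivec v \<le> t}" by simp
      next
        fix v assume "v \<in> {v. ivec v \<in> C \<and> w \<bullet> ivec v \<le> t}"
        then have v: "ivec v \<in> C" "w \<bullet> ivec v \<le> t" by auto
        define k m where "k = N1 * fst v + N2 * snd v" and "m = a1 * snd v - a2 * fst v"
        have "w \<bullet> ivec v = of_int k / H" by (simp add: w k_def inner_real2 add_divide_distrib)
        then have k: "k > 0" "of_int k \<le> H * t"
          using pos[OF v(1)] v(2) H by (simp_all add: zero_less_divide_iff divide_le_eq mult.commute)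
        have veq: "v = f (nat k, m)"
        proof -
          have "fst v = fst v * (N1 * a1 + N2 * a2)" "snd v = snd v * (N1 * a1 + N2 * a2)" using a by simp_all
          then show ?thesis using k by (simp add: f_def prod_eq_iff k_def m_def algebra_simps)
        qed
        have nk: "nat k \<ge> 1" using k by simp
        have "of_int m / real (nat k) \<in> I"
          using v(1) C'[of "real (nat k)"] nk unfolding veq ivec_f'[OF nk] by simp
        moreover have "nat k \<le> nat \<lfloor>H * t\<rfloor>" using k by (intro nat_mono) (simp add: le_floor_iff)
        ultimately show "v \<in> f ` S" using veq nk by (auto simp: S_def)
      qed
      moreover have "inj_on f S"
      proof (rule inj_onI, clarsimp simp: f_def)
        fix k m k' m' assume eq: "int k * a1 - m * N2 = int k' * a1 - m' * N2" "int k * a2 + m * N1 = int k' * a2 + m' * N1"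
        have inv: "int k = N1 * (int k * a1 - m * N2) + N2 * (int k * a2 + m * N1)"
          "m = a1 * (int k * a2 + m * N1) - a2 * (int k * a1 - m * N2)" for k m
        proof -
          have "N1 * (int k * a1 - m * N2) + N2 * (int k * a2 + m * N1) = int k * (N1 * a1 + N2 * a2)"
            "a1 * (int k * a2 + m * N1) - a2 * (int k * a1 - m * N2) = m * (N1 * a1 + N2 * a2)"
            by (simp_all add: algebra_simps)
          then show "int k = N1 * (int k * a1 - m * N2) + N2 * (int k * a2 + m * N1)"
            "m = a1 * (int k * a2 + m * N1) - a2 * (int k * a1 - m * N2)" using a by simp_all
        qed
        have "int k = int k'" using inv(1)[of k m] inv(1)[of k' m'] eq by simp
        moreover have "m = m'" using inv(2)[of m k] inv(2)[of m' k'] eq by simp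
        ultimately show "k = k' \<and> m = m'" by simp
      qed
      moreover have "finite S" unfolding S_def using \<rho>(3) by auto
      moreover have "real (card S) = (\<Sum>k=1..nat \<lfloor>H * t\<rfloor>. (\<beta> - \<alpha>) * real k + \<rho> k)"
        unfolding S_def using \<rho>(3,4) by (subst card_SigmaI) auto
      ultimately show ?thesis by (metis card_image finite_imageI)
    qed
    show ?thesis using card cB by (intro exI[of _ c] exI[of _ B]) simp
  qed
  define E where "E = {x \<in> C. w \<bullet> x \<le> 1}"
  define P Q where "P = H *\<^sub>R (X + \<alpha> *\<^sub>R T)" and "Q = H *\<^sub>R (X + \<beta> *\<^sub>R T)"
  define T0 where "T0 = convex hull {0, P, Q}"
  have E_iff: "x \<in> E \<longleftrightarrow> (\<exists>k y. 0 < k \<and> k \<le> H \<and> y \<in> I \<and> x = k *\<^sub>R (X + y *\<^sub>R T))" for x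
  proof
    assume "x \<in> E"
    then obtain k y where "k > 0" "x = k *\<^sub>R (X + y *\<^sub>R T)" "y \<in> I" "w \<bullet> x \<le> 1"
      using C_repr unfolding E_def by blast
    then show "\<exists>k y. 0 < k \<and> k \<le> H \<and> y \<in> I \<and> x = k *\<^sub>R (X + y *\<^sub>R T)"
      using H by (intro exI[of _ k] exI[of _ y]) (simp add: wXT divide_le_eq)
  next
    assume "\<exists>k y. 0 < k \<and> k \<le> H \<and> y \<in> I \<and> x = k *\<^sub>R (X + y *\<^sub>R T)"
    then show "x \<in> E" unfolding E_def using C' H by (auto simp: wXT divide_le_eq)
  qed
  have det: "(of_int a1 - y * of_int N2) * (of_int a2 + z * of_int N1) - (of_int a2 + y * of_int N1) * (of_int a1 - z * of_int N2) = z - y" for y z :: real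
  proof -
    have "(of_int a1 - y * of_int N2) * (of_int a2 + z * of_int N1) - (of_int a2 + y * of_int N1) * (of_int a1 - z * of_int N2)
        = (z - y) * (of_int N1 * of_int a1 + of_int N2 * of_int a2)" by (simp add: algebra_simps)
    then show ?thesis using ra by simp
  qed
  have T0_meas: "measure lebesgue T0 = (\<beta> - \<alpha>) * H\<^sup>2 / 2"
  proof -
    have "P $ 1 * Q $ 2 - P $ 2 * Q $ 1 = H\<^sup>2 * (\<beta> - \<alpha>)"
      using det[of \<alpha> \<beta>] by (simp add: P_def Q_def X_def T_def power2_eq_square algebra_simps) (simp add: distrib_left[symmetric] right_diff_distrib[symmetric])
    then have "measure lborel T0 = \<bar>H\<^sup>2 * (\<beta> - \<alpha>)\<bar> / 2"
      unfolding T0_def content_triangle by (simp add: abs_minus_commute mult.commute)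
    moreover have "measure lebesgue T0 = measure lborel T0"
      unfolding T0_def by (intro measure_completion) (auto intro!: borel_closed compact_imp_closed finite_imp_compact_convex_hull)
    ultimately show ?thesis using ab by (simp add: abs_mult mult.commute)
  qed
  have T0_lm: "T0 \<in> lmeasurable"
    unfolding T0_def by (intro lmeasurable_compact finite_imp_compact_convex_hull) auto
  have conv: "convex T0" "0 \<in> T0" "P \<in> T0" "Q \<in> T0"
    unfolding T0_def by (auto intro: hull_inc)
  have E_sub: "E \<subseteq> T0"
  proof
    fix x assume "x \<in> E"
    then obtain k y where ky: "0 < k" "k \<le> H" "y \<in> I" "x = k *\<^sub>R (X + y *\<^sub>R T)" using E_iff by blast
    \<comment> \<open>For \<alpha> = \<beta> the only possible value is y = \<alpha>, and \<theta> =
      0 serves.\<close>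
    define \<theta> where "\<theta> = (if \<alpha> < \<beta> then (y - \<alpha>) / (\<beta> - \<alpha>) else 0)"
    have y: "\<alpha> \<le> y" "y \<le> \<beta>" using ab ky by auto
    have th: "0 \<le> \<theta>" "\<theta> \<le> 1" "y = (1 - \<theta>) * \<alpha> + \<theta> * \<beta>"
    proof -
      show "0 \<le> \<theta>" "\<theta> \<le> 1" using y by (auto simp: \<theta>_def divide_le_eq)
      have "\<theta> * (\<beta> - \<alpha>) = y - \<alpha>" using y ab by (auto simp: \<theta>_def)
      then show "y = (1 - \<theta>) * \<alpha> + \<theta> * \<beta>" by (simp add: algebra_simps)
    qed
    have "(1 - \<theta>) *\<^sub>R P + \<theta> *\<^sub>R Q \<in> T0" using conv th by (intro convexD_alt) auto
    then have "(1 - k / H) *\<^sub>R 0 + (k / H) *\<^sub>R ((1 - \<theta>) *\<^sub>R P + \<theta> *\<^sub>R Q) \<in> T0"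
      using ky H by (intro convexD_alt[OF conv(1,2)]) (auto simp: divide_le_eq)
    moreover have "(1 - \<theta>) *\<^sub>R P + \<theta> *\<^sub>R Q = H *\<^sub>R (X + y *\<^sub>R T)"
      unfolding P_def Q_def th(3) by (simp add: algebra_simps)
    ultimately show "x \<in> T0" using ky H by simp
  qed
  have neg_line: "negligible {x. (vector [- (P $ 2), P $ 1] :: real^2) \<bullet> x = 0}" if "P \<noteq> 0" for P :: "real^2"
    using that by (intro negligible_hyperplane) (auto simp: vec2_eq_iff)
  have nz: "X + y *\<^sub>R T \<noteq> 0" for y
  proof
    assume "X + y *\<^sub>R T = 0"
    then have "ivec (N1, N2) \<bullet> (X + y *\<^sub>R T) = 0" by simp
    then show False by (simp add: inner_add_right NX)
  qed
  \<comment> \<open>Only points on the lines spanned by P and Q can be missing; for \<alpha> =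
    \<beta> the two lines coincide and contain the whole hull.\<close>
  have sub: "T0 - E \<subseteq> {x. (vector [- (P $ 2), P $ 1] :: real^2) \<bullet> x = 0} \<union> {x. (vector [- (Q $ 2), Q $ 1] :: real^2) \<bullet> x = 0}"
  proof
    fix x assume x: "x \<in> T0 - E"
    then obtain p q where pq: "0 \<le> p" "0 \<le> q" "p + q \<le> 1" "x = p *\<^sub>R P + q *\<^sub>R Q"
      unfolding T0_def convex_hull_3_alt by auto
    have line: "(vector [- (Z $ 2), Z $ 1] :: real^2) \<bullet> (r *\<^sub>R Z) = 0" for Z :: "real^2" and r
      by (simp add: inner_real2)
    consider "p = 0" | "q = 0" | "\<alpha> = \<beta>" | "p > 0" "q > 0" "\<alpha> < \<beta>" using pq ab by linarith
    then show "x \<in> {x. (vector [- (P $ 2), P $ 1] :: real^2) \<bullet> x = 0} \<union> {x. (vector [- (Q $ 2), Q $ 1] :: real^2) \<bullet> x = 0}"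
    proof cases
      case 1 then show ?thesis using pq line by simp
    next
      case 2 then show ?thesis using pq line by simp
    next
      case 3
      then have "Q = P" by (simp add: P_def Q_def)
      then have "x = (p + q) *\<^sub>R P" unfolding pq(4) by (simp only: scaleR_add_left)
      then show ?thesis using line by simp
    next
      case 4
      define y where "y = (p * \<alpha> + q * \<beta>) / (p + q)"
      have "\<alpha> < y" "y < \<beta>" using 4 by (auto simp: y_def field_simps)
      then have "y \<in> I" using I 4 by auto
      moreover have "x = (H * (p + q)) *\<^sub>R (X + y *\<^sub>R T)"
      proof -
        have "(p + q) * y = p * \<alpha> + q * \<beta>" using 4 by (simp add: y_def)
        then have "(H * (p + q)) *\<^sub>R (X + y *\<^sub>R T) = (H * (p + q)) *\<^sub>R X + (H * (p * \<alpha> + q * \<beta>)) *\<^sub>R T"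
          by (simp add: scaleR_add_right mult.assoc)
        then show ?thesis by (simp add: pq(4) P_def Q_def algebra_simps)
      qed
      moreover have "0 < H * (p + q)" "H * (p + q) \<le> H" using 4 pq H by auto
      ultimately have "x \<in> E" using E_iff by blast
      then show ?thesis using x by simp
    qed
  qed
  have "P \<noteq> 0" "Q \<noteq> 0" using nz H by (simp_all add: P_def Q_def)
  then have "negligible (T0 - E)"
    by (intro negligible_subset[OF negligible_Un[OF neg_line neg_line] sub])
  moreover have "E - T0 = {}" using E_sub by blast
  ultimately have neg: "negligible ((T0 - E) \<union> (E - T0))" by (simp only: Un_empty_right)
  show "{x \<in> C. w \<bullet> x \<le> 1} \<in> lmeasurable"
    using lmeasurable_negligible_symdiff[OF T0_lm neg] by (simp add: E_def)
  show "measure lebesgue {x \<in> C. w \<bullet> x \<le> 1} = (\<beta> - \<alpha>) * H\<^sup>2 / 2"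
    using measure_negligible_symdiff[OF T0_lm neg] T0_meas by (simp add: E_def)
qed

subsection \<open>Star-shaped polygons as unions of triangles\<close>

definition det2 :: "real^2 \<Rightarrow> real^2 \<Rightarrow> real" where
  "det2 x y = x $ 1 * y $ 2 - x $ 2 * y $ 1"

definition perp :: "real^2 \<Rightarrow> real^2" where
  "perp v = vector [- (v $ 2), v $ 1]"

lemma perp_nth [simp]: "perp v $ 1 = - (v $ 2)" "perp v $ 2 = v $ 1"
  by (simp_all add: perp_def)

lemma perp_inner: "perp v \<bullet> x = det2 v x"
  by (simp add: inner_real2 det2_def)

text \<open>The coordinate functionals with respect to \<open>a\<close> and \<open>b\<close>; both are \<open>0\<close> if \<open>a\<close> and \<open>b\<close> are
  linearly dependent, as \<open>1 / 0 = 0\<close>.\<close>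

definition coord1 :: "real^2 \<Rightarrow> real^2 \<Rightarrow> real^2" where
  "coord1 a b = (- 1 / det2 a b) *\<^sub>R perp b"

definition coord2 :: "real^2 \<Rightarrow> real^2 \<Rightarrow> real^2" where
  "coord2 a b = (1 / det2 a b) *\<^sub>R perp a"

lemma coords:
  assumes "det2 a b \<noteq> 0"
  shows "coord1 a b \<bullet> (p *\<^sub>R a + q *\<^sub>R b) = p" "coord2 a b \<bullet> (p *\<^sub>R a + q *\<^sub>R b) = q"
    "x = (coord1 a b \<bullet> x) *\<^sub>R a + (coord2 a b \<bullet> x) *\<^sub>R b"
proof -
  have "det2 b (p *\<^sub>R a + q *\<^sub>R b) = - p * det2 a b" "det2 a (p *\<^sub>R a + q *\<^sub>R b) = q * det2 a b"
    by (simp_all add: det2_def algebra_simps)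
  then show "coord1 a b \<bullet> (p *\<^sub>R a + q *\<^sub>R b) = p" "coord2 a b \<bullet> (p *\<^sub>R a + q *\<^sub>R b) = q"
    using assms by (simp_all add: coord1_def coord2_def perp_inner)
  have "det2 a b *\<^sub>R x = (- det2 b x) *\<^sub>R a + (det2 a x) *\<^sub>R b"
    by (simp add: vec2_eq_iff det2_def algebra_simps)
  then have "(1 / det2 a b) *\<^sub>R (det2 a b *\<^sub>R x) = (1 / det2 a b) *\<^sub>R ((- det2 b x) *\<^sub>R a + (det2 a x) *\<^sub>R b)"
    by simp
  then show "x = (coord1 a b \<bullet> x) *\<^sub>R a + (coord2 a b \<bullet> x) *\<^sub>R b"
    using assms by (simp add: coord1_def coord2_def perp_inner scaleR_add_right scaleR_diff_right)
qed

lemma rational_vec_scaleR: "c \<in> \<rat> \<Longrightarrow> rational_vec x \<Longrightarrow> rational_vec (c *\<^sub>R x)"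
  by (simp add: rational_vec_def)

lemma rational_vec_perp: "rational_vec x \<Longrightarrow> rational_vec (perp x)"
  by (simp add: rational_vec_def forall_2)

lemma det2_rational: "rational_vec x \<Longrightarrow> rational_vec y \<Longrightarrow> det2 x y \<in> \<rat>"
  by (simp add: rational_vec_def det2_def)

lemma rational_vec_coords:
  assumes "rational_vec a" "rational_vec b"
  shows "rational_vec (coord1 a b)" "rational_vec (coord2 a b)"
proof -
  show "rational_vec (coord1 a b)"
    unfolding coord1_def
    by (intro rational_vec_scaleR rational_vec_perp Rats_divide det2_rational assms) simp
  show "rational_vec (coord2 a b)"
    unfolding coord2_def
    by (intro rational_vec_scaleR rational_vec_perp Rats_divide det2_rational assms) simp
qed

lemma rational_vec_add: "rational_vec x \<Longrightarrow> rational_vec y \<Longrightarrow> rational_vec (x + y)"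
  by (simp add: rational_vec_def)

lemma rational_vec_diff: "rational_vec x \<Longrightarrow> rational_vec y \<Longrightarrow> rational_vec (x - y)"
  by (simp add: rational_vec_def)

lemma collinear_scale:
  assumes "det2 v y = 0" "v \<noteq> 0"
  shows "y = ((v \<bullet> y) / (v \<bullet> v)) *\<^sub>R v"
proof -
  have "(v \<bullet> v) *\<^sub>R y = (v \<bullet> y) *\<^sub>R v"
  proof -
    have "v $ 1 * y $ 2 = v $ 2 * y $ 1" using assms(1) by (simp add: det2_def)
    then show ?thesis
      by (simp add: vec2_eq_iff inner_real2 algebra_simps)
  qed
  then have "(1 / (v \<bullet> v)) *\<^sub>R ((v \<bullet> v) *\<^sub>R y) = (1 / (v \<bullet> v)) *\<^sub>R ((v \<bullet> y) *\<^sub>R v)" by simp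
  then show ?thesis using assms(2) by simp
qed

text \<open>Since y . y is a convex combination of a . y and b . y, some endpoint v has v . y \<ge>
  y . y; lying on the line of y, it is at least as far out in the same direction. Edges on lines
  through the origin thus reduce to rays.\<close>

lemma degenerate_edge:
  assumes "det2 a b = 0" "y \<in> closed_segment a b" "y \<noteq> 0"
  shows "\<exists>v\<in>{a, b}. v \<noteq> 0 \<and> (\<exists>c. 0 < c \<and> c \<le> 1 \<and> y = c *\<^sub>R v)"
proof -
  obtain \<theta> where \<theta>: "0 \<le> \<theta>" "\<theta> \<le> 1" "y = (1 - \<theta>) *\<^sub>R a + \<theta> *\<^sub>R b"
    using assms(2) unfolding in_segment by blast
  have yy: "y \<bullet> y > 0" using assms(3) by simp
  have "y \<bullet> y = (1 - \<theta>) * (a \<bullet> y) + \<theta> * (b \<bullet> y)"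
    by (subst (1) \<theta>(3)) (simp add: inner_add_left)
  have "y \<bullet> y \<le> a \<bullet> y \<or> y \<bullet> y \<le> b \<bullet> y"
  proof (rule ccontr)
    assume "\<not> ?thesis"
    then have lt: "a \<bullet> y < y \<bullet> y" "b \<bullet> y < y \<bullet> y" by auto
    have "(1 - \<theta>) * (a \<bullet> y) + \<theta> * (b \<bullet> y) < y \<bullet> y"
      using convex_bound_lt[OF lt, of "1 - \<theta>" \<theta>] \<theta> by simp
    then show False using \<open>y \<bullet> y = _\<close> by simp
  qed
  then obtain v where v: "v \<in> {a, b}" "y \<bullet> y \<le> v \<bullet> y" by blast
  have "det2 a y = \<theta> * det2 a b" "det2 b y = - (1 - \<theta>) * det2 a b"
    by (simp_all add: \<theta>(3) det2_def algebra_simps)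
  then have "det2 v y = 0" using v(1) assms(1) by auto
  moreover have v0: "v \<noteq> 0"
  proof
    assume "v = 0"
    then have "y \<bullet> y \<le> 0" using v(2) by simp
    then show False using yy by linarith
  qed
  ultimately have y: "y = ((v \<bullet> y) / (v \<bullet> v)) *\<^sub>R v" by (rule collinear_scale)
  define c where "c = (v \<bullet> y) / (v \<bullet> v)"
  have vy: "v \<bullet> y > 0" using v(2) yy by linarith
  then have "c > 0" using v0 by (simp add: c_def)
  moreover have "y \<bullet> y = c * (v \<bullet> y)" by (subst (1) y) (simp add: c_def)
  then have "c * (v \<bullet> y) \<le> 1 * (v \<bullet> y)" using v(2) by simp
  then have "c \<le> 1" using vy by simp
  ultimately show ?thesis using v(1) v0 y unfolding c_def by blast
qed

text \<open>The last conjunct removes the apex.\<close>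

definition triangle_cone :: "(real^2) \<times> (real^2) \<Rightarrow> (real^2) set" where
  "triangle_cone = (\<lambda>(a, b). {x. coord1 a b \<bullet> x \<ge> 0 \<and> coord2 a b \<bullet> x \<ge> 0 \<and> (coord1 a b \<bullet> x > 0 \<or> coord2 a b \<bullet> x > 0)})"

definition ray :: "real^2 \<Rightarrow> (real^2) set" where
  "ray v = {x. perp v \<bullet> x = 0 \<and> v \<bullet> x > 0}"

text \<open>Each functional is 1 on the outer boundary: coord1 + coord2 on the line through a and b,
  v / (v . v) at v. Cut off at 1, the cone becomes the triangle 0, a, b or the segment from 0 to v,
  without the origin. The rays take care of degenerate edges.\<close>

definition wedges :: "((real^2) \<times> (real^2)) set \<Rightarrow> ((real^2) set \<times> (real^2)) set" where
  "wedges E = (\<lambda>(a, b). (triangle_cone (a, b), coord1 a b + coord2 a b)) ` {(a, b) \<in> E. det2 a b \<noteq> 0}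
    \<union> (\<lambda>v. (ray v, (1 / (v \<bullet> v)) *\<^sub>R v)) ` (fst ` E \<union> snd ` E - {0})"

text \<open>The signs of the first four families decide membership in every wedge. The differences
  compare the functionals of any two wedges, so that on a cell a single one is smallest
  throughout.\<close>

definition wedge_functionals :: "((real^2) \<times> (real^2)) set \<Rightarrow> (real^2) set" where
  "wedge_functionals E = (\<lambda>(a, b). coord1 a b) ` E \<union> (\<lambda>(a, b). coord2 a b) ` E
    \<union> (fst ` E \<union> snd ` E) \<union> perp ` (fst ` E \<union> snd ` E)
    \<union> (\<lambda>(w, w'). w - w') ` (snd ` wedges E \<times> snd ` wedges E)"

lemma wedges_finite:
  assumes "finite E"
  shows "finite (wedges E)"
proof -
  have "finite {(a, b) \<in> E. det2 a b \<noteq> 0}" by (rule finite_subset[OF _ assms]) auto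
  then show ?thesis
    unfolding wedges_def by (intro finite_UnI finite_imageI finite_Diff assms)
qed

lemma wedge_functionals_finite:
  assumes "finite E"
  shows "finite (wedge_functionals E)"
  unfolding wedge_functionals_def
  by (intro finite_UnI finite_imageI finite_cartesian_product wedges_finite assms)

lemma wedges_rational:
  assumes "\<And>a b. (a, b) \<in> E \<Longrightarrow> rational_vec a \<and> rational_vec b" "(K, w) \<in> wedges E"
  shows "rational_vec w"
proof -
  have "rational_vec v" if "v \<in> fst ` E \<union> snd ` E" for v using that assms(1) by auto
  then show ?thesis
    using assms unfolding wedges_def
    by (auto intro!: rational_vec_add rational_vec_coords rational_vec_scaleR Rats_divide rational_vec_inner)
qed

lemma wedge_functionals_rational:
  assumes "\<And>a b. (a, b) \<in> E \<Longrightarrow> rational_vec a \<and> rational_vec b" "u \<in> wedge_functionals E"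
  shows "rational_vec u"
proof -
  have h1: "\<forall>u\<in>(\<lambda>(a, b). coord1 a b) ` E. rational_vec u"
    using assms(1) rational_vec_coords(1) by auto
  have h2: "\<forall>u\<in>(\<lambda>(a, b). coord2 a b) ` E. rational_vec u"
    using assms(1) rational_vec_coords(2) by auto
  have h3: "\<forall>u\<in>fst ` E. rational_vec u" "\<forall>u\<in>snd ` E. rational_vec u" using assms(1) by auto
  have h4: "\<forall>u\<in>perp ` (fst ` E \<union> snd ` E). rational_vec u"
    using h3 rational_vec_perp by auto
  have h5: "\<forall>u\<in>(\<lambda>(w, w'). w - w') ` (snd ` wedges E \<times> snd ` wedges E). rational_vec u"
    using wedges_rational[OF assms(1)] rational_vec_diff by auto
  show ?thesis
    using assms(2) unfolding wedge_functionals_def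
    by (elim UnE) (erule bspec[OF h1] bspec[OF h2] bspec[OF h3(1)] bspec[OF h3(2)] bspec[OF h4] bspec[OF h5])+
qed

lemma wedges_cases:
  assumes "(K, w) \<in> wedges E"
  obtains (triangle) a b where "(a, b) \<in> E" "det2 a b \<noteq> 0" "K = triangle_cone (a, b)" "w = coord1 a b + coord2 a b"
    | (ray) v where "v \<in> fst ` E \<union> snd ` E" "v \<noteq> 0" "K = ray v" "w = (1 / (v \<bullet> v)) *\<^sub>R v"
proof -
  from assms have "(K, w) \<in> (\<lambda>(a, b). (triangle_cone (a, b), coord1 a b + coord2 a b)) ` {(a, b) \<in> E. det2 a b \<noteq> 0}
      \<or> (K, w) \<in> (\<lambda>v. (ray v, (1 / (v \<bullet> v)) *\<^sub>R v)) ` (fst ` E \<union> snd ` E - {0})"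
    unfolding wedges_def by (rule UnE) (erule disjI1 disjI2)+
  then show thesis
  proof
    assume "(K, w) \<in> (\<lambda>(a, b). (triangle_cone (a, b), coord1 a b + coord2 a b)) ` {(a, b) \<in> E. det2 a b \<noteq> 0}"
    then obtain p where p: "(K, w) = (\<lambda>(a, b). (triangle_cone (a, b), coord1 a b + coord2 a b)) p"
      "p \<in> {(a, b) \<in> E. det2 a b \<noteq> 0}" by (rule imageE)
    obtain a b where "p = (a, b)" by (cases p)
    then show thesis using p by (intro triangle[of a b]) auto
  next
    assume "(K, w) \<in> (\<lambda>v. (ray v, (1 / (v \<bullet> v)) *\<^sub>R v)) ` (fst ` E \<union> snd ` E - {0})"
    then obtain v where v: "(K, w) = (ray v, (1 / (v \<bullet> v)) *\<^sub>R v)" "v \<in> fst ` E \<union> snd ` E - {0}" by (rule imageE)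
    then show thesis by (intro ray[of v]) simp_all
  qed
qed

lemma wedge_pos:
  assumes "(K, w) \<in> wedges E" "x \<in> K"
  shows "w \<bullet> x > 0"
  using assms(1)
proof (cases rule: wedges_cases)
  case (triangle a b)
  then show ?thesis using assms(2)
    by (auto simp: triangle_cone_def inner_add_left add_pos_nonneg add_nonneg_pos)
next
  case (ray v)
  then show ?thesis using assms(2) by (simp add: ray_def)
qed

lemma wedge_saturated:
  assumes "(K, w) \<in> wedges E" "signature (wedge_functionals E) x = signature (wedge_functionals E) y" "x \<in> K"
  shows "y \<in> K"
proof -
  have sg: "u \<bullet> x > 0 \<longleftrightarrow> u \<bullet> y > 0" "u \<bullet> x \<ge> 0 \<longleftrightarrow> u \<bullet> y \<ge> 0" "u \<bullet> x = 0 \<longleftrightarrow> u \<bullet> y = 0"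
    if "u \<in> wedge_functionals E" for u
  proof -
    have "sgn (u \<bullet> x) = sgn (u \<bullet> y)" using assms(2) that unfolding signature_eq_iff by blast
    then show "u \<bullet> x > 0 \<longleftrightarrow> u \<bullet> y > 0" "u \<bullet> x \<ge> 0 \<longleftrightarrow> u \<bullet> y \<ge> 0" "u \<bullet> x = 0 \<longleftrightarrow> u \<bullet> y = 0"
      by (auto simp: sgn_if split: if_splits)
  qed
  from assms(1) show ?thesis
  proof (cases rule: wedges_cases)
    case (triangle a b)
    have "coord1 a b \<in> wedge_functionals E" "coord2 a b \<in> wedge_functionals E"
      using triangle(1) unfolding wedge_functionals_def by force+
    then show ?thesis using assms(3) sg unfolding triangle(3) triangle_cone_def by auto
  next
    case (ray v)
    have "v \<in> wedge_functionals E" "perp v \<in> wedge_functionals E"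
      using ray(1) unfolding wedge_functionals_def by blast+
    then show ?thesis using assms(3) sg unfolding ray(3) ray_def by auto
  qed
qed

text \<open>A nonzero point of A is pulled back from the edge that its outward ray meets.
  Conversely, a point x of a truncated wedge is an edge point scaled by w . x \<le> 1, which
  star-shapedness keeps in A.\<close>

lemma star_union_wedges:
  assumes star: "\<And>x c. x \<in> A \<Longrightarrow> 0 \<le> c \<Longrightarrow> c \<le> 1 \<Longrightarrow> c *\<^sub>R x \<in> A"
    and edges: "\<And>a b. (a, b) \<in> E \<Longrightarrow> closed_segment a b \<subseteq> A"
    and exit: "\<And>x. x \<in> A \<Longrightarrow> x \<noteq> 0 \<Longrightarrow> \<exists>r\<ge>1. \<exists>(a, b)\<in>E. r *\<^sub>R x \<in> closed_segment a b"
  shows "x \<in> A \<and> x \<noteq> 0 \<longleftrightarrow> (\<exists>(K, w)\<in>wedges E. x \<in> K \<and> w \<bullet> x \<le> 1)"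
proof
  assume x: "x \<in> A \<and> x \<noteq> 0"
  then obtain r a b where r: "r \<ge> 1" "(a, b) \<in> E" "r *\<^sub>R x \<in> closed_segment a b" using exit by blast
  have inv: "0 < 1 / r" "1 / r \<le> 1" using r by auto
  have xr: "x = (1 / r) *\<^sub>R (r *\<^sub>R x)" using r by simp
  show "\<exists>(K, w)\<in>wedges E. x \<in> K \<and> w \<bullet> x \<le> 1"
  proof (cases "det2 a b = 0")
    case False
    obtain \<theta> where \<theta>: "0 \<le> \<theta>" "\<theta> \<le> 1" "r *\<^sub>R x = (1 - \<theta>) *\<^sub>R a + \<theta> *\<^sub>R b"
      using r(3) unfolding in_segment by blast
    have "x = ((1 - \<theta>) / r) *\<^sub>R a + (\<theta> / r) *\<^sub>R b"
      by (subst xr, subst \<theta>(3)) (simp add: scaleR_add_right)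
    then have co: "coord1 a b \<bullet> x = (1 - \<theta>) / r" "coord2 a b \<bullet> x = \<theta> / r"
      using coords(1,2)[OF False] by auto
    have "x \<in> triangle_cone (a, b)"
      unfolding triangle_cone_def using \<theta> r by (auto simp: co zero_less_divide_iff)
    moreover have "(coord1 a b + coord2 a b) \<bullet> x \<le> 1"
      using inv by (simp add: inner_add_left co add_divide_distrib[symmetric])
    moreover have "(triangle_cone (a, b), coord1 a b + coord2 a b) \<in> wedges E"
      unfolding wedges_def using r(2) False by (intro UnI1 image_eqI[of _ _ "(a, b)"]) auto
    ultimately show ?thesis by blast
  next
    case True
    have "r *\<^sub>R x \<noteq> 0" using x r by auto
    from degenerate_edge[OF True r(3) this] obtain v c where v: "v \<in> {a, b}" "v \<noteq> 0" "0 < c" "c \<le> 1" "r *\<^sub>R x = c *\<^sub>R v"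
      by blast
    define c' where "c' = c / r"
    have c': "0 < c'" "c' \<le> 1" using v r by (auto simp: c'_def divide_le_eq)
    have xc: "x = c' *\<^sub>R v" by (subst xr, subst v(5)) (simp add: c'_def)
    have "x \<in> ray v" using c' v by (simp add: ray_def xc perp_inner det2_def)
    moreover have "((1 / (v \<bullet> v)) *\<^sub>R v) \<bullet> x \<le> 1" using c' v by (simp add: xc)
    moreover have "(ray v, (1 / (v \<bullet> v)) *\<^sub>R v) \<in> wedges E"
    proof -
      have "v \<in> fst ` E \<union> snd ` E - {0}" using v(1,2) r(2) by force
      then show ?thesis unfolding wedges_def by blast
    qed
    ultimately show ?thesis by blast
  qed
next
  assume "\<exists>(K, w)\<in>wedges E. x \<in> K \<and> w \<bullet> x \<le> 1"
  then obtain K w where Kw: "(K, w) \<in> wedges E" "x \<in> K" "w \<bullet> x \<le> 1" by blast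
  have pos: "w \<bullet> x > 0" using wedge_pos[OF Kw(1,2)] .
  then have x0: "x \<noteq> 0" by auto
  from Kw(1) have "x \<in> A"
  proof (cases rule: wedges_cases)
    case 1: (triangle a b)
    define p q where "p = coord1 a b \<bullet> x" and "q = coord2 a b \<bullet> x"
    have pq: "p \<ge> 0" "q \<ge> 0" "p + q > 0" "p + q \<le> 1"
      using Kw(2,3) pos unfolding 1 triangle_cone_def by (auto simp: p_def q_def inner_add_left)
    have "x = p *\<^sub>R a + q *\<^sub>R b" unfolding p_def q_def by (rule coords(3)[OF 1(2)])
    also have "\<dots> = (p + q) *\<^sub>R ((p / (p + q)) *\<^sub>R a + (q / (p + q)) *\<^sub>R b)"
      using pq by (simp add: scaleR_add_right)
    finally have x: "x = (p + q) *\<^sub>R ((p / (p + q)) *\<^sub>R a + (q / (p + q)) *\<^sub>R b)" .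
    have "p / (p + q) = 1 - q / (p + q)" using pq by (simp add: field_simps)
    then have "(p / (p + q)) *\<^sub>R a + (q / (p + q)) *\<^sub>R b \<in> closed_segment a b"
      unfolding in_segment using pq by (intro exI[of _ "q / (p + q)"]) (auto simp: divide_le_eq)
    then have "(p / (p + q)) *\<^sub>R a + (q / (p + q)) *\<^sub>R b \<in> A" using edges[OF 1(1)] by blast
    then show ?thesis using star[of _ "p + q"] pq x by simp
  next
    case 2: (ray v)
    have "v \<in> A" using 2(1) edges by force
    have "det2 v x = 0" using Kw(2) unfolding 2 ray_def by (simp add: perp_inner)
    from collinear_scale[OF this 2(2)] have "x = (w \<bullet> x) *\<^sub>R v" unfolding 2(4) by simp
    moreover have "(w \<bullet> x) *\<^sub>R v \<in> A" using star[OF \<open>v \<in> A\<close>, of "w \<bullet> x"] pos Kw(3) by simp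
    ultimately show ?thesis by simp
  qed
  then show "x \<in> A \<and> x \<noteq> 0" using x0 by simp
qed

section \<open>Polygonal curves and their inside\<close>

lemma polygonal_path_image:
  assumes "length vs \<ge> 2"
  shows "path_image (polygonal_path vs) = (\<Union>(a, b)\<in>set (zip vs (tl vs)). closed_segment a b)
    \<and> pathstart (polygonal_path vs) = hd vs \<and> pathfinish (polygonal_path vs) = last vs"
  using assms
proof (induction vs rule: polygonal_path.induct)
  case (4 a b c vs)
  then have IH: "path_image (polygonal_path (b # c # vs)) = (\<Union>(a, b)\<in>set (zip (b # c # vs) (c # vs)). closed_segment a b)"
    "pathstart (polygonal_path (b # c # vs)) = b" "pathfinish (polygonal_path (b # c # vs)) = last (c # vs)"
    by auto
  have "path_image (polygonal_path (a # b # c # vs)) = closed_segment a b \<union> path_image (polygonal_path (b # c # vs))"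
    using IH(2) by (simp add: path_image_join)
  then show ?case using IH by simp
qed auto

text \<open>The outward ray from x is connected and unbounded, so it cannot stay in the bounded
  component of x in the complement of P.\<close>

lemma bounded_region_exit:
  fixes P :: "(real^2) set"
  assumes "x \<in> inside P" "x \<noteq> 0"
  shows "\<exists>r\<ge>1. r *\<^sub>R x \<in> P"
proof (rule ccontr)
  assume none: "\<not> ?thesis"
  define R where "R = (\<lambda>r. r *\<^sub>R x) ` {1..}"
  have "connected R" unfolding R_def
    by (intro connected_continuous_image continuous_intros convex_connected) auto
  moreover have "x \<in> R" unfolding R_def by (rule image_eqI[of _ _ 1]) auto
  moreover have "R \<subseteq> - P" using none by (auto simp: R_def)
  ultimately have "R \<subseteq> connected_component_set (- P) x" by (intro connected_component_maximal)
  moreover have "bounded (connected_component_set (- P) x)" using assms(1) by (simp add: inside_def)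
  ultimately have "bounded R" using bounded_subset by blast
  then obtain M where M: "\<And>y. y \<in> R \<Longrightarrow> norm y \<le> M" unfolding bounded_iff by blast
  have nx: "norm x > 0" using assms(2) by simp
  define r where "r = max 1 (M / norm x + 1)"
  have "r *\<^sub>R x \<in> R" unfolding R_def r_def by (rule imageI) simp
  then have "norm (r *\<^sub>R x) \<le> M" by (rule M)
  moreover have "norm (r *\<^sub>R x) = r * norm x" by (simp add: r_def)
  moreover have "(M / norm x + 1) * norm x \<le> r * norm x" using nx by (intro mult_right_mono) (auto simp: r_def)
  moreover have "(M / norm x + 1) * norm x = M + norm x" using nx by (simp add: distrib_right)
  ultimately show False using nx by linarith
qed

text \<open>A simple closed curve is not contractible, so it cannot itself be star-shaped.\<close>

lemma star_shaped_inside_nonempty: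
  fixes C :: "real \<Rightarrow> real^2"
  assumes "simple_path C" "pathfinish C = pathstart C"
    and star: "\<And>x c. x \<in> path_image C \<union> inside (path_image C) \<Longrightarrow> 0 \<le> c \<Longrightarrow> c \<le> 1 \<Longrightarrow> c *\<^sub>R x \<in> path_image C \<union> inside (path_image C)"
  shows "inside (path_image C) \<noteq> {}"
proof
  assume "inside (path_image C) = {}"
  then have st: "\<And>x c. x \<in> path_image C \<Longrightarrow> 0 \<le> c \<Longrightarrow> c \<le> 1 \<Longrightarrow> c *\<^sub>R x \<in> path_image C" using star by simp
  have "pathstart C \<in> path_image C" by (rule pathstart_in_path_image)
  then have "0 \<in> path_image C" using st[of "pathstart C" 0] by simp
  moreover have "closed_segment 0 x \<subseteq> path_image C" if "x \<in> path_image C" for x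
    using st[OF that] by (auto simp: in_segment)
  ultimately have "starlike (path_image C)" unfolding starlike_def by blast
  then have "contractible (path_image C)" by (rule starlike_imp_contractible)
  moreover have "path_image C homeomorphic sphere (0::complex) 1"
    using homeomorphic_simple_path_image_circle[OF assms(1,2), of 1 0] by simp
  ultimately have "contractible (sphere (0::complex) 1)" using homeomorphic_contractible by blast
  then show False by (simp add: contractible_sphere)
qed

lemma rational_star_polygon:
  assumes "rational_polygon A" "origin_star_shaped A"
  obtains E where "finite E" "\<And>a b. (a, b) \<in> E \<Longrightarrow> rational_vec a \<and> rational_vec b"
    "\<And>x. x \<in> A \<and> x \<noteq> 0 \<longleftrightarrow> (\<exists>(K, w)\<in>wedges E. x \<in> K \<and> w \<bullet> x \<le> 1)"
    "bounded A" "0 \<in> A" "interior A \<noteq> {}"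
proof -
  obtain vs where poly: "polygon_with_vertices vs A" and rat: "\<forall>v\<in>set vs. \<forall>i. v $ i \<in> \<rat>"
    using assms(1) unfolding rational_polygon_def by blast
  define L where "L = vs @ [hd vs]"
  define C where "C = polygonal_path L"
  define P where "P = path_image C"
  have C: "simple_path C" "A = P \<union> inside P"
    using poly unfolding polygon_with_vertices_def Let_def C_def L_def P_def by auto
  have star: "\<And>x c. x \<in> A \<Longrightarrow> 0 \<le> c \<Longrightarrow> c \<le> 1 \<Longrightarrow> c *\<^sub>R x \<in> A"
    using assms(2) unfolding origin_star_shaped_def by force
  \<comment> \<open>For the empty list the path is constant at the unspecified point
    \<open>hd []\<close>; the parameters 1/3 and 1/2 show that it is not loop-free.\<close>
  have "vs \<noteq> []"
  proof
    assume "vs = []"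
    then have "C = linepath (hd []) (hd [])" by (simp add: C_def L_def)
    then have "simple_path (linepath (hd [] :: real^2) (hd []))" using C(1) by simp
    then have "loop_free (linepath (hd [] :: real^2) (hd []))" by (simp add: simple_path_def)
    then have "(1/3::real) = 1/2 \<or> (1/3::real) = 0 \<and> (1/2::real) = 1 \<or> (1/3::real) = 1 \<and> (1/2::real) = 0"
      unfolding loop_free_def by (elim ballE[of _ _ "1/3"] ballE[of _ _ "1/2"]) auto
    then show False by simp
  qed
  then have L: "length L \<ge> 2" "hd L = last L" "set L = set vs"
    by (auto simp: L_def Suc_le_eq)
  define E where "E = set (zip L (tl L))"
  have PE: "P = (\<Union>(a, b)\<in>E. closed_segment a b)" and loop: "pathfinish C = pathstart C"
    using polygonal_path_image[OF L(1)] L(2) by (auto simp: P_def C_def E_def)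
  have "compact P" unfolding P_def using C(1) by (simp add: compact_path_image simple_path_imp_path)
  then have bddP: "bounded P" and clP: "closed P" by (auto simp: compact_imp_bounded compact_imp_closed)
  have edges: "closed_segment a b \<subseteq> A" if "(a, b) \<in> E" for a b using that PE C(2) by blast
  have exit: "\<exists>r\<ge>1. \<exists>(a, b)\<in>E. r *\<^sub>R x \<in> closed_segment a b" if x: "x \<in> A" "x \<noteq> 0" for x
  proof -
    have "\<exists>r\<ge>1. r *\<^sub>R x \<in> P"
    proof (cases "x \<in> P")
      case True
      then show ?thesis by (intro exI[of _ 1]) simp
    next
      case False
      then show ?thesis using bounded_region_exit[of x P] x C(2) by blast
    qed
    then show ?thesis unfolding PE by blast
  qed
  show ?thesis
  proof (rule that[of E])
    show "finite E" by (simp add: E_def)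
    show "rational_vec a \<and> rational_vec b" if "(a, b) \<in> E" for a b
    proof -
      have "a \<in> set L" "b \<in> set (tl L)" using that unfolding E_def by (auto dest: set_zip_leftD set_zip_rightD)
      moreover have "set (tl L) \<subseteq> set L" by (cases L) auto
      ultimately show ?thesis using rat L(3) unfolding rational_vec_def by blast
    qed
    show "x \<in> A \<and> x \<noteq> 0 \<longleftrightarrow> (\<exists>(K, w)\<in>wedges E. x \<in> K \<and> w \<bullet> x \<le> 1)" for x
      by (rule star_union_wedges[OF star edges exit])
    show "bounded A" unfolding C(2) using bddP by (simp add: bounded_inside)
    have "pathstart C \<in> A" unfolding C(2) P_def by (intro UnI1 pathstart_in_path_image)
    then show "0 \<in> A" using star[of "pathstart C" 0] by simp
    have "inside P \<noteq> {}"
      using star_shaped_inside_nonempty[OF C(1) loop] star unfolding C(2) P_def by blast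
    moreover have "inside P \<subseteq> interior A"
      using open_inside[OF clP] by (intro interior_maximal) (auto simp: C(2))
    ultimately show "interior A \<noteq> {}" by blast
  qed
qed

section \<open>The lattice count of the polygon\<close>

lemma cell_count:
  fixes U :: "(real^2) set" and w x0 :: "real^2"
  defines "C \<equiv> {x. signature U x = signature U x0}"
  assumes U: "finite U" "\<And>u. u \<in> U \<Longrightarrow> rational_vec u" and w: "rational_vec w"
    and pos: "\<And>x. x \<in> C \<Longrightarrow> w \<bullet> x > 0" and bdd: "bounded {x \<in> C. w \<bullet> x \<le> 1}"
  shows "\<exists>l H c B. l \<ge> 0 \<and> H > 0 \<and> H \<in> \<rat> \<and> {x \<in> C. w \<bullet> x \<le> 1} \<in> lmeasurable
    \<and> measure lebesgue {x \<in> C. w \<bullet> x \<le> 1} = l * H\<^sup>2 / 2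
    \<and> (\<forall>t>0. finite {v. ivec v \<in> C \<and> w \<bullet> ivec v \<le> t} \<and>
      \<bar>real (card {v. ivec v \<in> C \<and> w \<bullet> ivec v \<le> t})
        - (l * H\<^sup>2 / 2 * t\<^sup>2 - t * (l * H * saw (H * t)) + c * t)\<bar> \<le> B)"
proof -
  show ?thesis
  proof (rule cell_structure[OF U w pos[unfolded C_def] bdd[unfolded C_def], folded C_def])
    fix N1 N2 a1 a2 :: int and H \<alpha> \<beta> :: real and I :: "real set"
    assume s: "N1 * a1 + N2 * a2 = 1" "H > 0" "H \<in> \<rat>" "w = (1 / H) *\<^sub>R ivec (N1, N2)"
      "\<alpha> \<in> \<rat>" "\<beta> \<in> \<rat>" "(\<alpha> = \<beta> \<and> I = {\<alpha>}) \<or> (\<alpha> < \<beta> \<and> I = {\<alpha><..<\<beta>})"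
      "\<And>k y. k > 0 \<Longrightarrow> k *\<^sub>R (ivec (a1, a2) + y *\<^sub>R ivec (- N2, N1)) \<in> C \<longleftrightarrow> y \<in> I"
    have ca: "{x \<in> C. w \<bullet> x \<le> 1} \<in> lmeasurable"
      "measure lebesgue {x \<in> C. w \<bullet> x \<le> 1} = (\<beta> - \<alpha>) * H\<^sup>2 / 2"
      by (rule cell_count_area(2,3)[OF s(1,2,4,5,6,7) pos s(8)]; assumption)+
    have "\<exists>c B. \<forall>t>0. finite {v. ivec v \<in> C \<and> w \<bullet> ivec v \<le> t} \<and>
        \<bar>real (card {v. ivec v \<in> C \<and> w \<bullet> ivec v \<le> t})
          - ((\<beta> - \<alpha>) * H\<^sup>2 / 2 * t\<^sup>2 - t * ((\<beta> - \<alpha>) * H * saw (H * t)) + c * t)\<bar> \<le> B"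
      by (rule cell_count_area(1)[OF s(1,2,4,5,6,7) pos s(8)])
    then obtain c B where cB: "\<forall>t>0. finite {v. ivec v \<in> C \<and> w \<bullet> ivec v \<le> t} \<and>
        \<bar>real (card {v. ivec v \<in> C \<and> w \<bullet> ivec v \<le> t})
          - ((\<beta> - \<alpha>) * H\<^sup>2 / 2 * t\<^sup>2 - t * ((\<beta> - \<alpha>) * H * saw (H * t)) + c * t)\<bar> \<le> B"
      by (elim exE) (rule that)
    have "\<beta> - \<alpha> \<ge> 0" using s(7) by auto
    then show ?thesis using s(2,3) ca cB
      by (intro exI[of _ "\<beta> - \<alpha>"] exI[of _ H] exI[of _ c] exI[of _ B] conjI)
  qed
qed

text \<open>Wedges may overlap, but the cells of constant signature are disjoint. The wedges
  containing a cell are fixed, and so is the smallest of their functionals, since differences of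
  functionals have constant sign on the cell; A meets the cell where this one is at most 1. The
  formula is the sum of \<open>cell_count\<close> over the cells.\<close>

lemma lattice_count_of_wedges:
  fixes A :: "(real^2) set"
  assumes E: "finite E" "\<And>a b. (a, b) \<in> E \<Longrightarrow> rational_vec a \<and> rational_vec b"
    and A: "\<And>x. x \<in> A \<and> x \<noteq> 0 \<longleftrightarrow> (\<exists>(K, w)\<in>wedges E. x \<in> K \<and> w \<bullet> x \<le> 1)"
    and bdd: "bounded A"
  obtains S :: "((real^2) set \<times> (real^2) set) set" and W h c B where
    "finite S" "\<And>s. s \<in> S \<Longrightarrow> W s \<ge> 0 \<and> h s > 0 \<and> h s \<in> \<rat>"
    "A \<in> lmeasurable" "measure lebesgue A = (\<Sum>s\<in>S. W s * h s / 2)"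
    "\<And>t. t > 0 \<Longrightarrow> \<bar>real (card (lattice_in A t))
      - (measure lebesgue A * t\<^sup>2 - t * (\<Sum>s\<in>S. W s * saw (h s * t)) + c * t)\<bar> \<le> B"
proof -
  define U where "U = wedge_functionals E"
  have U: "finite U" "\<And>u. u \<in> U \<Longrightarrow> rational_vec u"
    unfolding U_def using wedge_functionals_finite[OF E(1)] wedge_functionals_rational[OF E(2)] by blast+
  define S where "S = signature U ` \<Union> (fst ` wedges E)"
  have "S \<subseteq> Pow U \<times> Pow U" by (auto simp: S_def signature_def)
  then have finS: "finite S" by (rule finite_subset) (simp add: U(1))
  \<comment> \<open>A sample point of the cell is taken together with a functional that is smallest
    there among those of the wedges through it.\<close>
  have "\<exists>x0 w. signature U x0 = s \<and> (\<exists>K. (K, w) \<in> wedges E \<and> x0 \<in> K) \<and>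
      (\<forall>K' w'. (K', w') \<in> wedges E \<longrightarrow> x0 \<in> K' \<longrightarrow> w \<bullet> x0 \<le> w' \<bullet> x0)" if s: "s \<in> S" for s
  proof -
    obtain x0 K0 w0 where x0: "signature U x0 = s" "(K0, w0) \<in> wedges E" "x0 \<in> K0"
      using s unfolding S_def by auto
    define Q where "Q = {w. \<exists>K. (K, w) \<in> wedges E \<and> x0 \<in> K}"
    have "Q \<subseteq> snd ` wedges E" unfolding Q_def by force
    then have "finite Q" by (rule finite_subset) (simp add: wedges_finite E(1))
    moreover have "Q \<noteq> {}" using x0 by (auto simp: Q_def)
    ultimately obtain w where w: "w \<in> Q" "\<And>w'. w' \<in> Q \<Longrightarrow> w \<bullet> x0 \<le> w' \<bullet> x0"
      using ex_min_if_finite[of "(\<lambda>w. w \<bullet> x0) ` Q"] by (metis (no_types, lifting) finite_imageI image_iff image_is_empty not_le)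
    then show ?thesis using x0(1) unfolding Q_def by blast
  qed
  then obtain x0 w where xw: "\<And>s. s \<in> S \<Longrightarrow> signature U (x0 s) = s"
    "\<And>s. s \<in> S \<Longrightarrow> \<exists>K. (K, w s) \<in> wedges E \<and> x0 s \<in> K"
    "\<And>s K' w'. s \<in> S \<Longrightarrow> (K', w') \<in> wedges E \<Longrightarrow> x0 s \<in> K' \<Longrightarrow> w s \<bullet> x0 s \<le> w' \<bullet> x0 s"
    by metis
  define C where "C s = {x. signature U x = s}" for s
  have wedge_cell: "\<exists>K. (K, w s) \<in> wedges E \<and> C s \<subseteq> K" if s: "s \<in> S" for s
  proof -
    obtain K where K: "(K, w s) \<in> wedges E" "x0 s \<in> K" using xw(2)[OF s] by blast
    have "x \<in> K" if "x \<in> C s" for x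
    proof (rule wedge_saturated[OF K(1) _ K(2)])
      show "signature (wedge_functionals E) (x0 s) = signature (wedge_functionals E) x"
        using xw(1)[OF s] that by (simp add: C_def U_def)
    qed
    then show ?thesis using K(1) by blast
  qed
  have pos: "w s \<bullet> x > 0" if "s \<in> S" "x \<in> C s" for s x
    using wedge_cell[OF that(1)] that(2) wedge_pos by blast
  have w_rat: "rational_vec (w s)" if "s \<in> S" for s
    using wedge_cell[OF that] wedges_rational[OF E(2)] by blast
  have A_iff: "x \<in> A \<and> x \<noteq> 0 \<longleftrightarrow> signature U x \<in> S \<and> w (signature U x) \<bullet> x \<le> 1" for x
  proof
    assume "x \<in> A \<and> x \<noteq> 0"
    then obtain K' w' where K': "(K', w') \<in> wedges E" "x \<in> K'" "w' \<bullet> x \<le> 1" using A by blast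
    define s where "s = signature U x"
    have s: "s \<in> S" unfolding s_def S_def using K'(1,2) by (intro imageI UnionI[of K']) force+
    obtain K where K: "(K, w s) \<in> wedges E" using wedge_cell[OF s] by blast
    have sig: "signature U x = signature U (x0 s)" using xw(1)[OF s] by (simp add: s_def)
    have "x0 s \<in> K'" using wedge_saturated[OF K'(1) _ K'(2)] sig by (simp add: U_def)
    then have "w s \<bullet> x0 s \<le> w' \<bullet> x0 s" using xw(3)[OF s K'(1)] by blast
    then have le0: "(w s - w') \<bullet> x0 s \<le> 0" by (simp add: inner_diff_left)
    have "w s - w' \<in> U"
    proof -
      have "w s \<in> snd ` wedges E" "w' \<in> snd ` wedges E" using K K'(1) by force+
      then have "(w s, w') \<in> snd ` wedges E \<times> snd ` wedges E" by simp
      from imageI[OF this, of "\<lambda>(w, w'). w - w'"] show ?thesis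
        unfolding U_def wedge_functionals_def by simp
    qed
    then have "sgn ((w s - w') \<bullet> x) = sgn ((w s - w') \<bullet> x0 s)" using sig unfolding signature_eq_iff by blast
    then have "(w s - w') \<bullet> x \<le> 0" using le0 by (auto simp: sgn_if split: if_splits)
    then have "w s \<bullet> x \<le> 1" using K'(3) by (simp add: inner_diff_left)
    then show "signature U x \<in> S \<and> w (signature U x) \<bullet> x \<le> 1" using s by (simp add: s_def)
  next
    assume *: "signature U x \<in> S \<and> w (signature U x) \<bullet> x \<le> 1"
    obtain K where K: "(K, w (signature U x)) \<in> wedges E" "C (signature U x) \<subseteq> K" using wedge_cell * by blast
    moreover have "x \<in> K" using K(2) by (auto simp: C_def)
    ultimately show "x \<in> A \<and> x \<noteq> 0" using A * by blast
  qed
  define piece where "piece s = {x \<in> C s. w s \<bullet> x \<le> 1}" for s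
  have piece_A: "piece s \<subseteq> A" if "s \<in> S" for s
  proof
    fix x assume "x \<in> piece s"
    then have "signature U x \<in> S \<and> w (signature U x) \<bullet> x \<le> 1" using that by (auto simp: piece_def C_def)
    then show "x \<in> A" using A_iff by blast
  qed
  define Q where "Q s l H c B \<longleftrightarrow> l \<ge> 0 \<and> H > 0 \<and> H \<in> \<rat> \<and> piece s \<in> lmeasurable
    \<and> measure lebesgue (piece s) = l * H\<^sup>2 / 2
    \<and> (\<forall>t>0. finite {v. ivec v \<in> C s \<and> w s \<bullet> ivec v \<le> t} \<and>
      \<bar>real (card {v. ivec v \<in> C s \<and> w s \<bullet> ivec v \<le> t})
        - (l * H\<^sup>2 / 2 * t\<^sup>2 - t * (l * H * saw (H * t)) + c * t)\<bar> \<le> B)" for s l H c B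
  have "\<exists>l H c B. Q s l H c B" if s: "s \<in> S" for s
  proof -
    have Cs: "C s = {x. signature U x = signature U (x0 s)}" using xw(1)[OF s] by (simp add: C_def)
    have "bounded (piece s)" using piece_A[OF s] bdd bounded_subset by blast
    then show ?thesis
      unfolding Q_def piece_def using cell_count[OF U w_rat[OF s], of "x0 s", folded Cs] pos[OF s] by simp
  qed
  then obtain l H c B where "\<And>s. s \<in> S \<Longrightarrow> Q s (l s) (H s) (c s) (B s)"
    by metis
  note cell = this[unfolded Q_def]
  have disj: "pairwise (\<lambda>s s'. disjnt (piece s) (piece s')) S"
    by (auto simp: pairwise_def disjnt_def piece_def C_def)
  have A_union: "A - {0} = (\<Union>s\<in>S. piece s)"
  proof (intro equalityI subsetI)
    fix x assume "x \<in> A - {0}"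
    then have "signature U x \<in> S \<and> w (signature U x) \<bullet> x \<le> 1" using A_iff by blast
    then show "x \<in> (\<Union>s\<in>S. piece s)" by (auto simp: piece_def C_def)
  next
    fix x assume "x \<in> (\<Union>s\<in>S. piece s)"
    then have "signature U x \<in> S \<and> w (signature U x) \<bullet> x \<le> 1" by (auto simp: piece_def C_def)
    then show "x \<in> A - {0}" using A_iff by blast
  qed
  have union_lm: "(\<Union>s\<in>S. piece s) \<in> lmeasurable"
    using cell finS by (intro fmeasurable.finite_UN) auto
  have neg: "negligible ((A - {0}) - A \<union> (A - (A - {0})))" by (rule negligible_subset[of "{0}"]) auto
  have A_lm: "A \<in> lmeasurable"
    using lmeasurable_negligible_symdiff[OF _ neg] union_lm unfolding A_union by blast
  have area: "measure lebesgue A = (\<Sum>s\<in>S. l s * (H s)\<^sup>2 / 2)"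
  proof -
    from neg have "measure lebesgue A = measure lebesgue (\<Union>s\<in>S. piece s)"
      using measure_negligible_symdiff[of "A - {0}" A] union_lm unfolding A_union by blast
    also have "\<dots> = (\<Sum>s\<in>S. measure lebesgue (piece s))"
      by (rule measure_UNION'[OF finS _ disj]) (use cell in blast)
    also have "\<dots> = (\<Sum>s\<in>S. l s * (H s)\<^sup>2 / 2)" by (rule sum.cong) (use cell in auto)
    finally show ?thesis .
  qed
  have lattice: "lattice_in A t = (\<Union>s\<in>S. {v. ivec v \<in> C s \<and> w s \<bullet> ivec v \<le> t})" if t: "t > 0" for t
  proof -
    have "v \<in> lattice_in A t \<longleftrightarrow> (\<exists>s\<in>S. ivec v \<in> C s \<and> w s \<bullet> ivec v \<le> t)" for v
    proof -
      have "v \<noteq> (0, 0) \<longleftrightarrow> (1 / t) *\<^sub>R ivec v \<noteq> 0" using t by (auto simp: vec2_eq_iff prod_eq_iff)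
      then have "v \<in> lattice_in A t \<longleftrightarrow> (1 / t) *\<^sub>R ivec v \<in> A \<and> (1 / t) *\<^sub>R ivec v \<noteq> 0"
        using mem_lattice_in[OF t] by blast
      also have "\<dots> \<longleftrightarrow> signature U (ivec v) \<in> S \<and> w (signature U (ivec v)) \<bullet> ((1 / t) *\<^sub>R ivec v) \<le> 1"
        unfolding A_iff using t by (simp add: signature_scaleR)
      also have "w (signature U (ivec v)) \<bullet> ((1 / t) *\<^sub>R ivec v) \<le> 1 \<longleftrightarrow> w (signature U (ivec v)) \<bullet> ivec v \<le> t"
        using t by (simp add: divide_le_eq)
      finally show ?thesis by (auto simp: C_def)
    qed
    then show ?thesis by blast
  qed
  show ?thesis
  proof (rule that[of S "\<lambda>s. l s * H s" H "\<Sum>s\<in>S. c s" "\<Sum>s\<in>S. B s"])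
    show "finite S" by (rule finS)
    show "A \<in> lmeasurable" by (rule A_lm)
    show "l s * H s \<ge> 0 \<and> H s > 0 \<and> H s \<in> \<rat>" if "s \<in> S" for s using cell[OF that] by simp
    show "measure lebesgue A = (\<Sum>s\<in>S. l s * H s * H s / 2)"
      unfolding area by (simp add: power2_eq_square mult.assoc)
    fix t :: real assume t: "t > 0"
    define a where "a s = real (card {v. ivec v \<in> C s \<and> w s \<bullet> ivec v \<le> t})" for s
    define m where "m s = l s * (H s)\<^sup>2 / 2 * t\<^sup>2 - t * (l s * H s * saw (H s * t)) + c s * t" for s
    have "real (card (lattice_in A t)) = (\<Sum>s\<in>S. a s)"
    proof -
      have "card (\<Union>s\<in>S. {v. ivec v \<in> C s \<and> w s \<bullet> ivec v \<le> t}) = (\<Sum>s\<in>S. card {v. ivec v \<in> C s \<and> w s \<bullet> ivec v \<le> t})"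
        by (rule card_UN_disjoint[OF finS]) (use cell t in \<open>auto simp: C_def\<close>)
      then show ?thesis unfolding lattice[OF t] a_def by simp
    qed
    moreover have "measure lebesgue A * t\<^sup>2 - t * (\<Sum>s\<in>S. l s * H s * saw (H s * t)) + (\<Sum>s\<in>S. c s) * t = (\<Sum>s\<in>S. m s)"
      unfolding area m_def by (simp add: sum.distrib sum_subtractf sum_distrib_left sum_distrib_right)
    moreover have "\<bar>(\<Sum>s\<in>S. a s) - (\<Sum>s\<in>S. m s)\<bar> \<le> (\<Sum>s\<in>S. B s)"
    proof -
      have "\<bar>\<Sum>s\<in>S. a s - m s\<bar> \<le> (\<Sum>s\<in>S. B s)"
      proof (rule order_trans[OF sum_abs sum_mono])
        fix s assume "s \<in> S"
        from cell[OF this] t show "\<bar>a s - m s\<bar> \<le> B s" unfolding a_def m_def by blast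
      qed
      then show ?thesis by (simp only: sum_subtractf)
    qed
    ultimately show "\<bar>real (card (lattice_in A t))
      - (measure lebesgue A * t\<^sup>2 - t * (\<Sum>s\<in>S. l s * H s * saw (H s * t)) + (\<Sum>s\<in>S. c s) * t)\<bar> \<le> (\<Sum>s\<in>S. B s)"
      by presburger
  qed
qed

theorem theorem1p4:
  fixes A :: "(real^2) set"
  assumes "rational_polygon A"
    and "origin_star_shaped A"
  shows "Limsup at_top (\<lambda>t::real. ereal (primitive_error A t / (t * sqrt (ln (ln t))))) > 0
       \<and> Liminf at_top (\<lambda>t::real. ereal (primitive_error A t / (t * sqrt (ln (ln t))))) < 0"
proof -
  obtain E where E: "finite E" "\<And>a b. (a, b) \<in> E \<Longrightarrow> rational_vec a \<and> rational_vec b"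
    "\<And>x. x \<in> A \<and> x \<noteq> 0 \<longleftrightarrow> (\<exists>(K, w)\<in>wedges E. x \<in> K \<and> w \<bullet> x \<le> 1)"
    "bounded A" "0 \<in> A" "interior A \<noteq> {}"
    by (rule rational_star_polygon[OF assms]) (assumption | rule that)+
  obtain S :: "((real^2) set \<times> (real^2) set) set" and W h c B where
    S: "finite S" "\<And>s. s \<in> S \<Longrightarrow> W s \<ge> 0 \<and> h s > 0 \<and> h s \<in> \<rat>"
    "A \<in> lmeasurable" "measure lebesgue A = (\<Sum>s\<in>S. W s * h s / 2)"
    "\<And>t. t > 0 \<Longrightarrow> \<bar>real (card (lattice_in A t))
      - (measure lebesgue A * t\<^sup>2 - t * (\<Sum>s\<in>S. W s * saw (h s * t)) + c * t)\<bar> \<le> B"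
    by (rule lattice_count_of_wedges[OF E(1-4)]) (assumption | rule that)+
  \<comment> \<open>The area is the sum of the nonnegative terms W s h s / 2, and it is positive
    because A has interior points.\<close>
  have "\<exists>s\<in>S. W s > 0"
  proof (rule ccontr)
    assume "\<not> ?thesis"
    then have "W s = 0" if "s \<in> S" for s using S(2)[OF that] that by force
    then have "measure lebesgue A = 0" unfolding S(4) by (intro sum.neutral) auto
    then have "negligible A" using S(3) by (simp add: negligible_iff_measure)
    then have "negligible (interior A)" using interior_subset negligible_subset by blast
    then show False using E(6) open_not_negligible[OF open_interior] by blast
  qed
  moreover obtain R where R: "R > 0" "\<And>x. x \<in> A \<Longrightarrow> norm x \<le> R"
    using E(4) unfolding bounded_pos by blast
  ultimately show ?thesis
    by (intro Limsup_Liminf_of_lattice_count[OF R(2) R(1) S(1) S(5)]) (use S(2) in blast)+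
qed

end
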